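(* Suppose $(k_n)_{n\ge1}$ is a sequence of natural numbers that is both Hartman uniformly distributed and $L^p$-good universal for some $p>1$. Then for almost all $x\in\mathbb{R}$ with respect to Lebesgue measure we have $$\lim_{N\to\infty}\frac1N\sum_{n=1}^{N}\log\left|\zeta\left(\tfrac12+\tfrac12 iT^{k_n}x\right)\right|=\sum_{\rho:\Re(\rho)>\frac12}\log\left|\frac{\rho}{1-\rho}\right|,$$ where $\rho$ runs over the complex (non-trivial) zeros of the Riemann zeta function $\zeta$ with real part greater than $\frac12$, counted with multiplicity.
   Context: $T:\mathbb{R}\to\mathbb{R}$ is the map $T(x)=\frac12\left(x-\frac1x\right)$ for $x\neq0$, $T(0)=0$, and $T^n$ is its $n$-th iterate; it preserves and is ergodic for the probability measure $\mu(A)=\frac1\pi\int_A\frac{dt}{1+t^2}$. A dynamical system $(X,\mathcal{A},\mu,T)$ is a probability space together with a measurable, measure preserving map. A sequence of natural numbers $(k_n)_{n\ge1}$ is $L^p$-good universal if for every dynamical system $(X,\mathcal{A},\mu,T)$ and every $g\in L^p(X,\mathcal{A},\mu)$ the limit $\lim_{N\to\infty}\frac1N\sum_{n=1}^{N}g(T^{k_n}x)$ exists for $\mu$-almost every $x$. A sequence of natural numbers $(k_n)_{n\ge1}$ is Hartman uniformly distributed if it is uniformly distributed among the residue classes modulo $m$ for each natural number $m>1$, and for each irrational number $\theta$ the sequence of fractional parts $(\{k_n\theta\})_{n\ge1}$ is uniformly distributed modulo one. *)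

theory Defs
  imports "HOL-Probability.Probability" "HOL-Complex_Analysis.Complex_Analysis"
begin

text \<open>
  The analytic continuation of the Dirichlet series to the plane without \<open>1\<close>; it is unique since
  that domain is connected. The value at the pole is irrelevant and is fixed to be \<open>0\<close> only to make
  the description definite. Accordingly \<open>1\<close> has to be excluded from the zeros below.
\<close>

definition zeta :: "complex \<Rightarrow> complex" where
  "zeta = (THE f. f holomorphic_on (- {1}) \<and>
                  (\<forall>s. Re s > 1 \<longrightarrow> (\<lambda>n. 1 / of_nat (Suc n) powr s) sums f s) \<and>
                  f 1 = 0)"

definition nontrivial_zeta_zeros :: "complex set" where
  "nontrivial_zeta_zeros =
     {\<rho>. \<rho> \<noteq> 1 \<and> zeta \<rho> = 0} - {- 2 * of_nat n | n :: nat. n \<ge> 1}"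

definition boole_map :: "real \<Rightarrow> real" where
  "boole_map x = (if x = 0 then 0 else (x - 1 / x) / 2)"

definition dynamical_system :: "'a measure \<Rightarrow> ('a \<Rightarrow> 'a) \<Rightarrow> bool" where
  "dynamical_system M T \<longleftrightarrow> prob_space M \<and> T \<in> measurable M M \<and> distr M M T = M"

text \<open>
  A sequence \<open>(k\<^sub>n)\<close> with \<open>n \<ge> 1\<close> is a function on \<^typ>\<open>nat\<close> whose value at \<open>0\<close> is never used.
\<close>

definition Lp_good_universal_on :: "'a itself \<Rightarrow> real \<Rightarrow> (nat \<Rightarrow> nat) \<Rightarrow> bool" where
  "Lp_good_universal_on ty p k \<longleftrightarrow>
     (\<forall>(M :: 'a measure) T (g :: 'a \<Rightarrow> real).
        dynamical_system M T \<longrightarrow> g \<in> borel_measurable M \<longrightarrow> integrable M (\<lambda>x. \<bar>g x\<bar> powr p) \<longrightarrow>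
        (AE x in M. convergent (\<lambda>N. (\<Sum>n=1..N. g ((T ^^ k n) x)) / real N)))"

text \<open>
  HOL cannot quantify over all types of points inside a formula. It suffices to consider systems
  whose points are real sequences: a system together with a function \<open>g\<close> is represented there by the
  stationary process \<open>(g (T\<^sup>n x))\<^sub>n\<close> and the shift. The lemma \<open>Lp_good_universal_imp_on\<close> below shows
  that the definition covers systems on every type.
\<close>

definition Lp_good_universal :: "real \<Rightarrow> (nat \<Rightarrow> nat) \<Rightarrow> bool" where
  "Lp_good_universal p k \<longleftrightarrow> Lp_good_universal_on TYPE(nat \<Rightarrow> real) p k"

lemma Lp_good_universal_imp_on:
  assumes "Lp_good_universal p k"
  shows "Lp_good_universal_on TYPE('a) p k"
  unfolding Lp_good_universal_on_def
proof (intro allI impI)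
  fix M :: "'a measure" and T :: "'a \<Rightarrow> 'a" and g :: "'a \<Rightarrow> real"
  assume sys: "dynamical_system M T"
    and g [measurable]: "g \<in> borel_measurable M"
    and int: "integrable M (\<lambda>x. \<bar>g x\<bar> powr p)"
  from sys have ps: "prob_space M" and T [measurable]: "T \<in> measurable M M" and dT: "distr M M T = M"
    by (auto simp: dynamical_system_def)
  let ?P = "PiM (UNIV :: nat set) (\<lambda>_. borel :: real measure)"
  define \<Phi> where "\<Phi> = (\<lambda>x n. g ((T ^^ n) x))"
  define S where "S = (\<lambda>w :: nat \<Rightarrow> real. \<lambda>n. w (Suc n))"
  define M' where "M' = distr M ?P \<Phi>"
  have Tn: "T ^^ n \<in> measurable M M" for n
  proof (induction n)
    case (Suc n)
    then show ?case using T measurable_comp by fastforce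
  qed (simp add: id_def)
  have \<Phi>: "\<Phi> \<in> measurable M ?P"
    unfolding \<Phi>_def by (rule measurable_PiM_single') (use Tn g in \<open>auto intro: measurable_compose\<close>)
  have S: "S \<in> measurable ?P ?P"
    unfolding S_def by (rule measurable_PiM_single') (auto simp: space_PiM)
  have S\<Phi>: "S (\<Phi> x) = \<Phi> (T x)" for x
    by (simp add: S_def \<Phi>_def fun_eq_iff funpow_Suc_right del: funpow.simps)
  have Sn: "(S ^^ n) w m = w (n + m)" for n m w
    by (induction n arbitrary: m) (simp_all add: S_def)
  have ps': "prob_space M'"
    unfolding M'_def by (rule prob_space.prob_space_distr[OF ps \<Phi>])
  have sets': "sets M' = sets ?P" by (simp add: M'_def)
  have "distr M' M' S = distr (distr M ?P \<Phi>) ?P S"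
    by (rule distr_cong) (simp_all add: M'_def)
  also have "\<dots> = distr M ?P (S \<circ> \<Phi>)" by (rule distr_distr[OF S \<Phi>])
  also have "S \<circ> \<Phi> = \<Phi> \<circ> T" by (simp add: fun_eq_iff S\<Phi>)
  also have "distr M ?P (\<Phi> \<circ> T) = distr (distr M M T) ?P \<Phi>" by (rule distr_distr[OF \<Phi> T, symmetric])
  also have "\<dots> = M'" by (simp only: dT M'_def)
  finally have dS: "distr M' M' S = M'" .
  have sys': "dynamical_system M' S"
    using ps' S dS by (simp add: dynamical_system_def measurable_cong_sets[OF sets' sets'])
  have g': "(\<lambda>w. w 0) \<in> borel_measurable M'"
    by (simp add: measurable_cong_sets[OF sets' refl])
  have "integrable M' (\<lambda>w. \<bar>w 0\<bar> powr p)"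
    unfolding M'_def by (subst integrable_distr_eq[OF \<Phi>]) (use int in \<open>simp_all add: \<Phi>_def\<close>)
  with assms sys' g'
  have "AE w in M'. convergent (\<lambda>N. (\<Sum>n=1..N. (S ^^ k n) w 0) / real N)"
    unfolding Lp_good_universal_def Lp_good_universal_on_def by blast
  from AE_distrD[OF \<Phi> this[unfolded M'_def]]
  show "AE x in M. convergent (\<lambda>N. (\<Sum>n=1..N. g ((T ^^ k n) x)) / real N)"
    by (simp add: Sn \<Phi>_def)
qed

definition uniformly_distributed_mod_one :: "(nat \<Rightarrow> real) \<Rightarrow> bool" where
  "uniformly_distributed_mod_one u \<longleftrightarrow>
     (\<forall>a b. 0 \<le> a \<longrightarrow> a < b \<longrightarrow> b \<le> 1 \<longrightarrow>
        (\<lambda>N. real (card {n \<in> {1..N}. frac (u n) \<in> {a..<b}}) / real N) \<longlonglongrightarrow> b - a)"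

definition uniformly_distributed_residues :: "nat \<Rightarrow> (nat \<Rightarrow> nat) \<Rightarrow> bool" where
  "uniformly_distributed_residues m k \<longleftrightarrow>
     (\<forall>a<m. (\<lambda>N. real (card {n \<in> {1..N}. k n mod m = a}) / real N) \<longlonglongrightarrow> 1 / real m)"

definition hartman_uniformly_distributed :: "(nat \<Rightarrow> nat) \<Rightarrow> bool" where
  "hartman_uniformly_distributed k \<longleftrightarrow>
     (\<forall>m>1. uniformly_distributed_residues m k) \<and>
     (\<forall>\<theta>. \<theta> \<notin> \<rat> \<longrightarrow> uniformly_distributed_mod_one (\<lambda>n. real (k n) * \<theta>))"

definition right_zeta_zeros :: "complex set" where
  "right_zeta_zeros = {\<rho> \<in> nontrivial_zeta_zeros. Re \<rho> > 1 / 2}"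

text \<open>The order \<^term>\<open>zorder zeta \<rho>\<close> is the multiplicity of the zero \<open>\<rho>\<close>.\<close>

definition zeta_zero_term :: "complex \<Rightarrow> real" where
  "zeta_zero_term \<rho> = of_int (zorder zeta \<rho>) * ln (norm (\<rho> / (1 - \<rho>)))"

end

theory Submission
  imports Defs "HOL-Real_Asymp.Real_Asymp"
begin

text \<open>
  The substitution \<open>x = cot (\<pi> \<theta>)\<close> turns \<^term>\<open>boole_map\<close> into the doubling map
  \<open>\<theta> \<mapsto> 2 \<theta> mod 1\<close> and the Cauchy distribution into Lebesgue measure on \<open>[0, 1)\<close>.
  By local applications of the Poisson--Jensen formula, \<open>log |\<zeta>|\<close> on the critical line lies in
  every \<open>L\<^sup>q\<close>, \<open>q < \<infinity>\<close>, for this measure, so the averages converge almost everywhere. The limit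
  is constant: the orbits of the doubling map mix exponentially fast, and \<open>2\<^bsup>-k n\<^esup>\<close> tends to
  \<open>0\<close> in the mean since \<open>k\<close> is equidistributed modulo every integer; this settles bounded
  functions, and truncation settles the others. Hence the limit is the mean of \<open>log |\<zeta>|\<close> for the
  Cauchy distribution. It is evaluated by Jensen's formula on the disc for
  \<open>F w = (1 - w)\<^sup>2 (s - 1) \<zeta> s / M\<close>, where \<open>s = 1 / (1 - w)\<close>; the singularity of \<open>F\<close> at
  \<open>w = 1\<close> carries no mass because \<open>|\<zeta>|\<close> is bounded below near \<open>+\<infinity>\<close>.
\<close>

section \<open>The zeta function\<close>

text \<open>The exponent in the hypothesis of good universality may be arbitrarily large, so every
  power of log |zeta| has to be integrable. Number and position of the zeros near the critical line
  are unknown; Jensen's formula at the centre of a disc bounds only the total weight of its zeros,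
  and convexity turns this into a bound for q-th powers that is uniform in their position. To
  identify the limit of the averages, it is enough to test it against half lines, and dyadic
  intervals make the correlations of the doubling map with these explicit. The square in
  \<open>(1 - w)^2\<close> matches the quadratic growth of (s - 1) zeta(s) in Re s >= 1/2 and makes
  \<open>F\<close> bounded by 1. Zeros of \<open>F\<close> may accumulate at w = 1, so Jensen's
  formula has to be obtained as a limit from smaller circles, and in such a limit a point mass at w
  = 1 could be lost.\<close>

text \<open>
  The remainder of the binomial expansion of \<open>n \<mapsto> n\<^bsup>1 - s\<^esup>\<close>. Summing it over \<open>n\<close> telescopes and
  expresses \<open>(s - 1) \<zeta> s\<close> by values of \<open>\<zeta>\<close> further to the right, which continues it.
\<close>

definition zeta_rem :: "nat \<Rightarrow> nat \<Rightarrow> complex \<Rightarrow> complex" where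
  "zeta_rem K m s = of_nat (Suc (Suc m)) powr (1 - s) -
     (\<Sum>j\<le>K. ((1 - s) gchoose j) * of_nat (Suc m) powr (1 - s - of_nat j))"

lemma norm_of_real_powr: "x > 0 \<Longrightarrow> norm (of_real x powr s :: complex) = x powr Re s"
  by (simp add: norm_powr_real_powr)

lemma norm_of_nat_powr: "n > 0 \<Longrightarrow> norm (of_nat n powr s :: complex) = real n powr Re s"
  using norm_of_real_powr[of "real n" s] by simp

text \<open>Taylor's formula for \<open>x powr (1 - s)\<close> between \<open>m + 1\<close> and
  \<open>m + 2\<close>, a step of length 1. By the hypothesis the derivative of order
  \<open>K + 1\<close> does not increase in modulus along the segment, so its value at the left end
  bounds it.\<close>

lemma norm_zeta_rem_le:
  assumes "Re s + real K \<ge> 0"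
  shows "norm (zeta_rem K m s) \<le> (\<Prod>l\<le>K. norm (1 - s - of_nat l)) * real (Suc m) powr (- Re s - real K)"
proof -
  define f where "f = (\<lambda>i (x::complex). (\<Prod>l<i. 1 - s - of_nat l) * x powr (1 - s - of_nat i))"
  define w z :: complex where "w = of_nat (Suc m)" and "z = of_nat (Suc (Suc m))"
  define S where "S = closed_segment w z"
  define B where "B = (\<Prod>l\<le>K. norm (1 - s - of_nat l)) * real (Suc m) powr (- Re s - real K)"
  have S_eq: "S = of_real ` closed_segment (real (Suc m)) (real (Suc (Suc m)))"
    using closed_segment_of_real[of "real (Suc m)" "real (Suc (Suc m))", where 'a = complex]
    by (simp add: S_def w_def z_def)
  have "norm (f 0 z - (\<Sum>i\<le>K. f i w * (z-w)^i / fact i)) \<le> B * norm (z-w)^(Suc K) / fact K"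
  proof (rule complex_Taylor[of S])
    show "convex S" "w \<in> S" "z \<in> S" by (auto simp: S_def)
    fix x assume "x \<in> S"
    then obtain y where y: "x = of_real y" "y \<ge> real (Suc m)"
      by (auto simp: S_eq closed_segment_eq_real_ivl)
    have "x \<notin> \<real>\<^sub>\<le>\<^sub>0" using y by (auto simp: complex_nonpos_Reals_iff)
    then show "(f i has_field_derivative f (Suc i) x) (at x within S)" for i
      unfolding f_def by (auto intro!: derivative_eq_intros simp: algebra_simps)
    have "norm (f (Suc K) x) = (\<Prod>l\<le>K. norm (1 - s - of_nat l)) * y powr (- Re s - real K)"
      using y by (simp add: f_def norm_mult prod_norm[symmetric] norm_of_real_powr lessThan_Suc_atMost)
    also have "\<dots> \<le> B"
      unfolding B_def using y assms by (intro mult_left_mono powr_mono2') (auto intro: prod_nonneg)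
    finally show "norm (f (Suc K) x) \<le> B" .
  qed
  also have "z - w = 1" by (simp add: z_def w_def)
  also have "f 0 z - (\<Sum>i\<le>K. f i w * 1 ^ i / fact i) = zeta_rem K m s"
    by (simp add: f_def zeta_rem_def gbinomial_prod_rev z_def w_def atLeast0LessThan mult.commute)
  finally have "norm (zeta_rem K m s) \<le> B / fact K" by simp
  also have "\<dots> \<le> B / 1"
    by (intro divide_left_mono) (auto simp: B_def intro!: mult_nonneg_nonneg prod_nonneg)
  finally show ?thesis by (simp add: B_def)
qed

lemma summable_Suc_powr: "c > 1 \<Longrightarrow> summable (\<lambda>m. real (Suc m) powr (- c))"
  by (subst summable_Suc_iff, subst summable_real_powr_iff) auto

text \<open>Weierstrass test on small balls. With \<open>d\<close> half the distance of
  \<open>x\<close> from the boundary line, every \<open>y\<close> in the ball satisfies Re y + K >=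
  1 + d, so the terms are dominated by a multiple of (m + 1)^(-1 - d).\<close>

lemma holomorphic_zeta_rem_sum:
  "(\<lambda>s. \<Sum>m. zeta_rem K m s) holomorphic_on {s. Re s > 1 - real K}"
proof -
  let ?S = "{s. Re s > 1 - real K}"
  have op: "open ?S" by (simp add: open_halfspace_Re_gt)
  obtain g where g: "\<And>x. x \<in> ?S \<Longrightarrow> (\<lambda>m. zeta_rem K m x) sums g x \<and> g field_differentiable (at x)"
  proof (rule series_differentiable_comparison_complex[OF op])
    fix m and x :: complex assume "x \<in> ?S"
    have "(\<lambda>s. ((1 - s) gchoose j)) holomorphic_on UNIV" for j
      by (subst gbinomial_prod_rev) (auto intro!: holomorphic_intros)
    then have "zeta_rem K m holomorphic_on UNIV"
      unfolding zeta_rem_def by (intro holomorphic_intros) auto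
    then show "zeta_rem K m field_differentiable (at x)"
      by (auto simp: holomorphic_on_def)
  next
    fix x assume x: "x \<in> ?S"
    define d where "d = (Re x - (1 - real K)) / 2"
    define C where "C = (\<Prod>l\<le>K. 1 + norm x + d + real l)"
    have d: "d > 0" using x by (auto simp: d_def)
    have C: "C \<ge> 0" unfolding C_def using d by (intro prod_nonneg) auto
    have *: "norm (zeta_rem K m y) \<le> C * real (Suc m) powr (- (1 + d))" if "y \<in> ball x d \<inter> ?S" for y m
    proof -
      have "norm (x - y) < d" using that by (auto simp: dist_norm)
      then have r: "Re y + real K \<ge> 1 + d" and n: "norm y \<le> norm x + d"
        using complex_Re_le_cmod[of "x - y"] norm_triangle_ineq2[of y x]
        by (auto simp: d_def norm_minus_commute field_simps)
      have "norm (zeta_rem K m y) \<le> (\<Prod>l\<le>K. norm (1 - y - of_nat l)) * real (Suc m) powr (- (Re y + real K))"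
        using norm_zeta_rem_le[of y K m] r d by simp
      also have "\<dots> \<le> C * real (Suc m) powr (- (1 + d))"
      proof (intro mult_mono)
        show "(\<Prod>l\<le>K. norm (1 - y - of_nat l)) \<le> C"
          unfolding C_def
        proof (intro prod_mono conjI)
          fix l
          have "norm (1 - y - of_nat l) \<le> norm (1 - y) + norm (of_nat l :: complex)"
            by (rule norm_triangle_ineq4)
          also have "\<dots> \<le> 1 + norm y + real l"
            using norm_triangle_ineq4[of 1 y] by simp
          finally show "norm (1 - y - of_nat l) \<le> 1 + norm x + d + real l" using n by simp
        qed auto
        show "real (Suc m) powr (- (Re y + real K)) \<le> real (Suc m) powr (- (1 + d))"
          using r by (intro powr_mono) auto
      qed (use C in auto)
      finally show ?thesis .
    qed
    show "\<exists>d h. 0 < d \<and> summable h \<and> range h \<subseteq> \<real>\<^sub>\<ge>\<^sub>0 \<and>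
        (\<forall>\<^sub>F m in sequentially. \<forall>y\<in>ball x d \<inter> ?S. cmod (zeta_rem K m y) \<le> cmod (h m))"
    proof (intro exI conjI)
      show "summable (\<lambda>m. of_real (C * real (Suc m) powr (- (1 + d))) :: complex)"
        by (intro summable_of_real summable_mult summable_Suc_powr) (use d in auto)
      show "range (\<lambda>m. of_real (C * real (Suc m) powr (- (1 + d))) :: complex) \<subseteq> \<real>\<^sub>\<ge>\<^sub>0"
        using C by (auto intro!: mult_nonneg_nonneg)
      show "\<forall>\<^sub>F m in sequentially. \<forall>y\<in>ball x d \<inter> ?S.
              cmod (zeta_rem K m y) \<le> cmod (of_real (C * real (Suc m) powr (- (1 + d))) :: complex)"
        using * C by (intro always_eventually allI ballI) (auto simp del: of_real_mult of_nat_Suc)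
    qed fact
  qed blast
  have "g holomorphic_on ?S"
    unfolding holomorphic_on_def using g by (auto intro: field_differentiable_at_within)
  then show ?thesis
    using g by (elim holomorphic_transform) (auto dest: sums_unique)
qed

section \<open>Continuation of (s - 1) zeta(s) by a recursion in half planes\<close>

definition zeta_series :: "complex \<Rightarrow> complex" where
  "zeta_series s = (\<Sum>n. 1 / of_nat (Suc n) powr s)"

lemma zeta_series_sums:
  assumes "Re s > 1"
  shows "(\<lambda>n. 1 / of_nat (Suc n) powr s) sums zeta_series s"
proof -
  have "norm (1 / of_nat (Suc n) powr s) = real (Suc n) powr (- Re s)" for n
    by (simp only: norm_divide norm_one norm_of_nat_powr[OF zero_less_Suc] powr_minus_divide)
  then have "summable (\<lambda>n. norm (1 / of_nat (Suc n) powr s))"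
    using summable_Suc_powr[OF assms] by simp
  then show ?thesis unfolding zeta_series_def by (rule summable_sums[OF summable_norm_cancel])
qed

text \<open>Level \<open>K + 1\<close> represents (s - 1) zeta(s) on Re s > -K. The previous level
  enters at s + 1, ..., s + K, at least one unit further right. Continuing this product instead of
  zeta keeps all levels free of poles.\<close>

fun zeta_reg_approx :: "nat \<Rightarrow> complex \<Rightarrow> complex" where
  "zeta_reg_approx 0 s = (s - 1) * zeta_series s"
| "zeta_reg_approx (Suc K) s =
     1 - (\<Sum>i<K. ((1 - s) gchoose (i + 1)) / of_nat (i + 2) * zeta_reg_approx K (s + of_nat i + 1))
       + (\<Sum>m. zeta_rem (Suc K) m s)"

text \<open>Sum the binomial expansion over \<open>m\<close>. The leading power and the terms of
  order 0 telescope to -1, because (m + 1)^(1 - s) tends to 0 for Re s > 1; order j + 1 yields a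
  multiple of zeta(s + j). The equation is then solved for the term with j = 0.\<close>

lemma zeta_series_recursion:
  assumes s: "Re s > 1"
  shows "(s - 1) * zeta_series s = 1 -
     (\<Sum>i<K. ((1 - s) gchoose (i + 1)) / of_nat (i + 2) * ((s + of_nat i) * zeta_series (s + of_nat i + 1)))
     + (\<Sum>m. zeta_rem (Suc K) m s)"
proof -
  have "(\<lambda>m. zeta_rem (Suc K) m s) sums
      (0 - of_nat (Suc 0) powr (1 - s) - (\<Sum>j<Suc K. ((1-s) gchoose (Suc j)) * zeta_series (s + of_nat j)))"
  proof -
    have eq: "(\<lambda>m. zeta_rem (Suc K) m s) = (\<lambda>m. of_nat (Suc (Suc m)) powr (1 - s) - of_nat (Suc m) powr (1 - s) -
       (\<Sum>j<Suc K. ((1-s) gchoose (Suc j)) * (1 / of_nat (Suc m) powr (s + of_nat j))))"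
    proof
      fix m
      have "(\<Sum>j\<le>Suc K. ((1 - s) gchoose j) * of_nat (Suc m) powr (1 - s - of_nat j)) =
         of_nat (Suc m) powr (1 - s) + (\<Sum>j<Suc K. ((1-s) gchoose (Suc j)) * of_nat (Suc m) powr (1 - s - of_nat (Suc j)))"
        by (simp only: lessThan_Suc_atMost[symmetric] sum.lessThan_Suc_shift[of _ "Suc K"]) simp
      moreover have "of_nat (Suc m) powr (1 - s - of_nat (Suc j)) = 1 / of_nat (Suc m) powr (s + of_nat j)" for j
        by (simp only: powr_minus_divide[symmetric]) (simp add: algebra_simps)
      ultimately show "zeta_rem (Suc K) m s = of_nat (Suc (Suc m)) powr (1 - s) - of_nat (Suc m) powr (1 - s) -
         (\<Sum>j<Suc K. ((1-s) gchoose (Suc j)) * (1 / of_nat (Suc m) powr (s + of_nat j)))"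
        unfolding zeta_rem_def by simp
    qed
    have "(\<lambda>m. of_nat (Suc (Suc m)) powr (1 - s) - of_nat (Suc m) powr (1 - s)) sums
        (0 - of_nat (Suc 0) powr (1 - s))"
    proof (rule telescope_sums)
      have "(\<lambda>n. norm (of_nat (Suc n) powr (1 - s) :: complex)) \<longlonglongrightarrow> 0"
      proof -
        have "(\<lambda>n. real (Suc n) powr (1 - Re s)) \<longlonglongrightarrow> 0" using s by real_asymp
        then show ?thesis by (simp only: norm_of_nat_powr[OF zero_less_Suc]) simp
      qed
      then show "(\<lambda>n. of_nat (Suc n) powr (1 - s) :: complex) \<longlonglongrightarrow> 0" by (simp only: tendsto_norm_zero_iff)
    qed
    moreover have "(\<lambda>m. \<Sum>j<Suc K. ((1-s) gchoose (Suc j)) * (1 / of_nat (Suc m) powr (s + of_nat j))) sums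
        (\<Sum>j<Suc K. ((1-s) gchoose (Suc j)) * zeta_series (s + of_nat j))"
      using s by (intro sums_sum sums_mult zeta_series_sums) auto
    ultimately show ?thesis unfolding eq by (rule sums_diff)
  qed
  then have *: "(\<Sum>m. zeta_rem (Suc K) m s) = - 1 - (1 - s) * zeta_series s -
      (\<Sum>i<K. ((1-s) gchoose (Suc (Suc i))) * zeta_series (s + of_nat i + 1))"
    by (simp only: sums_iff sum.lessThan_Suc_shift) (simp add: algebra_simps)
  \<comment> \<open>The extracted factor s + i is what regularises zeta(s + i + 1): together they
    are (z - 1) zeta(z) at z = s + i + 1.\<close>
  have **: "((1-s) gchoose (Suc (Suc i))) = - (((1 - s) gchoose (i + 1)) / of_nat (i + 2) * (s + of_nat i))" for i
  proof -
    define A B where "A = ((1-s) gchoose (Suc (Suc i)))" and "B = ((1-s) gchoose (Suc i))"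
    have "(1 - s) * B = of_nat (Suc i) * B + of_nat (Suc (Suc i)) * A"
      unfolding A_def B_def by (rule gbinomial_mult_1)
    then have "A * of_nat (Suc (Suc i)) = B * (- (s + of_nat i))" by (simp add: algebra_simps) algebra
    then have "A = B * (- (s + of_nat i)) / of_nat (Suc (Suc i))"
      by (subst nonzero_eq_divide_eq) (simp_all del: of_nat_Suc)
    also have "\<dots> = - (B / of_nat (Suc (Suc i)) * (s + of_nat i))"
      by (simp only: mult_minus_right times_divide_eq_left minus_divide_left)
    finally show ?thesis by (simp add: A_def B_def)
  qed
  define S where "S = (\<Sum>i<K. ((1 - s) gchoose (i + 1)) / of_nat (i + 2) *
    ((s + of_nat i) * zeta_series (s + of_nat i + 1)))"
  have "(\<Sum>i<K. ((1-s) gchoose (Suc (Suc i))) * zeta_series (s + of_nat i + 1)) = - S"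
    unfolding S_def ** by (simp only: sum_negf[symmetric] mult_minus_left mult.assoc)
  then show ?thesis unfolding * S_def[symmetric] by (simp add: algebra_simps)
qed

lemma zeta_reg_approx_eq: "Re s > 1 \<Longrightarrow> zeta_reg_approx K s = (s - 1) * zeta_series s"
proof (induction K arbitrary: s)
  case (Suc K)
  then have "zeta_reg_approx K (s + of_nat i + 1) = (s + of_nat i) * zeta_series (s + of_nat i + 1)" for i
    by (subst Suc.IH) auto
  then show ?case using zeta_series_recursion[OF Suc.prems, of K] by simp
qed simp

lemma holomorphic_zeta_reg_approx: "zeta_reg_approx (Suc K) holomorphic_on {s. Re s > - real K}"
proof (induction K)
  case 0
  have "(\<lambda>s. 1 + (\<Sum>m. zeta_rem 1 m s)) holomorphic_on {s. Re s > - real 0}"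
    using holomorphic_zeta_rem_sum[of 1] by (intro holomorphic_intros) simp
  then show ?case by simp
next
  case (Suc K)
  have 1: "(\<lambda>s. zeta_reg_approx (Suc K) (s + of_nat i + 1)) holomorphic_on {s. Re s > - real (Suc K)}" for i
  proof -
    have "zeta_reg_approx (Suc K) \<circ> (\<lambda>s. s + of_nat i + 1) holomorphic_on {s. Re s > - real (Suc K)}"
      by (rule holomorphic_on_compose_gen[OF _ Suc.IH]) (auto intro!: holomorphic_intros)
    then show ?thesis by (simp only: o_def)
  qed
  have 2: "(\<lambda>s. ((1 - s) gchoose j)) holomorphic_on A" for j A
    by (subst gbinomial_prod_rev) (auto intro!: holomorphic_intros)
  have 3: "(\<lambda>s. \<Sum>m. zeta_rem (Suc (Suc K)) m s) holomorphic_on {s. Re s > - real (Suc K)}"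
    using holomorphic_zeta_rem_sum[of "Suc (Suc K)"] by simp
  show ?case
    unfolding zeta_reg_approx.simps(2)[of "Suc K" , abs_def]
    by (intro holomorphic_intros 1 2 3) auto
qed

text \<open>The entire function (s - 1) zeta(s). The level varies with \<open>s\<close> and is large
  enough for its half plane to contain \<open>s\<close>; that all admissible levels agree is
  \<open>zeta_reg_eq_approx\<close>.\<close>

definition zeta_reg :: "complex \<Rightarrow> complex" where
  "zeta_reg s = zeta_reg_approx (Suc (nat \<lfloor>\<bar>Re s\<bar>\<rfloor> + 1)) s"

text \<open>Any two levels coincide on Re s > 1, hence by the identity theorem on the smaller of
  their half planes.\<close>

lemma zeta_reg_eq_approx:
  assumes "Re s > - real K"
  shows "zeta_reg s = zeta_reg_approx (Suc K) s"
proof -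
  have eq: "zeta_reg_approx (Suc K) s = zeta_reg_approx (Suc L) s" if "Re s > - real K" "K \<le> L" for K L
  proof (rule analytic_continuation_open[of "{s. Re s > 1}" "{s. Re s > - real K}" "zeta_reg_approx (Suc K)" "zeta_reg_approx (Suc L)"])
    show "zeta_reg_approx (Suc L) holomorphic_on {s. - real K < Re s}"
      using that by (intro holomorphic_on_subset[OF holomorphic_zeta_reg_approx[of L]]) auto
    show "{s. Re s > 1} \<noteq> {}" by (auto intro: exI[of _ 2])
    show "{s. 1 < Re s} \<subseteq> {s. - real K < Re s}" by auto
  qed (use that in \<open>auto simp: open_halfspace_Re_gt convex_connected convex_halfspace_Re_gt
            holomorphic_zeta_reg_approx zeta_reg_approx_eq simp del: zeta_reg_approx.simps\<close>)
  define L where "L = nat \<lfloor>\<bar>Re s\<bar>\<rfloor> + 1"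
  have L: "Re s > - real L" unfolding L_def by linarith
  show ?thesis
    using eq[of K "max K L"] eq[of L "max K L"] assms L by (simp add: zeta_reg_def L_def del: zeta_reg_approx.simps)
qed

lemma holomorphic_zeta_reg: "zeta_reg holomorphic_on A"
proof -
  have "zeta_reg field_differentiable (at s)" for s
  proof -
    obtain K where K: "Re s > - real K" by (metis minus_less_iff reals_Archimedean2)
    have op: "open {s. Re s > - real K}" by (simp add: open_halfspace_Re_gt)
    have "zeta_reg holomorphic_on {s. Re s > - real K}"
      using holomorphic_zeta_reg_approx[of K] by (rule holomorphic_transform) (auto simp: zeta_reg_eq_approx simp del: zeta_reg_approx.simps)
    then show ?thesis using K op holomorphic_on_imp_differentiable_at by blast
  qed
  then show ?thesis by (auto simp: holomorphic_on_def intro: field_differentiable_at_within)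
qed

lemma zeta_reg_eq_series: "Re s > 1 \<Longrightarrow> zeta_reg s = (s - 1) * zeta_series s"
  using zeta_reg_eq_approx[of 0 s] zeta_reg_approx_eq[of s 1] by (simp del: zeta_reg_approx.simps)

text \<open>Makes the definite description usable: the quotient meets the three conditions, and any
  other candidate agrees with it on Re s > 1 and therefore on the punctured plane, which is
  connected.\<close>

lemma zeta_eq: "zeta = (\<lambda>s. if s = 1 then 0 else zeta_reg s / (s - 1))"
  unfolding zeta_def
proof (rule the_equality)
  let ?f = "\<lambda>s. if s = 1 then 0 else zeta_reg s / (s - 1)"
  have "(\<lambda>s. zeta_reg s / (s - 1)) holomorphic_on (-{1})"
    by (intro holomorphic_intros holomorphic_zeta_reg) auto
  then have 1: "?f holomorphic_on (-{1})" by (rule holomorphic_transform) auto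
  have 2: "?f s = zeta_series s" if "Re s > 1" for s
    using zeta_reg_eq_series[OF that] that by auto
  show P: "?f holomorphic_on (- {1}) \<and> (\<forall>s. Re s > 1 \<longrightarrow> (\<lambda>n. 1 / of_nat (Suc n) powr s) sums ?f s) \<and> ?f 1 = 0"
    using 1 2 zeta_series_sums by (auto simp del: of_nat_Suc)
  fix f :: "complex \<Rightarrow> complex"
  assume f: "f holomorphic_on (- {1}) \<and> (\<forall>s. Re s > 1 \<longrightarrow> (\<lambda>n. 1 / of_nat (Suc n) powr s) sums f s) \<and> f 1 = 0"
  have "f s = ?f s" if "s \<noteq> 1" for s
  proof (rule analytic_continuation_open[of "{s. Re s > 1}" "-{1}" f ?f])
    show "{s. Re s > 1} \<noteq> {}" by (auto intro: exI[of _ 2])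
    show "connected (- {1 :: complex})"
      using connected_open_delete[OF open_UNIV connected_UNIV, of "1::complex"] by (simp add: Compl_eq_Diff_UNIV)
    show "f z = ?f z" if "z \<in> {s. Re s > 1}" for z
      using f P that sums_unique2 by blast
  qed (use f 1 that in \<open>auto simp: open_halfspace_Re_gt\<close>)
  then show "f = ?f" using f by auto
qed

text \<open>Level 1 already covers this half plane. Each remainder is at most |s| |s - 1| (m +
  1)^(-Re s - 1), and Re s >= 1/4 makes 5/4 a uniform exponent of convergence. The margin to the
  left of 1/2 accommodates the discs of radius 7/4 around 2 + ik used later.\<close>

lemma zeta_reg_bound:
  obtains C where "C > 0" "\<And>s. Re s \<ge> 1/4 \<Longrightarrow> norm (zeta_reg s - 1) \<le> C * norm s * norm (s - 1)"
proof -
  define C where "C = (\<Sum>m. real (Suc m) powr (- (5/4)))"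
  have sm: "summable (\<lambda>m. real (Suc m) powr (- (5/4)))" by (rule summable_Suc_powr) simp
  have "norm (zeta_reg s - 1) \<le> (C + 1) * norm s * norm (s - 1)" if s: "Re s \<ge> 1/4" for s
  proof -
    have "zeta_reg s = 1 + (\<Sum>m. zeta_rem 1 m s)"
      using s by (subst zeta_reg_eq_approx[of 0]) auto
    moreover have "norm (\<Sum>m. zeta_rem 1 m s) \<le> (\<Sum>m. norm (s - 1) * norm s * real (Suc m) powr (- (5/4)))"
    proof (rule norm_suminf_le[OF _ summable_mult[OF sm]])
      fix m
      have "norm (zeta_rem 1 m s) \<le> norm (1 - s) * norm (1 - s - 1) * real (Suc m) powr (- Re s - 1)"
        using norm_zeta_rem_le[of s 1 m] s by simp
      also have "\<dots> \<le> norm (s - 1) * norm s * real (Suc m) powr (- (5/4))"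
        using s by (intro mult_mono powr_mono) (auto simp: norm_minus_commute)
      finally show "norm (zeta_rem 1 m s) \<le> norm (s - 1) * norm s * real (Suc m) powr (- (5/4))" .
    qed
    moreover have "(\<Sum>m. norm (s - 1) * norm s * real (Suc m) powr (- (5/4))) = C * norm s * norm (s - 1)"
      using suminf_mult[OF sm, of "norm (s-1) * norm s"] by (simp add: C_def mult_ac)
    ultimately have "norm (zeta_reg s - 1) \<le> C * norm s * norm (s - 1)" by simp
    also have "\<dots> \<le> (C + 1) * norm s * norm (s - 1)" by (intro mult_right_mono) auto
    finally show ?thesis .
  qed
  moreover have "C \<ge> 0" unfolding C_def by (intro suminf_nonneg sm) auto
  ultimately show ?thesis using that[of "C + 1"] by auto
qed

lemma zeta_reg_1 [simp]: "zeta_reg 1 = 1"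
proof (rule zeta_reg_bound)
  fix C assume "\<And>s. Re s \<ge> 1/4 \<Longrightarrow> norm (zeta_reg s - 1) \<le> C * norm s * norm (s - 1)"
  from this[of 1] show ?thesis by simp
qed

text \<open>Without its first term 1 the series is at most pi^2/6 - 1 in modulus, and pi <= 3.15
  puts this below 3/4.\<close>

lemma norm_zeta_series_ge:
  assumes "Re s \<ge> 2"
  shows "norm (zeta_series s) \<ge> 1/4"
proof -
  have "(\<lambda>n. 1 / of_nat (Suc n) powr s) sums zeta_series s"
    by (rule zeta_series_sums) (use assms in linarith)
  then have "(\<lambda>n. 1 / of_nat (Suc (Suc n)) powr s) sums (zeta_series s - 1)"
    using sums_Suc_iff[of "\<lambda>n. 1 / of_nat (Suc n) powr s" "zeta_series s - 1"] by simp
  moreover have "(\<lambda>n. 1 / real (Suc n)^2) sums (pi\<^sup>2/6)"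
    using inverse_squares_sums by (simp add: add.commute)
  then have sm: "(\<lambda>n. 1 / real (Suc (Suc n))^2) sums (pi\<^sup>2/6 - 1)"
    using sums_Suc_iff[of "\<lambda>n. 1 / real (Suc n)^2" "pi\<^sup>2/6 - 1"] by simp
  moreover have "norm (1 / of_nat (Suc (Suc n)) powr s) \<le> 1 / real (Suc (Suc n))^2" for n
  proof -
    have "norm (1 / of_nat (Suc (Suc n)) powr s) = 1 / real (Suc (Suc n)) powr Re s"
      by (simp only: norm_divide norm_one norm_of_nat_powr[OF zero_less_Suc])
    also have "\<dots> \<le> 1 / real (Suc (Suc n)) powr 2"
      using assms by (intro divide_left_mono powr_mono) auto
    finally show ?thesis by simp
  qed
  ultimately have "norm (zeta_series s - 1) \<le> pi\<^sup>2/6 - 1"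
    using norm_suminf_le[of "\<lambda>n. 1 / of_nat (Suc (Suc n)) powr s" "\<lambda>n. 1 / real (Suc (Suc n))^2"]
    by (simp only: sums_iff)
  moreover have "pi\<^sup>2 \<le> 3.15\<^sup>2" using pi_approx pi_ge_zero by (intro power_mono) auto
  moreover have "norm (1::complex) - norm (zeta_series s - 1) \<le> norm (zeta_series s)"
    using norm_triangle_ineq4[of "zeta_series s" "zeta_series s - 1"] by simp
  ultimately show ?thesis by (simp add: power2_eq_square)
qed

section \<open>Zeros of holomorphic functions on compact convex sets\<close>

lemma zorder_prod_power:
  fixes m :: "complex \<Rightarrow> nat"
  assumes "finite Z"
  shows "zorder (\<lambda>z. \<Prod>x\<in>Z. (z - x) ^ m x) a = (if a \<in> Z then int (m a) else 0)"
proof (rule zorder_eqI[of UNIV _ "\<lambda>z. \<Prod>x\<in>Z - {a}. (z - x) ^ m x"])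
  fix w assume "w \<noteq> a"
  show "(\<Prod>x\<in>Z. (w - x) ^ m x) = (\<Prod>x\<in>Z - {a}. (w - x) ^ m x) * (w - a) powi (if a \<in> Z then int (m a) else 0)"
    using assms by (auto simp: prod.remove mult.commute)
qed (use assms in \<open>auto intro!: holomorphic_intros\<close>)

text \<open>\<open>A\<close> is convex so that the zero-free factor \<open>h\<close> has a
  holomorphic logarithm there. A compact neighbourhood of \<open>K\<close> contains finitely many
  zeros; removing those outside \<open>K\<close> leaves an open set around \<open>K\<close>, and in
  it a uniform neighbourhood of \<open>K\<close>, convex as the Minkowski sum of \<open>K\<close>
  and a ball.\<close>

lemma factor_zeros_compact_convex:
  fixes f :: "complex \<Rightarrow> complex"
  assumes K: "compact K" "convex K" "K \<subseteq> S" and S: "open S" and f: "f holomorphic_on S"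
    and nz: "z0 \<in> K" "f z0 \<noteq> 0"
  obtains A h where "open A" "convex A" "K \<subseteq> A" "A \<subseteq> S" "finite {a\<in>K. f a = 0}"
    "h holomorphic_on A" "\<And>z. z \<in> A \<Longrightarrow> h z \<noteq> 0"
    "\<And>z. z \<in> A \<Longrightarrow> f z = h z * (\<Prod>a\<in>{a\<in>K. f a = 0}. (z - a) ^ nat (zorder f a))"
proof -
  define Z where "Z = {a\<in>K. f a = 0}"
  obtain e where e: "e > 0" "(\<Union>x\<in>K. ball x e) \<subseteq> S"
    using compact_subset_open_imp_ball_epsilon_subset[OF K(1) S K(3)] .
  define nb where "nb = (\<lambda>r. \<Union>x\<in>K. ball x (r::real))"
  have mem_sum: "z \<in> (\<Union>x\<in>K. \<Union>y\<in>T. {x + y}) \<longleftrightarrow> (\<exists>x\<in>K. z - x \<in> T)" for z and T :: "complex set"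
  proof
    assume "\<exists>x\<in>K. z - x \<in> T"
    then obtain x where "x \<in> K" "z - x \<in> T" ..
    moreover have "z = x + (z - x)" by simp
    ultimately show "z \<in> (\<Union>x\<in>K. \<Union>y\<in>T. {x + y})" by blast
  qed force
  have nb_eq: "nb r = (\<Union>x\<in>K. \<Union>y\<in>ball 0 r. {x + y})" for r
    by (rule set_eqI, unfold mem_sum) (simp add: nb_def dist_norm norm_minus_commute)
  have nb_convex: "convex (nb r)" for r
    using convex_sums[OF K(2) convex_ball, of 0 r] by (simp only: nb_eq)
  have nb_open: "open (nb r)" for r by (auto simp: nb_def)
  define K' where "K' = (\<Union>x\<in>K. \<Union>y\<in>cball 0 (e/2). {x + y})"
  have K': "compact K'" unfolding K'_def by (rule compact_sums'[OF K(1) compact_cball])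
  have K'nb: "K' \<subseteq> nb e" and nbK': "nb (e/2) \<subseteq> K'"
    using e(1) unfolding K'_def nb_eq subset_iff mem_sum by force+
  have KK': "K \<subseteq> K'" using e(1) by (force simp: K'_def)
  have fin: "finite {a\<in>K'. f a = 0}"
  proof (cases "f constant_on nb e")
    case True
    moreover have "z0 \<in> nb e" using nz KK' K'nb by auto
    ultimately have "{a\<in>K'. f a = 0} = {}"
      using nz K'nb by (force simp: constant_on_def)
    then show ?thesis by (simp only: finite.emptyI)
  next
    case False
    have "f holomorphic_on nb e" using f e(2) unfolding nb_def by (rule holomorphic_on_subset)
    then show ?thesis
      by (rule holomorphic_compact_finite_zeros[OF _ nb_open convex_connected[OF nb_convex] K' K'nb False])
  qed
  then have finZ: "finite Z"
    by (rule finite_subset[rotated]) (use KK' in \<open>auto simp: Z_def\<close>)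
  define S' where "S' = nb (e/2) - {a\<in>K'. a \<notin> K \<and> f a = 0}"
  have "open S'" unfolding S'_def
    by (intro open_Diff nb_open finite_imp_closed finite_subset[OF _ fin]) auto
  moreover have "K \<subseteq> S'" using e(1) by (auto simp: S'_def nb_def)
  ultimately obtain e' where e': "e' > 0" "nb e' \<subseteq> S'"
    unfolding nb_def using compact_subset_open_imp_ball_epsilon_subset[OF K(1)] by metis
  define A where "A = nb e'"
  have A: "open A" "convex A" "K \<subseteq> A"
    using nb_open nb_convex e' unfolding A_def by (auto simp: nb_def intro: bexI[where P = "\<lambda>x. dist x _ < _"])
  have AS: "A \<subseteq> S"
  proof -
    have "A \<subseteq> S'" "S' \<subseteq> nb (e/2)" "nb e \<subseteq> S" using e' e(2) by (simp_all add: A_def S'_def nb_def)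
    then show ?thesis using nbK' K'nb by blast
  qed
  have zA: "f z = 0 \<longleftrightarrow> z \<in> Z" if "z \<in> A" for z
    using that e'(2) nbK' unfolding Z_def A_def S'_def by blast
  have fA: "f holomorphic_on A" using f AS by (rule holomorphic_on_subset)
  have freq: "frequently (\<lambda>w. f w \<noteq> 0) (at z)" if "z \<in> A" for z
  proof -
    have "eventually (\<lambda>w. f w \<noteq> 0 \<and> w \<in> A) (at z)"
      by (rule non_zero_neighbour_alt[OF fA A(1) convex_connected[OF A(2)] that, of z0]) (use nz A in auto)
    then show ?thesis by (intro eventually_frequently) (auto elim: eventually_mono)
  qed
  define P where "P = (\<lambda>z. \<Prod>a\<in>Z. (z - a) ^ nat (zorder f a))"
  have ana: "f analytic_on {z}" if "z \<in> A" for z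
    using fA A(1) analytic_at that by blast
  have zpos: "zorder f a > 0" if "a \<in> Z" for a
  proof -
    have "a \<in> A" using that A by (auto simp: Z_def)
    from zorder_pos_iff'[OF ana[OF this] freq[OF this]] show ?thesis using that by (simp add: Z_def)
  qed
  obtain h where h: "h holomorphic_on A" "\<And>z. z \<in> A \<Longrightarrow> h z \<noteq> 0" "\<And>z. z \<in> A \<Longrightarrow> f z = h z * P z"
  proof (rule holomorphic_zorder_factorization[OF fA A(1) convex_connected[OF A(2)], of P])
    show "P holomorphic_on A" unfolding P_def by (auto intro!: holomorphic_intros)
    show "P z = 0 \<longleftrightarrow> f z = 0" if "z \<in> A" for z
      using zA[OF that] finZ zpos by (auto simp: P_def)
    show "zorder P z = zorder f z" if "z \<in> A" for z
    proof (cases "z \<in> Z")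
      case True
      then show ?thesis using zpos[of z] finZ by (simp add: P_def zorder_prod_power)
    next
      case False
      then have "zorder f z = 0" using zA[OF that] ana[OF that] zorder_eq_0I by blast
      then show ?thesis using False finZ by (simp add: P_def zorder_prod_power)
    qed
  qed blast
  show thesis
    by (rule that[of A h]) (use A AS finZ h in \<open>auto simp: Z_def P_def\<close>)
qed

section \<open>The Poisson--Jensen formula\<close>

text \<open>Angles are counted in full turns, so that [0, 1] carries a probability measure and
  squaring on the circle is doubling of the angle.\<close>

definition circ :: "real \<Rightarrow> complex" where
  "circ \<theta> = cis (2 * pi * \<theta>)"

definition poisson :: "complex \<Rightarrow> real \<Rightarrow> real" where
  "poisson w \<theta> = (1 - (norm w)\<^sup>2) / (norm (circ \<theta> - w))\<^sup>2"

lemma norm_circ [simp]: "norm (circ \<theta>) = 1"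
  by (simp add: circ_def)

lemma circ_nonzero [simp]: "circ \<theta> \<noteq> 0"
  by (simp add: circ_def)

lemma continuous_on_circ [continuous_intros]: "continuous_on A f \<Longrightarrow> continuous_on A (\<lambda>x. circ (f x))"
  unfolding circ_def by (intro continuous_intros)

lemma cnj_circ: "cnj (circ \<theta>) = 1 / circ \<theta>"
  by (simp add: circ_def cis_cnj divide_inverse)

lemma poisson_0 [simp]: "poisson 0 \<theta> = 1"
  by (simp add: poisson_def)

lemma poisson_nonneg: "norm w \<le> 1 \<Longrightarrow> poisson w \<theta> \<ge> 0"
  unfolding poisson_def by (intro divide_nonneg_nonneg) (auto simp: power_le_one)

text \<open>Cauchy's formula at \<open>w\<close> is added to Cauchy's theorem for the function G(u)
  cnj w / (1 - cnj w u), which has no pole in the closed disc. Since cnj u = 1/u on the circle, the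
  two kernels combine to the Poisson kernel.\<close>

lemma poisson_formula:
  assumes G: "G holomorphic_on S" and S: "cball 0 1 \<subseteq> S" and w: "norm w < 1"
  shows "((\<lambda>\<theta>. of_real (poisson w \<theta>) * G (circ \<theta>)) has_integral G w) {0..1}"
proof -
  have G': "G holomorphic_on cball 0 1" using G S by (rule holomorphic_on_subset)
  have path: "circlepath 0 1 x = circ x" for x
    by (simp add: circlepath circ_def cis_conv_exp mult_ac)
  have der: "vector_derivative (circlepath 0 1) (at x within {0..1}) = 2 * pi * \<i> * circ x" if "x \<in> {0..1}" for x
    using that by (simp add: vector_derivative_circlepath01 circ_def cis_conv_exp mult_ac)
  have "((\<lambda>u. G u / (u - w)) has_contour_integral (2 * of_real pi * \<i> * G w)) (circlepath 0 1)"
    by (rule Cauchy_integral_circlepath)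
       (use G' w in \<open>auto intro: holomorphic_on_imp_continuous_on holomorphic_on_subset[OF G']\<close>)
  then have 1: "((\<lambda>x. G (circ x) / (circ x - w) * (2 * pi * \<i> * circ x)) has_integral (2 * of_real pi * \<i> * G w)) {0..1}"
    unfolding has_contour_integral_def by (rule has_integral_eq[rotated]) (simp add: path der)
  have nz: "1 - cnj w * u \<noteq> 0" if "norm u \<le> 1" for u
  proof
    assume "1 - cnj w * u = 0"
    then have "norm (cnj w * u) = 1" by simp
    moreover have "norm (cnj w * u) \<le> norm w * 1" unfolding norm_mult using that by (intro mult_mono) auto
    ultimately show False using w by simp
  qed
  have "((\<lambda>u. G u * cnj w / (1 - cnj w * u)) has_contour_integral 0) (circlepath 0 1)"
    by (rule Cauchy_theorem_convex_simple[of _ "cball 0 1"])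
       (use nz in \<open>auto intro!: holomorphic_intros G'\<close>)
  then have 2: "((\<lambda>x. G (circ x) * cnj w / (1 - cnj w * circ x) * (2 * pi * \<i> * circ x)) has_integral 0) {0..1}"
    unfolding has_contour_integral_def by (rule has_integral_eq[rotated]) (simp add: path der)
  have "((\<lambda>x. G (circ x) / (circ x - w) * (2 * pi * \<i> * circ x) + G (circ x) * cnj w / (1 - cnj w * circ x) * (2 * pi * \<i> * circ x))
      has_integral (2 * of_real pi * \<i> * G w + 0)) {0..1}"
    by (rule has_integral_add[OF 1 2])
  then have "((\<lambda>x. (G (circ x) / (circ x - w) * (2 * pi * \<i> * circ x) + G (circ x) * cnj w / (1 - cnj w * circ x) * (2 * pi * \<i> * circ x)) / (2 * of_real pi * \<i>))
      has_integral ((2 * of_real pi * \<i> * G w + 0) / (2 * of_real pi * \<i>))) {0..1}"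
    by (rule has_integral_divide)
  moreover have "(G c / (c - w) * (2 * pi * \<i> * c) + G c * cnj w / (1 - cnj w * c) * (2 * pi * \<i> * c)) / (2 * of_real pi * \<i>)
     = of_real (poisson w x) * G c" if c: "c = circ x" for x c
  proof -
    have n1: "c - w \<noteq> 0" using w c by auto
    have n2: "1 - cnj w * c \<noteq> 0" using nz[of c] c by simp
    have c0: "c \<noteq> 0" using c by simp
    have "of_real (poisson w x) = (1 - w * cnj w) / ((c - w) * cnj (c - w))"
      unfolding poisson_def c by (simp only: of_real_divide of_real_diff of_real_1 complex_norm_square)
    also have "cnj (c - w) = (1 - cnj w * c) / c"
      using c0 cnj_circ[of x] by (simp add: c[symmetric] field_simps)
    finally have "of_real (poisson w x) = (1 - w * cnj w) * c / ((c - w) * (1 - cnj w * c))" by simp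
    moreover have "(G c / (c - w) * (2 * pi * \<i> * c) + G c * cnj w / (1 - cnj w * c) * (2 * pi * \<i> * c)) / (2 * of_real pi * \<i>)
      = G c * (c / (c - w) + cnj w * c / (1 - cnj w * c))"
      by (simp add: field_simps)
    moreover have "c / (c - w) + cnj w * c / (1 - cnj w * c) = (1 - w * cnj w) * c / ((c - w) * (1 - cnj w * c))"
      using n1 n2 by (simp add: add_frac_eq) (simp add: algebra_simps)
    ultimately show ?thesis by (simp add: mult.commute)
  qed
  ultimately show ?thesis by (simp add: mult.commute)
qed

text \<open>A zero-free function on a convex open set is the exponential of a holomorphic
  \<open>g\<close>, and the logarithm of its modulus is the real part of \<open>g\<close>.\<close>

lemma poisson_ln:
  assumes A: "open A" "convex A" "cball 0 1 \<subseteq> A" and h: "h holomorphic_on A" "\<And>z. z \<in> A \<Longrightarrow> h z \<noteq> 0"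
    and w: "norm w < 1"
  shows "((\<lambda>\<theta>. poisson w \<theta> * ln (norm (h (circ \<theta>)))) has_integral ln (norm (h w))) {0..1}"
proof -
  obtain g where g: "g holomorphic_on A" "\<And>x. x \<in> A \<Longrightarrow> exp (g x) = h x"
    by (rule holomorphic_logarithm_exists[OF A(2,1) h, of 0]) (use A(3) in auto)
  have ln_eq: "ln (norm (h z)) = Re (g z)" if "z \<in> A" for z
    using g(2)[OF that] by (metis norm_exp_eq_Re ln_exp)
  have "((\<lambda>\<theta>. Re (of_real (poisson w \<theta>) * g (circ \<theta>))) has_integral Re (g w)) {0..1}"
    using has_integral_linear[OF poisson_formula[OF g(1) A(3) w] bounded_linear_Re] by (simp add: o_def)
  moreover have "circ \<theta> \<in> A" "w \<in> A" for \<theta> using A(3) w by auto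
  ultimately show ?thesis by (simp add: ln_eq)
qed

definition blaschke :: "complex \<Rightarrow> complex \<Rightarrow> complex" where
  "blaschke a z = (z - a) / (1 - cnj a * z)"

lemma norm_one_minus_cnj_mult: "norm z = 1 \<Longrightarrow> norm (1 - cnj a * z) = norm (z - a)"
proof -
  assume "norm z = 1"
  then have "z * cnj z = 1" by (simp add: complex_norm_square[symmetric])
  then have "1 - cnj a * z = z * cnj (z - a)" by (simp add: algebra_simps)
  then show ?thesis using \<open>norm z = 1\<close> by (simp add: norm_mult del: complex_cnj_diff)
qed

lemma one_minus_cnj_mult_nonzero: "norm a < 1 \<Longrightarrow> norm z \<le> 1 \<Longrightarrow> 1 - cnj a * z \<noteq> 0"
proof
  assume *: "norm a < 1" "norm z \<le> 1" "1 - cnj a * z = 0"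
  then have "norm (cnj a * z) = 1" by simp
  moreover have "norm (cnj a * z) \<le> norm a * 1" unfolding norm_mult using * by (intro mult_mono) auto
  ultimately show False using * by simp
qed

lemma norm_blaschke_identity:
  "(norm (1 - cnj a * z))\<^sup>2 - (norm (z - a))\<^sup>2 = (1 - (norm a)\<^sup>2) * (1 - (norm z)\<^sup>2)"
  by (simp only: cmod_power2) (simp add: algebra_simps power2_eq_square)

lemma norm_blaschke_le:
  assumes "norm a < 1" "norm z \<le> 1"
  shows "norm (blaschke a z) \<le> 1"
proof -
  have "(norm (z - a))\<^sup>2 \<le> (norm (1 - cnj a * z))\<^sup>2"
  proof -
    have "0 \<le> (1 - (norm a)\<^sup>2) * (1 - (norm z)\<^sup>2)"
      using assms by (intro mult_nonneg_nonneg) (auto simp: power_le_one)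
    then show ?thesis using norm_blaschke_identity[of a z] by linarith
  qed
  then have "norm (z - a) \<le> norm (1 - cnj a * z)"
    by (rule power2_le_imp_le) simp
  then show ?thesis
    using one_minus_cnj_mult_nonzero[OF assms] by (simp add: blaschke_def norm_divide)
qed

text \<open>Once the zeros are divided out, each factor z - a may be replaced on the circle by 1 -
  cnj a z, which has the same modulus there and no zero in the closed disc. At \<open>w\<close> the
  two moduli differ, and this defect is the Blaschke term.\<close>

lemma poisson_jensen:
  assumes S: "open S" "cball 0 1 \<subseteq> S" and f: "f holomorphic_on S"
    and nz: "\<And>z. norm z = 1 \<Longrightarrow> f z \<noteq> 0" and w: "norm w < 1" "f w \<noteq> 0"
  defines "Z \<equiv> {a. norm a < 1 \<and> f a = 0}"
  shows "finite Z" "\<And>a. a \<in> Z \<Longrightarrow> zorder f a > 0"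
    and "((\<lambda>\<theta>. poisson w \<theta> * ln (norm (f (circ \<theta>)))) has_integral
           (ln (norm (f w)) - (\<Sum>a\<in>Z. zorder f a * ln (norm (blaschke a w))))) {0..1}"
proof -
  have Z_eq: "{a\<in>cball 0 1. f a = 0} = Z"
    using nz by (force simp: Z_def)
  obtain A h where A: "open A" "convex A" "cball 0 1 \<subseteq> A" "A \<subseteq> S" and fin: "finite Z"
    and h: "h holomorphic_on A" "\<And>z. z \<in> A \<Longrightarrow> h z \<noteq> 0"
    and fh: "\<And>z. z \<in> A \<Longrightarrow> f z = h z * (\<Prod>a\<in>Z. (z - a) ^ nat (zorder f a))"
    using factor_zeros_compact_convex[OF compact_cball convex_cball S(2,1) f, of w] w unfolding Z_eq by auto
  show "finite Z" by fact
  have fA: "f holomorphic_on A" using f A(4) by (rule holomorphic_on_subset)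
  show zpos: "zorder f a > 0" if "a \<in> Z" for a
  proof -
    have aA: "a \<in> A" using that A(3) by (auto simp: Z_def)
    have "eventually (\<lambda>w. f w \<noteq> 0 \<and> w \<in> A) (at a)"
      by (rule non_zero_neighbour_alt[OF fA A(1) convex_connected[OF A(2)] aA, of w]) (use w A in auto)
    then have "frequently (\<lambda>w. f w \<noteq> 0) (at a)" by (intro eventually_frequently) (auto elim: eventually_mono)
    then show ?thesis using zorder_pos_iff[OF fA A(1) aA] that by (auto simp: Z_def)
  qed
  define m where "m = (\<lambda>a. real (nat (zorder f a)))"
  have m: "m a = of_int (zorder f a)" if "a \<in> Z" for a using zpos[OF that] by (simp add: m_def)
  have lnf: "ln (norm (f z)) = ln (norm (h z)) + (\<Sum>a\<in>Z. m a * ln (norm (z - a)))"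
    if "z \<in> A" "f z \<noteq> 0" for z
  proof -
    have "z \<noteq> a" if "a \<in> Z" for a
      using that \<open>f z \<noteq> 0\<close> by (auto simp: Z_def)
    then have "(\<Prod>a\<in>Z. norm (z - a) ^ nat (zorder f a)) > 0" by (intro prod_pos) auto
    moreover have "ln (\<Prod>a\<in>Z. norm (z - a) ^ nat (zorder f a)) = (\<Sum>a\<in>Z. m a * ln (norm (z - a)))"
      using \<open>f z \<noteq> 0\<close> fin by (subst ln_prod) (auto simp: m_def ln_realpow Z_def intro!: sum.cong)
    ultimately show ?thesis
      using h(2)[OF that(1)] fh[OF that(1)] by (simp add: norm_mult prod_norm[symmetric] norm_power ln_mult)
  qed
  have P: "((\<lambda>\<theta>. poisson w \<theta> * ln (norm (1 - cnj a * circ \<theta>))) has_integral ln (norm (1 - cnj a * w))) {0..1}"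
    if "a \<in> Z" for a
  proof -
    \<comment> \<open>A radius strictly between 1 and 1/|a|, in a form that also covers a =
      0.\<close>
    define r where "r = 2 / (1 + norm a)"
    have na: "norm a < 1" using that by (simp add: Z_def)
    have r: "r > 1" using na by (simp add: r_def field_simps add_pos_nonneg)
    have "1 - cnj a * z \<noteq> 0" if "z \<in> ball 0 r" for z
    proof
      assume "1 - cnj a * z = 0"
      then have 1: "norm a * norm z = 1" by (metis complex_mod_cnj eq_iff_diff_eq_0 norm_mult norm_one)
      then have "norm a > 0" by (cases "a = 0") auto
      then have "norm a * norm z < norm a * r" using that by (intro mult_strict_left_mono) auto
      also have "norm a * r \<le> 1" using na by (simp add: r_def field_simps add_pos_nonneg)
      finally show False using 1 by simp
    qed
    then show ?thesis
      by (intro poisson_ln[of "ball 0 r"] w) (use r in \<open>auto intro!: holomorphic_intros\<close>)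
  qed
  have "((\<lambda>\<theta>. poisson w \<theta> * ln (norm (h (circ \<theta>))) + (\<Sum>a\<in>Z. m a * (poisson w \<theta> * ln (norm (1 - cnj a * circ \<theta>)))))
     has_integral (ln (norm (h w)) + (\<Sum>a\<in>Z. m a * ln (norm (1 - cnj a * w))))) {0..1}"
    by (intro has_integral_add poisson_ln[OF A(1-3) h w(1)] has_integral_sum fin has_integral_mult_right P)
  moreover have "poisson w \<theta> * ln (norm (h (circ \<theta>))) + (\<Sum>a\<in>Z. m a * (poisson w \<theta> * ln (norm (1 - cnj a * circ \<theta>))))
      = poisson w \<theta> * ln (norm (f (circ \<theta>)))" for \<theta>
  proof -
    have "circ \<theta> \<in> A" using A(3) by auto
    then show ?thesis using nz[of "circ \<theta>"]
      by (simp add: lnf norm_one_minus_cnj_mult distrib_left sum_distrib_left mult_ac)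
  qed
  moreover have "ln (norm (h w)) + (\<Sum>a\<in>Z. m a * ln (norm (1 - cnj a * w))) =
       ln (norm (f w)) - (\<Sum>a\<in>Z. zorder f a * ln (norm (blaschke a w)))"
  proof -
    have "w \<in> A" using A(3) w by auto
    have "m a * ln (norm (1 - cnj a * w)) = m a * ln (norm (w - a)) - zorder f a * ln (norm (blaschke a w))"
      if "a \<in> Z" for a
    proof -
      have "w \<noteq> a" "1 - cnj a * w \<noteq> 0"
        using w that one_minus_cnj_mult_nonzero[of a w] by (auto simp: Z_def)
      then show ?thesis by (simp add: m[OF that] blaschke_def norm_divide ln_div algebra_simps)
    qed
    then show ?thesis using lnf[OF \<open>w \<in> A\<close> w(2)] by (simp add: sum_subtractf)
  qed
  ultimately show "((\<lambda>\<theta>. poisson w \<theta> * ln (norm (f (circ \<theta>)))) has_integral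
           (ln (norm (f w)) - (\<Sum>a\<in>Z. zorder f a * ln (norm (blaschke a w))))) {0..1}"
    by simp
qed

section \<open>The doubling map\<close>

text \<open>A density on the whole line rather than a restriction: the space is then
  \<open>UNIV\<close>, and maps between real numbers need no membership conditions. The points
  outside [0, 1) form a null set.\<close>

definition unit_measure :: "real measure" where
  "unit_measure = density lborel (\<lambda>x. ennreal (indicator {0..<1} x))"

definition doubling :: "real \<Rightarrow> real" where
  "doubling \<theta> = frac (2 * \<theta>)"

lemma sets_unit_measure [simp, measurable_cong]: "sets unit_measure = sets borel"
  and space_unit_measure [simp]: "space unit_measure = UNIV"
  by (simp_all add: unit_measure_def)

lemma borel_measurable_frac [measurable]: "frac \<in> borel_measurable (borel :: real measure)"
  unfolding frac_def[abs_def] by measurable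

lemma nn_integral_unit_measure:
  "f \<in> borel_measurable borel \<Longrightarrow>
     (\<integral>\<^sup>+\<theta>. f \<theta> \<partial>unit_measure) = (\<integral>\<^sup>+\<theta>. f \<theta> * indicator {0..<1} \<theta> \<partial>lborel)"
  unfolding unit_measure_def
  by (subst nn_integral_density) (auto simp: ennreal_indicator mult.commute)

lemma AE_unit_measure: "(AE \<theta> in unit_measure. P \<theta>) \<longleftrightarrow> (AE \<theta> in lborel. \<theta> \<in> {0..<1} \<longrightarrow> P \<theta>)"
  unfolding unit_measure_def by (subst AE_density) (auto simp: indicator_def)

lemma AE_unit_measureI: "(\<And>\<theta>. 0 \<le> \<theta> \<Longrightarrow> \<theta> < 1 \<Longrightarrow> P \<theta>) \<Longrightarrow> AE \<theta> in unit_measure. P \<theta>"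
  by (simp add: AE_unit_measure)

lemma prob_space_unit_measure: "prob_space unit_measure"
proof
  have "emeasure unit_measure UNIV = (\<integral>\<^sup>+\<theta>. 1 \<partial>unit_measure)" by simp
  also have "\<dots> = 1" by (subst nn_integral_unit_measure) auto
  finally show "emeasure unit_measure (space unit_measure) = 1" by simp
qed

interpretation unit_measure: prob_space unit_measure by (rule prob_space_unit_measure)

lemma measure_unit_measure_UNIV [simp]: "measure unit_measure UNIV = 1"
  using unit_measure.prob_space by simp

text \<open>Multiplication by \<open>M\<close> followed by \<open>frac\<close> carries the block
  affinely onto [0, 1).\<close>

lemma nn_integral_frac_block:
  assumes f [measurable]: "f \<in> borel_measurable borel" and M: "M > (0::nat)"
  shows "(\<integral>\<^sup>+\<theta>. f (frac (real M * \<theta>)) * indicator {real i / real M..<real (Suc i) / real M} \<theta> \<partial>lborel) =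
           ennreal (1 / real M) * (\<integral>\<^sup>+\<theta>. f \<theta> \<partial>unit_measure)"
proof -
  have eq: "f (frac (real M * (real i / real M + 1 / real M * x))) *
      indicator {real i / real M..<real (Suc i) / real M} (real i / real M + 1 / real M * x) =
      f x * indicator {0..<1} x" for x
  proof -
    have "real M * (real i / real M + 1 / real M * x) = real i + x" using M by (simp add: field_simps)
    moreover have "real i / real M + 1 / real M * x \<in> {real i / real M..<real (Suc i) / real M} \<longleftrightarrow> x \<in> {0..<1}"
      using M by (auto simp: field_simps)
    moreover have "frac (real i + x) = x" if "x \<in> {0..<1}"
      using that by (simp add: frac_unique_iff)
    ultimately show ?thesis by (simp add: indicator_def)
  qed
  show ?thesis
    by (subst nn_integral_real_affine[where c = "1 / real M" and t = "real i / real M"])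
       (use M in \<open>simp_all only: eq nn_integral_unit_measure[OF f], simp_all\<close>)
qed

lemma nn_integral_frac_blocks:
  assumes f [measurable]: "f \<in> borel_measurable borel" and M: "M > (0::nat)"
  shows "(\<integral>\<^sup>+\<theta>. f (frac (real M * \<theta>)) * indicator {0..<real j / real M} \<theta> \<partial>lborel) =
           ennreal (real j / real M) * (\<integral>\<^sup>+\<theta>. f \<theta> \<partial>unit_measure)"
proof (induction j)
  case (Suc j)
  have *: "indicator {0..<real (Suc j) / real M} \<theta> =
      (indicator {0..<real j / real M} \<theta> + indicator {real j / real M..<real (Suc j) / real M} \<theta> :: ennreal)" for \<theta>
  proof -
    have "indicator {0..<b} \<theta> = (indicator {0..<a} \<theta> + indicator {a..<b} \<theta> :: ennreal)"
      if "0 \<le> a" "a \<le> b" for a b :: real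
      using that by (auto simp: indicator_def)
    then show ?thesis by (simp add: divide_right_mono)
  qed
  have "(\<integral>\<^sup>+\<theta>. f (frac (real M * \<theta>)) * indicator {0..<real (Suc j) / real M} \<theta> \<partial>lborel) =
      (\<integral>\<^sup>+\<theta>. f (frac (real M * \<theta>)) * indicator {0..<real j / real M} \<theta> \<partial>lborel) +
      (\<integral>\<^sup>+\<theta>. f (frac (real M * \<theta>)) * indicator {real j / real M..<real (Suc j) / real M} \<theta> \<partial>lborel)"
    unfolding * distrib_left by (rule nn_integral_add) measurable
  also have "\<dots> = ennreal (real (Suc j) / real M) * (\<integral>\<^sup>+\<theta>. f \<theta> \<partial>unit_measure)"
    unfolding Suc nn_integral_frac_block[OF f M] distrib_right[symmetric]
    by (subst ennreal_plus[symmetric]) (auto simp: add_divide_distrib add.commute)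
  finally show ?case .
qed simp

lemma nn_integral_frac_mult:
  assumes f [measurable]: "f \<in> borel_measurable borel" and M: "M > (0::nat)"
  shows "(\<integral>\<^sup>+\<theta>. f (frac (real M * \<theta>)) \<partial>unit_measure) = (\<integral>\<^sup>+\<theta>. f \<theta> \<partial>unit_measure)"
  using nn_integral_frac_blocks[OF f M, of M] M by (simp add: nn_integral_unit_measure)

lemma doubling_measurable [measurable]: "doubling \<in> borel_measurable borel"
  unfolding doubling_def[abs_def] by measurable

lemma doubling_system: "dynamical_system unit_measure doubling"
  unfolding dynamical_system_def
proof (intro conjI prob_space_unit_measure)
  show m: "doubling \<in> measurable unit_measure unit_measure"
    using doubling_measurable measurable_cong_sets[OF sets_unit_measure sets_unit_measure] by blast
  show "distr unit_measure unit_measure doubling = unit_measure"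
  proof (rule measure_eqI)
    fix A assume A: "A \<in> sets (distr unit_measure unit_measure doubling)"
    then have [measurable]: "A \<in> sets borel" by simp
    have "emeasure (distr unit_measure unit_measure doubling) A = (\<integral>\<^sup>+\<theta>. indicator A (frac (real 2 * \<theta>)) \<partial>unit_measure)"
    proof -
      have "doubling -` A \<in> sets unit_measure" using measurable_sets[OF m, of A] by simp
      then have "emeasure unit_measure (doubling -` A) = (\<integral>\<^sup>+\<theta>. indicator (doubling -` A) \<theta> \<partial>unit_measure)"
        by (rule nn_integral_indicator[symmetric])
      moreover have "indicator (doubling -` A) \<theta> = (indicator A (frac (real 2 * \<theta>)) :: ennreal)" for \<theta>
        by (simp add: doubling_def indicator_def)
      ultimately show ?thesis using m A by (simp add: emeasure_distr)
    qed
    also have "\<dots> = (\<integral>\<^sup>+\<theta>. indicator A \<theta> \<partial>unit_measure)"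
      by (rule nn_integral_frac_mult) auto
    finally show "emeasure (distr unit_measure unit_measure doubling) A = emeasure unit_measure A" by simp
  qed simp
qed

lemma doubling_funpow:
  assumes "0 \<le> \<theta>" "\<theta> < 1"
  shows "(doubling ^^ n) \<theta> = frac (real (2 ^ n) * \<theta>)"
proof (induction n)
  case 0
  then show ?case using assms by (simp add: frac_eq)
next
  case (Suc n)
  have "frac (2 * frac y) = frac (2 * y)" for y :: real
  proof -
    have "2 * frac y = 2 * y - of_int (2 * \<lfloor>y\<rfloor>)" by (simp add: frac_def algebra_simps)
    then show ?thesis by (simp only: frac_def floor_diff_of_int of_int_diff)
  qed
  then show ?case using Suc by (simp add: doubling_def mult.assoc)
qed

lemma nn_integral_doubling_funpow:
  assumes f [measurable]: "f \<in> borel_measurable borel"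
  shows "(\<integral>\<^sup>+\<theta>. f ((doubling ^^ n) \<theta>) \<partial>unit_measure) = (\<integral>\<^sup>+\<theta>. f \<theta> \<partial>unit_measure)"
proof -
  have "(\<integral>\<^sup>+\<theta>. f ((doubling ^^ n) \<theta>) \<partial>unit_measure) = (\<integral>\<^sup>+\<theta>. f (frac (real (2 ^ n) * \<theta>)) \<partial>unit_measure)"
    by (intro nn_integral_cong_AE AE_unit_measureI) (simp add: doubling_funpow)
  also have "\<dots> = (\<integral>\<^sup>+\<theta>. f \<theta> \<partial>unit_measure)" by (rule nn_integral_frac_mult[OF f]) simp
  finally show ?thesis .
qed

text \<open>On each dyadic block of length 2^-n the iterate runs once through [0, 1), so the block
  contributes exactly \<open>c\<close> / 2^n. The part of [0, 1) up to \<open>x\<close> lies between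
  the unions of j and of j + 1 blocks, and one block is the whole error. The factor
  \<open>max 0 (min 1 x)\<close> is the mass of \<open>{..x}\<close>.\<close>

lemma doubling_mixing:
  assumes f [measurable]: "f \<in> borel_measurable borel" and bd: "\<And>\<theta>. 0 \<le> f \<theta>" "\<And>\<theta>. f \<theta> \<le> (K::real)"
  defines "c \<equiv> (\<integral>\<theta>. f \<theta> \<partial>unit_measure)"
  shows "\<bar>(\<integral>\<theta>. indicator {..x} \<theta> * f ((doubling ^^ n) \<theta>) \<partial>unit_measure) - max 0 (min 1 x) * c\<bar> \<le> K * (1 / 2 ^ n)"
proof -
  define M where "M = (2 ^ n :: nat)"
  have M: "M > 0" by (simp add: M_def)
  have K: "K \<ge> 0" using bd[of 0] by linarith
  have int_f: "integrable unit_measure f"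
    by (rule unit_measure.integrable_const_bound[of _ K]) (use bd in auto)
  have c: "ennreal c = (\<integral>\<^sup>+\<theta>. f \<theta> \<partial>unit_measure)" "c \<ge> 0"
    unfolding c_def using bd int_f by (auto simp: nn_integral_eq_integral)
  have cK: "c \<le> K"
  proof -
    have "c \<le> (\<integral>\<theta>. K \<partial>unit_measure)" unfolding c_def by (rule integral_mono) (use int_f bd in auto)
    then show ?thesis by simp
  qed
  define F where "F = (\<integral>\<theta>. indicator {..x} \<theta> * f ((doubling ^^ n) \<theta>) \<partial>unit_measure)"
  have "integrable unit_measure (\<lambda>\<theta>. indicator {..x} \<theta> * f ((doubling ^^ n) \<theta>))"
    by (rule unit_measure.integrable_const_bound[of _ K]) (use bd K in \<open>auto simp: indicator_def\<close>)
  then have "ennreal F = (\<integral>\<^sup>+\<theta>. indicator {..x} \<theta> * f ((doubling ^^ n) \<theta>) \<partial>unit_measure)"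
    unfolding F_def using bd by (subst nn_integral_eq_integral) auto
  also have "\<dots> = (\<integral>\<^sup>+\<theta>. indicator {..x} \<theta> * f (frac (real M * \<theta>)) \<partial>unit_measure)"
    by (intro nn_integral_cong_AE AE_unit_measureI) (simp add: doubling_funpow M_def)
  also have "\<dots> = (\<integral>\<^sup>+\<theta>. ennreal (f (frac (real M * \<theta>))) * indicator ({0..<1} \<inter> {..x}) \<theta> \<partial>lborel)"
    by (subst nn_integral_unit_measure) (auto intro!: nn_integral_cong simp: indicator_def)
  finally have F: "ennreal F = (\<integral>\<^sup>+\<theta>. ennreal (f (frac (real M * \<theta>))) * indicator ({0..<1} \<inter> {..x}) \<theta> \<partial>lborel)" .
  have F0: "F \<ge> 0" unfolding F_def using bd by (intro integral_nonneg_AE) auto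
  have blocks: "(\<integral>\<^sup>+\<theta>. ennreal (f (frac (real M * \<theta>))) * indicator {0..<real j / real M} \<theta> \<partial>lborel) = ennreal (real j / real M * c)" for j
    using nn_integral_frac_blocks[of "\<lambda>x. ennreal (f x)" M j] M c(2) by (simp add: c(1)[symmetric] ennreal_mult[symmetric])
  have up: "F \<le> real j / real M * c" if "{0..<1} \<inter> {..x} \<subseteq> {0..<real j / real M}" for j
  proof -
    have "ennreal F \<le> ennreal (real j / real M * c)"
      unfolding F blocks[symmetric] using that by (intro nn_integral_mono mult_left_mono) (auto simp: indicator_def)
    then show ?thesis using c(2) by simp
  qed
  have lo: "F \<ge> real j / real M * c" if "{0..<real j / real M} \<subseteq> {0..<1} \<inter> {..x}" for j
  proof -
    have "ennreal F \<ge> ennreal (real j / real M * c)"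
      unfolding F blocks[symmetric] using that by (intro nn_integral_mono mult_left_mono) (auto simp: indicator_def)
    then show ?thesis using F0 by simp
  qed
  have le: "c / real M \<le> K * (1 / 2 ^ n)" using cK M by (simp add: M_def divide_right_mono)
  consider "x < 0" | "x \<ge> 1" | "0 \<le> x" "x < 1" by linarith
  then have "\<bar>F - max 0 (min 1 x) * c\<bar> \<le> c / real M"
  proof cases
    case 1
    then have "{0..<1} \<inter> {..x} \<subseteq> {0..<real 0 / real M}" by auto
    from up[OF this] F0 show ?thesis using 1 c(2) by simp
  next
    case 2
    then have "{0..<real M / real M} \<subseteq> {0..<1} \<inter> {..x}" "{0..<1} \<inter> {..x} \<subseteq> {0..<real M / real M}" using M by auto
    from up[OF this(2)] lo[OF this(1)] show ?thesis using 2 c(2) M by simp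
  next
    case 3
    define j where "j = nat \<lfloor>real M * x\<rfloor>"
    have "real j \<le> real M * x" "real M * x < real (Suc j)"
    proof -
      have "real j = of_int \<lfloor>real M * x\<rfloor>" using 3 M by (simp add: j_def)
      then show "real j \<le> real M * x" "real M * x < real (Suc j)" by linarith+
    qed
    then have j: "real j / real M \<le> x" "x < real (Suc j) / real M" using M by (auto simp: field_simps)
    have "F \<le> real (Suc j) / real M * c" by (rule up) (use j in auto)
    moreover have "F \<ge> real j / real M * c" by (rule lo) (use j 3 in auto)
    moreover have "real j / real M * c \<le> x * c" "x * c \<le> real (Suc j) / real M * c"
      using j c(2) by (intro mult_right_mono; linarith)+
    moreover have "real (Suc j) / real M * c = real j / real M * c + c / real M"
      by (simp add: add_divide_distrib distrib_right)
    ultimately show ?thesis using 3 by simp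
  qed
  then show ?thesis using le unfolding F_def by linarith
qed

section \<open>Averages along the sequence\<close>

text \<open>Values \<open>k n >= V\<close> contribute at most 2^-V each. A value v < V forces the
  residue v modulo any m > V, a class of density 1/m. The limit superior is thus at most V/m + 2^-V;
  \<open>V\<close> is chosen first, then \<open>m\<close>.\<close>

lemma average_half_powers_tendsto_0:
  assumes "\<And>m. m > 1 \<Longrightarrow> uniformly_distributed_residues m k"
  shows "(\<lambda>N. (\<Sum>n=1..N. 1 / 2 ^ k n) / real N) \<longlonglongrightarrow> (0::real)"
proof (rule LIMSEQ_I)
  fix e :: real assume e: "e > 0"
  obtain V where V: "(1/2::real) ^ V < e / 2"
    using real_arch_pow_inv[of "e/2" "1/2"] e by auto
  obtain m :: nat where m0: "real m > 2 * (real V + 1) / e + real V + 1" using reals_Archimedean2 by blast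
  have "2 * (real V + 1) / e \<ge> 0" using e by simp
  then have m: "m > V" "m > 1" using m0 by linarith+
  have "2 * real V / e \<le> 2 * (real V + 1) / e" using e by (intro divide_right_mono) auto
  then have "2 * real V / e < real m" using m0 by linarith
  then have mV: "real V / real m < e / 2" using m e by (simp add: field_simps)
  define D where "D = (\<lambda>N. (\<Sum>v<V. real (card {n \<in> {1..N}. k n mod m = v}) / real N))"
  have "(\<lambda>N. D N + (1/2)^V) \<longlonglongrightarrow> (\<Sum>v<V. 1 / real m) + (1/2) ^ V"
    unfolding D_def using assms[OF m(2)] m(1)
    by (intro tendsto_add tendsto_sum tendsto_const) (auto simp: uniformly_distributed_residues_def)
  moreover have "(\<Sum>v<V. 1 / real m) + (1/2) ^ V < e" using add_strict_mono[OF mV V] by simp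
  ultimately have ev: "\<forall>\<^sub>F N in sequentially. D N + (1/2)^V < e" by (rule order_tendstoD(2))
  have bound: "(\<Sum>n=1..N. 1 / 2 ^ k n) / real N \<le> D N + (1/2)^V" if "N > 0" for N
  proof -
    have "(\<Sum>n=1..N. 1 / 2 ^ k n :: real) \<le> (\<Sum>n=1..N. (\<Sum>v<V. of_bool (k n mod m = v)) + (1/2)^V)"
    proof (rule sum_mono)
      fix n
      show "1 / 2 ^ k n \<le> (\<Sum>v<V. of_bool (k n mod m = v)) + (1/2::real)^V"
      proof (cases "k n < V")
        case True
        then have "(\<Sum>v<V. of_bool (k n mod m = v)) = (1::real)" using m by simp
        moreover have "1 / 2 ^ k n \<le> (1::real)" "(1/2::real)^V \<ge> 0" by (simp_all add: field_simps)
        ultimately show ?thesis by linarith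
      next
        case False
        then have "(1/2::real) ^ k n \<le> (1/2) ^ V" by (intro power_decreasing) auto
        moreover have "(\<Sum>v<V. of_bool (k n mod m = v)) \<ge> (0::real)" by (intro sum_nonneg) auto
        ultimately show ?thesis by (simp add: power_one_over)
      qed
    qed
    also have "\<dots> = (\<Sum>v<V. \<Sum>n=1..N. of_bool (k n mod m = v)) + real N * (1/2)^V"
      unfolding sum.distrib by (subst sum.swap) simp
    also have "\<dots> = (\<Sum>v<V. real (card {n \<in> {1..N}. k n mod m = v})) + real N * (1/2)^V"
      by (simp add: of_bool_def sum.If_cases Int_def)
    finally have "(\<Sum>n=1..N. 1 / 2 ^ k n) / real N \<le>
        ((\<Sum>v<V. real (card {n \<in> {1..N}. k n mod m = v})) + real N * (1/2)^V) / real N"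
      by (rule divide_right_mono) simp
    then show ?thesis using that by (simp add: D_def add_divide_distrib sum_divide_distrib)
  qed
  from ev obtain N0 where N0: "\<And>N. N \<ge> N0 \<Longrightarrow> D N + (1/2)^V < e" by (auto simp: eventually_sequentially)
  show "\<exists>no. \<forall>N\<ge>no. norm ((\<Sum>n=1..N. 1 / 2 ^ k n) / real N - 0) < e"
  proof (intro exI[of _ "max N0 1"] allI impI)
    fix N assume N: "N \<ge> max N0 1"
    have "(\<Sum>n=1..N. 1 / 2 ^ k n) / real N \<ge> (0::real)" by (intro divide_nonneg_nonneg sum_nonneg) auto
    then show "norm ((\<Sum>n=1..N. 1 / 2 ^ k n) / real N - 0) < e" using bound[of N] N0[of N] N by simp
  qed
qed

definition doubling_average :: "(nat \<Rightarrow> nat) \<Rightarrow> (real \<Rightarrow> real) \<Rightarrow> nat \<Rightarrow> real \<Rightarrow> real" where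
  "doubling_average k f N \<theta> = (\<Sum>n=1..N. f ((doubling ^^ k n) \<theta>)) / real N"

lemma doubling_average_measurable [measurable]:
  assumes [measurable]: "f \<in> borel_measurable borel"
  shows "doubling_average k f N \<in> borel_measurable borel"
proof -
  have "(\<lambda>\<theta>. f ((doubling ^^ n) \<theta>)) \<in> borel_measurable borel" for n by measurable
  then show ?thesis
    unfolding doubling_average_def[abs_def]
    by (intro borel_measurable_divide borel_measurable_sum borel_measurable_const)
qed

lemma doubling_average_bounded:
  assumes "\<And>\<theta>. 0 \<le> f \<theta>" "\<And>\<theta>. f \<theta> \<le> K" "K \<ge> 0"
  shows "0 \<le> doubling_average k f N \<theta>" "doubling_average k f N \<theta> \<le> K"
proof -
  show "0 \<le> doubling_average k f N \<theta>"
    unfolding doubling_average_def using assms by (intro divide_nonneg_nonneg sum_nonneg) auto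
  have "(\<Sum>n=1..N. f ((doubling ^^ k n) \<theta>)) \<le> (\<Sum>n=1..N. K)" using assms by (intro sum_mono) auto
  then show "doubling_average k f N \<theta> \<le> K"
    using assms(3) by (cases "N = 0") (auto simp: doubling_average_def divide_le_eq mult.commute)
qed

text \<open>The densities \<open>g\<close> and \<open>c\<close> define finite measures with equal
  distribution functions, hence equal measures, and a density is unique up to null sets.\<close>

lemma AE_eq_const_of_interval_integrals:
  fixes g :: "real \<Rightarrow> real"
  assumes [measurable]: "g \<in> borel_measurable borel" and int: "integrable unit_measure g"
    and nonneg: "\<And>x. 0 \<le> g x" and c: "c \<ge> 0"
    and eq: "\<And>x. (\<integral>\<theta>. indicator {..x} \<theta> * g \<theta> \<partial>unit_measure) = (\<integral>\<theta>. indicator {..x} \<theta> * c \<partial>unit_measure)"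
  shows "AE \<theta> in unit_measure. g \<theta> = c"
proof -
  have fin: "finite_borel_measure (density unit_measure (\<lambda>\<theta>. ennreal (h \<theta>)))"
    and cdf: "cdf (density unit_measure (\<lambda>\<theta>. ennreal (h \<theta>))) x = (\<integral>\<theta>. indicator {..x} \<theta> * h \<theta> \<partial>unit_measure)"
    if [measurable]: "h \<in> borel_measurable borel" and i: "integrable unit_measure h" and n: "\<And>x. 0 \<le> h x" for h :: "real \<Rightarrow> real" and x
  proof -
    have "emeasure (density unit_measure (\<lambda>\<theta>. ennreal (h \<theta>))) UNIV = (\<integral>\<^sup>+\<theta>. h \<theta> \<partial>unit_measure)"
      by (subst emeasure_density) auto
    also have "\<dots> < \<infinity>" using i n by (simp add: nn_integral_eq_integral)
    finally show "finite_borel_measure (density unit_measure (\<lambda>\<theta>. ennreal (h \<theta>)))"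
      by (intro finite_borel_measure.intro finite_measureI finite_borel_measure_axioms.intro) (simp_all add: less_top)
    have "integrable unit_measure (\<lambda>\<theta>. indicator {..x} \<theta> * h \<theta>)"
      using integrable_mult_indicator[OF _ i, of "{..x}"] by simp
    moreover have "emeasure (density unit_measure (\<lambda>\<theta>. ennreal (h \<theta>))) {..x} =
        (\<integral>\<^sup>+\<theta>. ennreal (indicator {..x} \<theta> * h \<theta>) \<partial>unit_measure)"
      by (subst emeasure_density) (auto simp: indicator_def intro!: nn_integral_cong)
    ultimately show "cdf (density unit_measure (\<lambda>\<theta>. ennreal (h \<theta>))) x = (\<integral>\<theta>. indicator {..x} \<theta> * h \<theta> \<partial>unit_measure)"
      unfolding cdf_def measure_def using n
      by (simp add: nn_integral_eq_integral integral_nonneg_AE)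
  qed
  have "density unit_measure (\<lambda>\<theta>. ennreal (g \<theta>)) = density unit_measure (\<lambda>\<theta>. ennreal c)"
    by (rule cdf_unique') (use fin cdf int nonneg c eq in auto)
  then have "AE \<theta> in unit_measure. ennreal (g \<theta>) = ennreal c"
    by (subst (asm) unit_measure.density_unique_iff) auto
  then show ?thesis using nonneg c by (simp add: ennreal_inj)
qed

text \<open>The limit \<open>g\<close> is identified through its integrals over half lines.
  Dominated convergence makes them limits of averages of the correlations \<open>F (k n)\<close>. By
  mixing these deviate from \<open>t * c\<close> by at most \<open>K\<close> / 2^(k n), and the
  powers average to 0.\<close>

lemma doubling_average_bounded_limit:
  assumes ud: "\<And>m. m > 1 \<Longrightarrow> uniformly_distributed_residues m k"
    and f [measurable]: "f \<in> borel_measurable borel" and bd: "\<And>\<theta>. 0 \<le> f \<theta>" "\<And>\<theta>. f \<theta> \<le> (K::real)"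
    and conv: "AE \<theta> in unit_measure. convergent (\<lambda>N. doubling_average k f N \<theta>)"
  shows "AE \<theta> in unit_measure. (\<lambda>N. doubling_average k f N \<theta>) \<longlonglongrightarrow> (\<integral>\<theta>. f \<theta> \<partial>unit_measure)"
proof -
  define c where "c = (\<integral>\<theta>. f \<theta> \<partial>unit_measure)"
  have K: "K \<ge> 0" using bd[of 0] by linarith
  have c0: "c \<ge> 0" unfolding c_def using bd by (intro integral_nonneg_AE) auto
  \<comment> \<open>Clamping to [0, K] bounds \<open>g\<close> everywhere, also where the averages
    have no limit; elsewhere it changes nothing.\<close>
  define g where "g = (\<lambda>\<theta>. max 0 (min K (lim (\<lambda>N. doubling_average k f N \<theta>))))"
  have [measurable]: "g \<in> borel_measurable borel"
    unfolding g_def by (intro borel_measurable_max borel_measurable_min borel_measurable_lim_metric) measurable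
  have lim_g: "AE \<theta> in unit_measure. (\<lambda>N. doubling_average k f N \<theta>) \<longlonglongrightarrow> g \<theta>"
    using conv
  proof eventually_elim
    case (elim \<theta>)
    then obtain l where l: "(\<lambda>N. doubling_average k f N \<theta>) \<longlonglongrightarrow> l" by (auto simp: convergent_def)
    have "0 \<le> l" "l \<le> K"
      using doubling_average_bounded[of f K k _ \<theta>, OF bd K]
      by (auto intro: LIMSEQ_le_const[OF l] LIMSEQ_le_const2[OF l])
    then show ?case using l limI[OF l] by (simp add: g_def)
  qed
  have "AE \<theta> in unit_measure. g \<theta> = c"
  proof (rule AE_eq_const_of_interval_integrals)
    show "integrable unit_measure g"
      by (rule unit_measure.integrable_const_bound[of _ K]) (use K in \<open>auto simp: g_def\<close>)
    fix x :: real
    define t where "t = max 0 (min 1 x)"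
    define F where "F = (\<lambda>n. \<integral>\<theta>. indicator {..x} \<theta> * f ((doubling ^^ n) \<theta>) \<partial>unit_measure)"
    have int: "integrable unit_measure (\<lambda>\<theta>. indicator {..x} \<theta> * f ((doubling ^^ n) \<theta>))" for n
      by (rule unit_measure.integrable_const_bound[of _ K]) (use bd K in \<open>auto simp: indicator_def\<close>)
    have F: "\<bar>F n - t * c\<bar> \<le> K * (1 / 2 ^ n)" for n
      using doubling_mixing[OF f bd] unfolding F_def t_def c_def .
    have "(\<lambda>N. \<integral>\<theta>. indicator {..x} \<theta> * doubling_average k f N \<theta> \<partial>unit_measure) \<longlonglongrightarrow>
        (\<integral>\<theta>. indicator {..x} \<theta> * g \<theta> \<partial>unit_measure)"
    proof (rule integral_dominated_convergence[of _ _ _ "\<lambda>_. K"])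
      show "AE \<theta> in unit_measure. (\<lambda>N. indicator {..x} \<theta> * doubling_average k f N \<theta>) \<longlonglongrightarrow> indicator {..x} \<theta> * g \<theta>"
        using lim_g by eventually_elim (rule tendsto_mult_left)
      show "AE \<theta> in unit_measure. norm (indicator {..x} \<theta> * doubling_average k f N \<theta>) \<le> K" for N
        using doubling_average_bounded[of f K k N, OF bd K] K by (auto simp: indicator_def)
    qed auto
    moreover have "(\<integral>\<theta>. indicator {..x} \<theta> * doubling_average k f N \<theta> \<partial>unit_measure) = (\<Sum>n=1..N. F (k n)) / real N" for N
    proof -
      have "(\<integral>\<theta>. indicator {..x} \<theta> * doubling_average k f N \<theta> \<partial>unit_measure) =
        (\<integral>\<theta>. (\<Sum>n=1..N. indicator {..x} \<theta> * f ((doubling ^^ k n) \<theta>)) / real N \<partial>unit_measure)"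
        by (simp add: doubling_average_def sum_distrib_left)
      also have "\<dots> = (\<Sum>n=1..N. F (k n)) / real N"
        unfolding F_def integral_divide_zero by (subst Bochner_Integration.integral_sum) (rule int, rule refl)
      finally show ?thesis .
    qed
    moreover have "(\<lambda>N. (\<Sum>n=1..N. F (k n)) / real N) \<longlonglongrightarrow> t * c"
    proof (rule Lim_transform_bound[THEN LIM_zero_cancel[where l = "t * c"]])
      show "\<forall>\<^sub>F N in sequentially. norm ((\<Sum>n=1..N. F (k n)) / real N - t * c) \<le> norm (K * ((\<Sum>n=1..N. 1 / 2 ^ k n) / real N))"
        using eventually_gt_at_top[of 0]
      proof eventually_elim
        case (elim N)
        have "(\<Sum>n=1..N. F (k n)) / real N - t * c = (\<Sum>n=1..N. F (k n) - t * c) / real N"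
          using elim by (simp add: sum_subtractf diff_divide_distrib)
        also have "norm \<dots> \<le> (\<Sum>n=1..N. K * (1 / 2 ^ k n)) / real N"
          unfolding norm_divide by (intro divide_mono order.trans[OF norm_sum] sum_mono) (use elim F in \<open>auto intro!: sum_nonneg mult_nonneg_nonneg K\<close>)
        also have "\<dots> = K * ((\<Sum>n=1..N. 1 / 2 ^ k n) / real N)" by (simp add: sum_distrib_left)
        also have "\<dots> \<le> norm (K * ((\<Sum>n=1..N. 1 / 2 ^ k n) / real N))" by (simp only: real_norm_def abs_ge_self)
        finally show ?case .
      qed
      show "(\<lambda>N. K * ((\<Sum>n=1..N. 1 / 2 ^ k n) / real N)) \<longlonglongrightarrow> 0"
        using tendsto_mult_right_zero[OF average_half_powers_tendsto_0[OF ud]] by blast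
    qed
    ultimately have 1: "(\<integral>\<theta>. indicator {..x} \<theta> * g \<theta> \<partial>unit_measure) = t * c"
      using LIMSEQ_unique by simp
    have "\<bar>(\<integral>\<theta>. indicator {..x} \<theta> * c \<partial>unit_measure) - t * c\<bar> \<le> c * (1 / 2 ^ n)" for n
      using doubling_mixing[of "\<lambda>_. c" c x n] c0 by (simp add: t_def unit_measure.prob_space)
    then have "\<bar>(\<integral>\<theta>. indicator {..x} \<theta> * c \<partial>unit_measure) - t * c\<bar> \<le> 0"
      by (intro LIMSEQ_le_const[of "\<lambda>n. c * (1 / 2 ^ n)"]) (auto intro!: tendsto_mult_right_zero LIMSEQ_divide_realpow_zero)
    then have "(\<integral>\<theta>. indicator {..x} \<theta> * c \<partial>unit_measure) = t * c" by linarith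
    with 1 show "(\<integral>\<theta>. indicator {..x} \<theta> * g \<theta> \<partial>unit_measure) = (\<integral>\<theta>. indicator {..x} \<theta> * c \<partial>unit_measure)" by (rule trans[OF _ sym])
  qed (use c0 in \<open>auto simp: g_def\<close>)
  with lim_g show ?thesis unfolding c_def[symmetric] by eventually_elim auto
qed


lemma doubling_invariant_integral:
  fixes f :: "real \<Rightarrow> real"
  assumes f [measurable]: "f \<in> borel_measurable borel" and nonneg: "\<And>\<theta>. 0 \<le> f \<theta>"
    and int: "integrable unit_measure f"
  shows "has_bochner_integral unit_measure (\<lambda>\<theta>. f ((doubling ^^ n) \<theta>)) (\<integral>\<theta>. f \<theta> \<partial>unit_measure)"
proof -
  have "(\<integral>\<^sup>+\<theta>. ennreal (f ((doubling ^^ n) \<theta>)) \<partial>unit_measure) = (\<integral>\<^sup>+\<theta>. ennreal (f \<theta>) \<partial>unit_measure)"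
    by (rule nn_integral_doubling_funpow) measurable
  also have "\<dots> = ennreal (\<integral>\<theta>. f \<theta> \<partial>unit_measure)"
    using int nonneg by (intro nn_integral_eq_integral) auto
  finally have "(\<integral>\<^sup>+\<theta>. ennreal (f ((doubling ^^ n) \<theta>)) \<partial>unit_measure) = ennreal (\<integral>\<theta>. f \<theta> \<partial>unit_measure)" .
  moreover have "(\<integral>\<theta>. f \<theta> \<partial>unit_measure) \<ge> 0" using nonneg by (intro integral_nonneg_AE) auto
  moreover have "(\<lambda>\<theta>. f ((doubling ^^ n) \<theta>)) \<in> borel_measurable unit_measure" by measurable
  ultimately show ?thesis
    using nn_integral_eq_integrable[of "\<lambda>\<theta>. f ((doubling ^^ n) \<theta>)" unit_measure] nonneg
    unfolding has_bochner_integral_iff by auto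
qed

text \<open>Two bounds meet. The averages dominate those of each truncation, so the limit is at
  least the mean of every truncation and hence at least \<open>c\<close>. By Fatou's lemma and
  invariance its integral is at most \<open>c\<close>. Together they force the value
  \<open>c\<close> almost everywhere.\<close>

lemma doubling_average_nonneg_limit:
  assumes ud: "\<And>m. m > 1 \<Longrightarrow> uniformly_distributed_residues m k"
    and f [measurable]: "f \<in> borel_measurable borel" and nonneg: "\<And>\<theta>. 0 \<le> f \<theta>"
    and int: "integrable unit_measure f"
    and conv: "AE \<theta> in unit_measure. convergent (\<lambda>N. doubling_average k f N \<theta>)"
    and conv_trunc: "\<And>K. AE \<theta> in unit_measure. convergent (\<lambda>N. doubling_average k (\<lambda>\<theta>. min (f \<theta>) (real K)) N \<theta>)"
  shows "AE \<theta> in unit_measure. (\<lambda>N. doubling_average k f N \<theta>) \<longlonglongrightarrow> (\<integral>\<theta>. f \<theta> \<partial>unit_measure)"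
proof -
  define c where "c = (\<integral>\<theta>. f \<theta> \<partial>unit_measure)"
  define fK where "fK = (\<lambda>K \<theta>. min (f \<theta>) (real K))"
  define cK where "cK = (\<lambda>K. \<integral>\<theta>. fK K \<theta> \<partial>unit_measure)"
  define g where "g = (\<lambda>\<theta>. lim (\<lambda>N. doubling_average k f N \<theta>))"
  have c0: "c \<ge> 0" unfolding c_def using nonneg by (intro integral_nonneg_AE) auto
  have g_meas [measurable]: "g \<in> borel_measurable borel"
    unfolding g_def by (intro borel_measurable_lim_metric) measurable
  have fK_meas [measurable]: "fK K \<in> borel_measurable borel" for K unfolding fK_def by measurable
  have lim_g: "AE \<theta> in unit_measure. (\<lambda>N. doubling_average k f N \<theta>) \<longlonglongrightarrow> g \<theta>"
    using conv by eventually_elim (simp add: g_def convergent_LIMSEQ_iff)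
  have "AE \<theta> in unit_measure. cK K \<le> g \<theta>" for K
  proof -
    have "AE \<theta> in unit_measure. (\<lambda>N. doubling_average k (fK K) N \<theta>) \<longlonglongrightarrow> cK K"
      unfolding cK_def
      by (rule doubling_average_bounded_limit[OF ud fK_meas, of K "real K"])
         (use nonneg conv_trunc in \<open>auto simp: fK_def\<close>)
    with lim_g show ?thesis
    proof eventually_elim
      case (elim \<theta>)
      have "doubling_average k (fK K) N \<theta> \<le> doubling_average k f N \<theta>" for N
        unfolding doubling_average_def fK_def by (intro divide_right_mono sum_mono) auto
      then show ?case by (intro LIMSEQ_le[OF elim(2,1)]) auto
    qed
  qed
  then have "AE \<theta> in unit_measure. \<forall>K. cK K \<le> g \<theta>" by (simp add: AE_all_countable)
  moreover have "cK \<longlonglongrightarrow> c"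
    unfolding cK_def c_def
  proof (rule integral_dominated_convergence[of _ _ _ f])
    show "AE \<theta> in unit_measure. (\<lambda>K. fK K \<theta>) \<longlonglongrightarrow> f \<theta>"
    proof (rule AE_I2)
      fix \<theta>
      obtain K0 where "f \<theta> \<le> real K0" using real_arch_simple by blast
      then have "\<forall>\<^sub>F K in sequentially. fK K \<theta> = f \<theta>"
        unfolding eventually_sequentially fK_def by (auto intro!: exI[of _ K0])
      then show "(\<lambda>K. fK K \<theta>) \<longlonglongrightarrow> f \<theta>" by (rule tendsto_eventually)
    qed
  qed (use nonneg int in \<open>auto simp: fK_def\<close>)
  ultimately have ge: "AE \<theta> in unit_measure. c \<le> g \<theta>"
    by (elim AE_mp, intro AE_I2 impI) (auto intro: LIMSEQ_le_const2)
  have avg: "(\<integral>\<^sup>+\<theta>. ennreal (doubling_average k f N \<theta>) \<partial>unit_measure) \<le> ennreal c" for N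
  proof -
    have "has_bochner_integral unit_measure (doubling_average k f N) ((\<Sum>n=1..N. c) / real N)"
      unfolding doubling_average_def[abs_def] c_def
      by (intro has_bochner_integral_divide_zero has_bochner_integral_sum doubling_invariant_integral f nonneg int)
    then have "integrable unit_measure (doubling_average k f N)"
      and "(\<integral>\<theta>. doubling_average k f N \<theta> \<partial>unit_measure) \<le> c"
      using c0 by (auto simp: has_bochner_integral_iff)
    moreover have "0 \<le> doubling_average k f N \<theta>" for \<theta>
      unfolding doubling_average_def using nonneg by (intro divide_nonneg_nonneg sum_nonneg) auto
    ultimately show ?thesis by (simp add: nn_integral_eq_integral ennreal_leI)
  qed
  have "(\<integral>\<^sup>+\<theta>. ennreal (g \<theta>) \<partial>unit_measure) =
      (\<integral>\<^sup>+\<theta>. liminf (\<lambda>N. ennreal (doubling_average k f N \<theta>)) \<partial>unit_measure)"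
    using lim_g by (intro nn_integral_cong_AE) (auto elim!: eventually_mono intro!: lim_imp_Liminf[symmetric])
  also have "\<dots> \<le> liminf (\<lambda>N. \<integral>\<^sup>+\<theta>. ennreal (doubling_average k f N \<theta>) \<partial>unit_measure)"
    by (rule nn_integral_liminf) measurable
  also have "\<dots> \<le> liminf (\<lambda>N::nat. ennreal c)" by (intro Liminf_mono always_eventually allI avg)
  finally have fatou: "(\<integral>\<^sup>+\<theta>. ennreal (g \<theta>) \<partial>unit_measure) \<le> ennreal c" by (simp add: Liminf_const)
  have g0: "AE \<theta> in unit_measure. 0 \<le> g \<theta>" using ge by eventually_elim (use c0 in linarith)
  have int_g: "integrable unit_measure g"
    using fatou g0 by (intro integrableI_nonneg) (auto simp: le_less_trans less_top[symmetric] top_unique)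
  have "ennreal (\<integral>\<theta>. g \<theta> \<partial>unit_measure) \<le> ennreal c"
    using fatou nn_integral_eq_integral[OF int_g g0] by simp
  then have "(\<integral>\<theta>. g \<theta> - c \<partial>unit_measure) \<le> 0" using c0 int_g by simp
  moreover have "AE \<theta> in unit_measure. 0 \<le> g \<theta> - c" using ge by eventually_elim simp
  ultimately have "AE \<theta> in unit_measure. g \<theta> - c = 0"
    using integral_nonneg_eq_0_iff_AE[of unit_measure "\<lambda>\<theta>. g \<theta> - c"] int_g
      integral_nonneg_AE[of "\<lambda>\<theta>. g \<theta> - c" unit_measure] by simp
  with lim_g show ?thesis unfolding c_def[symmetric] by eventually_elim auto
qed

text \<open>Positive and negative part and their truncations are dominated by |f| and so stay in
  L^p. Good universality therefore applies to each of them and supplies the convergence that the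
  identification of the limit presupposes.\<close>

theorem doubling_good_universal_limit:
  assumes p: "p > 1" and hartman: "hartman_uniformly_distributed k" and good: "Lp_good_universal p k"
    and f [measurable]: "f \<in> borel_measurable borel"
    and int_p: "integrable unit_measure (\<lambda>\<theta>. \<bar>f \<theta>\<bar> powr p)"
  shows "AE \<theta> in unit_measure. (\<lambda>N. (\<Sum>n=1..N. f ((doubling ^^ k n) \<theta>)) / real N) \<longlonglongrightarrow> (\<integral>\<theta>. f \<theta> \<partial>unit_measure)"
proof -
  have ud: "uniformly_distributed_residues m k" if "m > 1" for m
    using hartman that by (simp add: hartman_uniformly_distributed_def)
  have conv: "AE \<theta> in unit_measure. convergent (\<lambda>N. doubling_average k g N \<theta>)"
    if [measurable]: "g \<in> borel_measurable borel" and i: "integrable unit_measure (\<lambda>\<theta>. \<bar>g \<theta>\<bar> powr p)" for g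
    using Lp_good_universal_imp_on[OF good, where 'a = real] doubling_system that i
    unfolding Lp_good_universal_on_def doubling_average_def by (auto simp: measurable_cong_sets[OF sets_unit_measure refl])
  have nn: "AE \<theta> in unit_measure. (\<lambda>N. doubling_average k g N \<theta>) \<longlonglongrightarrow> (\<integral>\<theta>. g \<theta> \<partial>unit_measure)"
    and int_g: "integrable unit_measure g"
    if g [measurable]: "g \<in> borel_measurable borel" and bd: "\<And>\<theta>. 0 \<le> g \<theta>" "\<And>\<theta>. g \<theta> \<le> \<bar>f \<theta>\<bar>" for g
  proof -
    have ip: "integrable unit_measure (\<lambda>\<theta>. \<bar>h \<theta>\<bar> powr p)"
      if [measurable]: "h \<in> borel_measurable borel" and "\<And>\<theta>. \<bar>h \<theta>\<bar> \<le> \<bar>f \<theta>\<bar>" for h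
      by (rule Bochner_Integration.integrable_bound[OF int_p]) (use that p in \<open>auto intro!: powr_mono2\<close>)
    have le: "t \<le> 1 + t powr p" if "t \<ge> 0" for t :: real
    proof (cases "t \<le> 1")
      case False
      then have "t powr 1 \<le> t powr p" using p by (intro powr_mono) auto
      then show ?thesis using False by simp
    qed (simp add: add_increasing2)
    show ig: "integrable unit_measure g"
      by (rule Bochner_Integration.integrable_bound[of _ "\<lambda>\<theta>. 1 + \<bar>g \<theta>\<bar> powr p"])
         (use ip[of g] bd le in auto)
    show "AE \<theta> in unit_measure. (\<lambda>N. doubling_average k g N \<theta>) \<longlonglongrightarrow> (\<integral>\<theta>. g \<theta> \<partial>unit_measure)"
    proof (rule doubling_average_nonneg_limit[OF ud g bd(1) ig])
      show "AE \<theta> in unit_measure. convergent (\<lambda>N. doubling_average k g N \<theta>)"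
        by (intro conv ip) (use bd in auto)
      show "AE \<theta> in unit_measure. convergent (\<lambda>N. doubling_average k (\<lambda>\<theta>. min (g \<theta>) (real K)) N \<theta>)" for K
        by (intro conv ip) (use bd in \<open>auto simp: min_le_iff_disj\<close>)
    qed
  qed
  define fp fn where "fp = (\<lambda>\<theta>. max 0 (f \<theta>))" and "fn = (\<lambda>\<theta>. max 0 (- f \<theta>))"
  have m [measurable]: "fp \<in> borel_measurable borel" "fn \<in> borel_measurable borel"
    unfolding fp_def fn_def by measurable
  have bd: "0 \<le> fp \<theta>" "fp \<theta> \<le> \<bar>f \<theta>\<bar>" "0 \<le> fn \<theta>" "fn \<theta> \<le> \<bar>f \<theta>\<bar>" for \<theta>
    by (auto simp: fp_def fn_def)
  have f_eq: "f \<theta> = fp \<theta> - fn \<theta>" for \<theta> by (auto simp: fp_def fn_def)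
  have "(\<integral>\<theta>. f \<theta> \<partial>unit_measure) = (\<integral>\<theta>. fp \<theta> \<partial>unit_measure) - (\<integral>\<theta>. fn \<theta> \<partial>unit_measure)"
    unfolding f_eq by (intro Bochner_Integration.integral_diff int_g m bd)
  moreover have "(\<Sum>n=1..N. f ((doubling ^^ k n) \<theta>)) / real N = doubling_average k fp N \<theta> - doubling_average k fn N \<theta>" for N \<theta>
    unfolding f_eq doubling_average_def by (simp add: sum_subtractf diff_divide_distrib)
  ultimately show ?thesis
    using nn[OF m(1) bd(1,2)] nn[OF m(2) bd(3,4)]
    by (simp only:) (elim AE_mp, intro AE_I2 impI tendsto_diff)
qed

section \<open>Local integrability of powers of the logarithm\<close>

text \<open>Near 0 a power of the logarithm is dominated by a multiple of |t|^(-1/2); for 1 <= |t|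
  <= D it is at most its value at \<open>D\<close>.\<close>

lemma nn_integral_ln_power_finite:
  "(\<integral>\<^sup>+t. ennreal (\<bar>ln \<bar>t\<bar>\<bar> ^ q) * indicator {-D..D} t \<partial>lborel) < \<infinity>"
proof (cases "D \<le> 0")
  case True
  have "(\<integral>\<^sup>+t. ennreal (\<bar>ln \<bar>t\<bar>\<bar> ^ q) * indicator {-D..D} t \<partial>lborel) = (\<integral>\<^sup>+t. 0 \<partial>(lborel :: real measure))"
  proof (intro nn_integral_cong_AE)
    have "AE t in lborel. t \<noteq> (0::real)" by (rule AE_lborel_singleton)
    then show "AE t in lborel. ennreal (\<bar>ln \<bar>t\<bar>\<bar> ^ q) * indicator {-D..D} t = 0"
      by eventually_elim (use True in \<open>auto simp: indicator_def\<close>)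
  qed
  then show ?thesis by simp
next
  case False
  \<comment> \<open>In ln x <= x^a / a take a = 1 / (2 m). The q-th power is then of order x^(q / (2
    m)), and \<open>m = q + 1\<close> keeps this exponent below 1/2 and \<open>m\<close> positive
    for every \<open>q\<close>.\<close>
  define m where "m = real q + 1"
  define A where "A = (2 * m) ^ q"
  define B where "B = \<bar>ln D\<bar> ^ q"
  have m: "m > 0" by (simp add: m_def)
  have bound: "\<bar>ln \<bar>t\<bar>\<bar> ^ q \<le> A * \<bar>t\<bar> powr (- (1/2)) + A + B" if t: "t \<noteq> 0" "\<bar>t\<bar> \<le> D" for t
  proof (cases "\<bar>t\<bar> \<le> 1")
    case True
    have "ln (1 / \<bar>t\<bar>) \<le> (1 / \<bar>t\<bar>) powr (1 / (2 * m)) / (1 / (2 * m))"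
      by (rule ln_powr_bound) (use True t m in auto)
    moreover have "ln (1 / \<bar>t\<bar>) = \<bar>ln \<bar>t\<bar>\<bar>"
      using True t by (simp add: ln_div)
    ultimately have "\<bar>ln \<bar>t\<bar>\<bar> \<le> 2 * m * (1 / \<bar>t\<bar>) powr (1 / (2 * m))"
      using m by (simp add: field_simps)
    then have "\<bar>ln \<bar>t\<bar>\<bar> ^ q \<le> (2 * m * (1 / \<bar>t\<bar>) powr (1 / (2 * m))) ^ q" by (intro power_mono) auto
    also have "\<dots> = A * (1 / \<bar>t\<bar>) powr (real q / (2 * m))"
      using t by (simp add: power_mult_distrib A_def powr_realpow[symmetric] powr_powr)
    also have "\<dots> \<le> A * (1 / \<bar>t\<bar>) powr (1/2)"
      using True t m by (intro mult_left_mono powr_mono) (auto simp: A_def m_def field_simps)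
    also have "(1 / \<bar>t\<bar>) powr (1/2) = \<bar>t\<bar> powr (- (1/2))"
      using t by (simp add: powr_divide powr_minus_divide)
    finally show ?thesis using m by (simp add: A_def B_def add_increasing2)
  next
    case F: False
    then have "0 \<le> ln \<bar>t\<bar>" "ln \<bar>t\<bar> \<le> ln D" using t by auto
    then have "\<bar>ln \<bar>t\<bar>\<bar> ^ q \<le> B" unfolding B_def by (intro power_mono) auto
    moreover have "0 \<le> A * \<bar>t\<bar> powr (- (1/2)) + A" using m by (simp add: A_def)
    ultimately show ?thesis by simp
  qed
  have half: "(\<integral>\<^sup>+t. ennreal (t powr (- (1/2))) * indicator {0..D} t \<partial>lborel) = ennreal (D powr (1/2) / (1/2))"
    using nn_integral_has_integral_lebesgue'[OF _ has_integral_powr_from_0[of "- (1/2)" D]] False by simp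
  have half': "(\<integral>\<^sup>+t. ennreal (\<bar>t\<bar> powr (- (1/2))) * indicator {-D..0} t \<partial>lborel) = ennreal (D powr (1/2) / (1/2))"
  proof -
    have "(\<integral>\<^sup>+t. ennreal (\<bar>t\<bar> powr (- (1/2))) * indicator {-D..0} t \<partial>lborel) =
        (\<integral>\<^sup>+t. ennreal (\<bar>t\<bar> powr (- (1/2))) * indicator {0..D} t \<partial>lborel)"
      by (subst nn_integral_real_affine[where c = "-1" and t = 0])
         (auto intro!: nn_integral_cong simp: indicator_def)
    also have "\<dots> = (\<integral>\<^sup>+t. ennreal (t powr (- (1/2))) * indicator {0..D} t \<partial>lborel)"
      by (intro nn_integral_cong) (auto simp: indicator_def)
    finally show ?thesis using half by simp
  qed
  have AB: "A \<ge> 0" "B \<ge> 0" using m by (auto simp: A_def B_def)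
  have "(\<integral>\<^sup>+t. ennreal (\<bar>ln \<bar>t\<bar>\<bar> ^ q) * indicator {-D..D} t \<partial>lborel) \<le>
     (\<integral>\<^sup>+t. (ennreal A * (ennreal (\<bar>t\<bar> powr (- (1/2))) * indicator {-D..0} t) +
          ennreal A * (ennreal (t powr (- (1/2))) * indicator {0..D} t)) + ennreal (A + B) * indicator {-D..D} t \<partial>lborel)"
  proof (intro nn_integral_mono_AE)
    have "AE t in lborel. t \<noteq> (0::real)" by (rule AE_lborel_singleton)
    then show "AE t in lborel. ennreal (\<bar>ln \<bar>t\<bar>\<bar> ^ q) * indicator {-D..D} t \<le>
        (ennreal A * (ennreal (\<bar>t\<bar> powr (- (1/2))) * indicator {-D..0} t) +
          ennreal A * (ennreal (t powr (- (1/2))) * indicator {0..D} t)) + ennreal (A + B) * indicator {-D..D} t"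
    proof eventually_elim
      case (elim t)
      show ?case
      proof (cases "\<bar>t\<bar> \<le> D")
        case True
        have "ennreal (\<bar>ln \<bar>t\<bar>\<bar> ^ q) \<le> ennreal (A * \<bar>t\<bar> powr (- (1/2)) + (A + B))"
          using bound[OF elim True] by (intro ennreal_leI) (simp add: add.assoc)
        also have "\<dots> = ennreal A * ennreal (\<bar>t\<bar> powr (- (1/2))) + ennreal (A + B)"
          using AB by (simp add: ennreal_mult)
        finally show ?thesis using True elim by (cases "t < 0") (auto simp: indicator_def)
      qed (auto simp: indicator_def)
    qed
  qed
  also have "\<dots> = ennreal A * ennreal (D powr (1/2) / (1/2)) + ennreal A * ennreal (D powr (1/2) / (1/2)) + ennreal (A + B) * ennreal (2 * D)"
    using False by (simp add: nn_integral_add nn_integral_cmult half half' del: ennreal_plus)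
  also have "\<dots> < \<infinity>" by (simp add: ennreal_mult_less_top)
  finally show ?thesis .
qed

section \<open>Powers of the logarithm of a holomorphic function\<close>

text \<open>The bound has to be proportional to -ln |a|, the weight of the zero \<open>a\<close> in
  Jensen's formula at the centre, because only the sum of these weights is controlled. If
  \<open>a\<close> is close to the circle it is far from \<open>z\<close>, and ln t <= t - 1
  together with the Blaschke identity produces a factor 1 - |a|^2. Otherwise -ln |a| is bounded
  below, and a constant multiple of it absorbs the logarithm of the distance.\<close>

lemma ln_blaschke_bound:
  assumes \<rho>: "0 < \<rho>" "\<rho> < 1"
  obtains C where "C > 0"
    "\<And>a z. 0 < norm a \<Longrightarrow> norm a < 1 \<Longrightarrow> norm z \<le> \<rho> \<Longrightarrow> z \<noteq> a \<Longrightarrow>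
       - ln (norm (blaschke a z)) \<le> C * (- ln (norm a)) * (1 + \<bar>ln (norm (z - a))\<bar>)"
proof -
  \<comment> \<open>The circle of radius (1 + \<rho>) / 2 separates the two cases:
    \<open>\<delta>\<close> is its distance from the disc of radius \<rho>, and \<open>c0\<close> a
    lower bound for the weights of zeros inside it.\<close>
  define \<delta> where "\<delta> = (1 - \<rho>) / 2"
  define c0 where "c0 = - ln ((1 + \<rho>) / 2)"
  have \<delta>: "\<delta> > 0" using \<rho> by (simp add: \<delta>_def)
  have c0: "c0 > 0" using \<rho> by (simp add: c0_def)
  define C where "C = 1 / \<delta>\<^sup>2 + 1 / c0"
  have C: "C > 0" "1 / \<delta>\<^sup>2 \<le> C" "1 / c0 \<le> C" using \<delta> c0 by (auto simp: C_def add_pos_pos)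
  have main: "- ln (norm (blaschke a z)) \<le> C * (- ln (norm a)) * (1 + \<bar>ln (norm (z - a))\<bar>)"
    if a: "0 < norm a" "norm a < 1" and z: "norm z \<le> \<rho>" "z \<noteq> a" for a z
  proof -
    define w where "w = - ln (norm a)"
    have w: "w > 0" using a by (simp add: w_def)
    have nz: "1 - cnj a * z \<noteq> 0" using one_minus_cnj_mult_nonzero[of a z] a z \<rho> by auto
    have pos: "norm (1 - cnj a * z) > 0" "norm (z - a) > 0" using nz z by auto
    have eq: "- ln (norm (blaschke a z)) = ln (norm (1 - cnj a * z)) - ln (norm (z - a))"
      using pos by (simp add: blaschke_def norm_divide ln_div)
    have "- ln (norm (blaschke a z)) \<le> C * w * 1 \<or> - ln (norm (blaschke a z)) \<le> C * w * (1 + \<bar>ln (norm (z - a))\<bar>)"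
    proof (cases "norm a \<ge> (1 + \<rho>) / 2")
      case True
      have "norm a \<le> norm (z - a) + norm z"
        using norm_triangle_ineq[of "a - z" z] by (simp add: norm_minus_commute)
      then have "\<delta> \<le> norm (z - a)" using True z by (simp add: \<delta>_def field_simps)
      then have d2: "\<delta>\<^sup>2 \<le> (norm (z - a))\<^sup>2" using \<delta> by (intro power_mono) auto
      define t where "t = (norm (1 - cnj a * z))\<^sup>2 / (norm (z - a))\<^sup>2"
      have t0: "t > 0" using pos by (simp add: t_def)
      have "ln t = 2 * (ln (norm (1 - cnj a * z)) - ln (norm (z - a)))"
        using pos by (simp add: t_def ln_div ln_realpow)
      then have "2 * (- ln (norm (blaschke a z))) = ln t" using eq by simp
      also have "\<dots> \<le> t - 1" by (rule ln_le_minus_one[OF t0])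
      also have "\<dots> = (1 - (norm a)\<^sup>2) * (1 - (norm z)\<^sup>2) / (norm (z - a))\<^sup>2"
        using norm_blaschke_identity[of a z] pos by (simp add: t_def field_simps)
      also have "\<dots> \<le> (2 * w * 1) / \<delta>\<^sup>2"
      proof (intro frac_le mult_mono d2)
        have 1: "1 - norm a \<le> w" using ln_le_minus_one[of "norm a"] a by (simp add: w_def)
        have "1 - (norm a)\<^sup>2 = (1 - norm a) * (1 + norm a)" by (simp add: algebra_simps power2_eq_square)
        also have "\<dots> \<le> (1 - norm a) * 2" using a by (intro mult_left_mono) auto
        also have "\<dots> \<le> w * 2" using 1 by (rule mult_right_mono) simp
        finally show "1 - (norm a)\<^sup>2 \<le> 2 * w" by (simp only: mult.commute)
      qed (use z \<rho> w \<delta> a in \<open>auto simp: power_le_one\<close>)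
      finally have "- ln (norm (blaschke a z)) \<le> 1 / \<delta>\<^sup>2 * w" by simp
      also have "\<dots> \<le> C * w" using C w by (intro mult_right_mono) auto
      finally show ?thesis by simp
    next
      case False
      then have "ln (norm a) \<le> ln ((1 + \<rho>) / 2)" using a \<rho> by simp
      then have "c0 \<le> w" by (simp add: w_def c0_def)
      then have "1 \<le> 1 / c0 * w" using c0 by (simp add: field_simps)
      also have "\<dots> \<le> C * w" using C w by (intro mult_right_mono) auto
      finally have Cw: "1 \<le> C * w" .
      have "norm (1 - cnj a * z) \<le> norm (1::complex) + norm (cnj a * z)" by (rule norm_triangle_ineq4)
      also have "norm (cnj a * z) \<le> 1 * 1" unfolding norm_mult using a z \<rho> by (intro mult_mono) auto
      finally have "ln (norm (1 - cnj a * z)) \<le> 1"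
        using ln_le_minus_one[OF pos(1)] by simp
      then have "- ln (norm (blaschke a z)) \<le> 1 * (1 + \<bar>ln (norm (z - a))\<bar>)" unfolding eq by simp
      also have "\<dots> \<le> C * w * (1 + \<bar>ln (norm (z - a))\<bar>)" using Cw by (intro mult_right_mono) auto
      finally show ?thesis by simp
    qed
    moreover have "C * w * 1 \<le> C * w * (1 + \<bar>ln (norm (z - a))\<bar>)" using C w by (intro mult_left_mono) auto
    ultimately show ?thesis unfolding w_def by linarith
  qed
  show thesis using that[OF C(1) main] .
qed

lemma poisson_le:
  assumes "norm w \<le> \<rho>" "\<rho> < 1"
  shows "poisson w \<theta> \<le> (1 + \<rho>) / (1 - \<rho>)"
proof -
  have "1 - norm w \<le> norm (circ \<theta> - w)" using norm_triangle_ineq2[of "circ \<theta>" w] by simp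
  then have "(1 - norm w)\<^sup>2 \<le> (norm (circ \<theta> - w))\<^sup>2" using assms by (intro power_mono) auto
  then have "poisson w \<theta> \<le> (1 - (norm w)\<^sup>2) / (1 - norm w)\<^sup>2"
    unfolding poisson_def using assms by (intro divide_left_mono mult_pos_pos) (auto simp: power_le_one intro!: zero_less_power)
  also have "1 - (norm w)\<^sup>2 = (1 - norm w) * (1 + norm w)" by (simp add: algebra_simps power2_eq_square)
  also have "(1 - norm w) * (1 + norm w) / (1 - norm w)\<^sup>2 = (1 + norm w) / (1 - norm w)"
    using assms by (simp add: power2_eq_square)
  also have "\<dots> \<le> (1 + \<rho>) / (1 - \<rho>)" using assms norm_ge_zero[of w] by (intro frac_le) linarith+
  finally show ?thesis .
qed

text \<open>
  On a smaller disc the logarithm of a bounded function is a sum, with nonnegative weights of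
  controlled total mass, of a constant and of logarithms of distances to zeros.
\<close>

lemma minus_ln_norm_le_weighted_sum:
  assumes \<rho>: "0 < \<rho>" "\<rho> < 1"
  shows "\<exists>C>0. \<forall>f S. open S \<longrightarrow> cball 0 1 \<subseteq> S \<longrightarrow> f holomorphic_on S \<longrightarrow> (\<forall>z. norm z = 1 \<longrightarrow> f z \<noteq> 0) \<longrightarrow>
       (\<forall>z. norm z \<le> 1 \<longrightarrow> norm (f z) \<le> 1) \<longrightarrow> f 0 \<noteq> 0 \<longrightarrow>
       (\<exists>Z V w. finite Z \<and> Z \<subseteq> ball 0 1 \<and> V \<ge> 0 \<and> (\<forall>a\<in>Z. w a \<ge> (0::real)) \<and> V + (\<Sum>a\<in>Z. w a) = - ln (norm (f 0)) \<and>
         (\<forall>z. norm z \<le> \<rho> \<longrightarrow> f z \<noteq> 0 \<longrightarrow> - ln (norm (f z)) \<le> C * (V + (\<Sum>a\<in>Z. w a * (1 + \<bar>ln (norm (z - a))\<bar>)))))"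
proof -
  obtain C0 where C0: "C0 > 0"
    "\<And>a z. 0 < norm a \<Longrightarrow> norm a < 1 \<Longrightarrow> norm z \<le> \<rho> \<Longrightarrow> z \<noteq> a \<Longrightarrow>
       - ln (norm (blaschke a z)) \<le> C0 * (- ln (norm a)) * (1 + \<bar>ln (norm (z - a))\<bar>)"
    using ln_blaschke_bound[OF \<rho>] by blast
  define L where "L = (1 + \<rho>) / (1 - \<rho>)"
  define C where "C = max C0 L"
  have "C > 0" using C0(1) by (simp add: C_def)
  have "\<exists>Z V w. finite Z \<and> Z \<subseteq> ball 0 1 \<and> V \<ge> 0 \<and> (\<forall>a\<in>Z. w a \<ge> (0::real)) \<and> V + (\<Sum>a\<in>Z. w a) = - ln (norm (f 0)) \<and>
         (\<forall>z. norm z \<le> \<rho> \<longrightarrow> f z \<noteq> 0 \<longrightarrow> - ln (norm (f z)) \<le> C * (V + (\<Sum>a\<in>Z. w a * (1 + \<bar>ln (norm (z - a))\<bar>))))"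
    if S: "open S" "cball 0 1 \<subseteq> S" and f: "f holomorphic_on S" and nz: "\<And>z. norm z = 1 \<Longrightarrow> f z \<noteq> 0"
      and bd: "\<And>z. norm z \<le> 1 \<Longrightarrow> norm (f z) \<le> 1" and f0: "f 0 \<noteq> 0" for f S
  proof -
    define Z where "Z = {a. norm a < 1 \<and> f a = 0}"
    define w where "w = (\<lambda>a. of_int (zorder f a) * (- ln (norm a)) :: real)"
    define u where "u = (\<lambda>\<theta>. - ln (norm (f (circ \<theta>))))"
    \<comment> \<open>By Jensen's formula at 0 this is the mean of \<open>u\<close> on the unit
      circle, which is why it is nonnegative.\<close>
    define V where "V = - ln (norm (f 0)) - (\<Sum>a\<in>Z. w a)"
    note pj = poisson_jensen[OF S f nz, folded Z_def]
    have fin: "finite Z" and zpos: "\<And>a. a \<in> Z \<Longrightarrow> zorder f a > 0"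
      using pj(1,2)[of 0] f0 by auto
    have u0: "u \<theta> \<ge> 0" for \<theta> using bd[of "circ \<theta>"] nz[of "circ \<theta>"] by (simp add: u_def)
    have na: "0 < norm a" "norm a < 1" if "a \<in> Z" for a using that f0 by (auto simp: Z_def)
    have w0: "w a \<ge> 0" if "a \<in> Z" for a
      unfolding w_def using na[OF that] zpos[OF that] by (intro mult_nonneg_nonneg) auto
    have hu: "(u has_integral V) {0..1}"
    proof -
      have "((\<lambda>\<theta>. - (poisson 0 \<theta> * ln (norm (f (circ \<theta>))))) has_integral
         - (ln (norm (f 0)) - (\<Sum>a\<in>Z. zorder f a * ln (norm (blaschke a 0))))) {0..1}"
        by (intro has_integral_neg pj(3)) (use f0 in auto)
      then show ?thesis by (simp add: u_def[abs_def] V_def w_def blaschke_def sum_negf)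
    qed
    have V0: "V \<ge> 0" by (rule has_integral_nonneg[OF hu]) (use u0 in auto)
    have "- ln (norm (f z)) \<le> C * (V + (\<Sum>a\<in>Z. w a * (1 + \<bar>ln (norm (z - a))\<bar>)))"
      if z: "norm z \<le> \<rho>" "f z \<noteq> 0" for z
    proof -
      have z1: "norm z < 1" using z \<rho> by simp
      define s where "s = (\<Sum>a\<in>Z. zorder f a * ln (norm (blaschke a z)))"
      have "((\<lambda>\<theta>. - (poisson z \<theta> * ln (norm (f (circ \<theta>))))) has_integral - (ln (norm (f z)) - s)) {0..1}"
        unfolding s_def by (intro has_integral_neg pj(3) z1 z(2))
      then have "((\<lambda>\<theta>. poisson z \<theta> * u \<theta>) has_integral - ln (norm (f z)) + s) {0..1}"
        by (simp add: u_def)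
      \<comment> \<open>Harnack's inequality in effect: \<open>L\<close> bounds the Poisson kernel
        for points of the smaller disc, and \<open>u\<close> is nonnegative.\<close>
      moreover have "((\<lambda>\<theta>. L * u \<theta>) has_integral L * V) {0..1}" by (rule has_integral_mult_right[OF hu])
      ultimately have "- ln (norm (f z)) + s \<le> L * V"
        by (rule has_integral_le) (rule mult_right_mono[OF poisson_le[OF z(1) \<rho>(2), folded L_def] u0])
      moreover have "- s \<le> (\<Sum>a\<in>Z. C * (w a * (1 + \<bar>ln (norm (z - a))\<bar>)))"
        unfolding s_def sum_negf[symmetric]
      proof (rule sum_mono)
        fix a assume a: "a \<in> Z"
        have "z \<noteq> a" using a z by (auto simp: Z_def)
        then have "of_int (zorder f a) * (- ln (norm (blaschke a z))) \<le>
            of_int (zorder f a) * (C0 * (- ln (norm a)) * (1 + \<bar>ln (norm (z - a))\<bar>))"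
          using zpos[OF a] na[OF a] z by (intro mult_left_mono C0(2)) auto
        also have "\<dots> = C0 * (w a * (1 + \<bar>ln (norm (z - a))\<bar>))" by (simp add: w_def mult_ac)
        also have "\<dots> \<le> C * (w a * (1 + \<bar>ln (norm (z - a))\<bar>))"
          using w0[OF a] by (intro mult_right_mono) (auto simp: C_def)
        finally show "- (of_int (zorder f a) * ln (norm (blaschke a z))) \<le> C * (w a * (1 + \<bar>ln (norm (z - a))\<bar>))" by simp
      qed
      moreover have "L * V \<le> C * V" using V0 by (intro mult_right_mono) (auto simp: C_def)
      ultimately show ?thesis by (simp add: distrib_left sum_distrib_left)
    qed
    then show ?thesis
      using fin V0 w0 by (intro exI[of _ Z] exI[of _ V] exI[of _ w]) (auto simp: Z_def V_def)
  qed
  then show ?thesis using \<open>C > 0\<close> by (intro exI[of _ C] conjI allI impI) simp_all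
qed

text \<open>Jensen's inequality for x^q, convex on the whole line as \<open>q\<close> is even, with
  the weights divided by their sum. If the sum is 0, both sides vanish.\<close>

lemma power_mean_weighted:
  fixes v x :: "'a \<Rightarrow> real"
  assumes fin: "finite I" and v: "\<And>i. i \<in> I \<Longrightarrow> v i \<ge> 0" and q: "even q" "q > 0"
  shows "(\<Sum>i\<in>I. v i * x i) ^ q \<le> (\<Sum>i\<in>I. v i) ^ (q - 1) * (\<Sum>i\<in>I. v i * x i ^ q)"
proof (cases "(\<Sum>i\<in>I. v i) = 0")
  case True
  then have "v i = 0" if "i \<in> I" for i using sum_nonneg_eq_0_iff[OF fin v] that by auto
  then show ?thesis using q by (simp add: power_0_left)
next
  case False
  define W where "W = (\<Sum>i\<in>I. v i)"
  have W: "W > 0" using False sum_nonneg[of I v] v unfolding W_def by fastforce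
  have "(\<Sum>i\<in>I. (v i / W) *\<^sub>R x i) ^ q \<le> (\<Sum>i\<in>I. v i / W * x i ^ q)"
  proof (rule convex_on_sum[OF fin _ convex_power_even[OF q(1)]])
    show "I \<noteq> {}" using False by auto
    show "(\<Sum>i\<in>I. v i / W) = 1" using W by (simp add: sum_divide_distrib[symmetric] W_def)
  qed (use v W in auto)
  then have "((\<Sum>i\<in>I. v i * x i) / W) ^ q \<le> (\<Sum>i\<in>I. v i * x i ^ q) / W"
    by (simp add: sum_divide_distrib)
  then have "(\<Sum>i\<in>I. v i * x i) ^ q \<le> W ^ q * ((\<Sum>i\<in>I. v i * x i ^ q) / W)"
    using W by (simp add: power_divide field_simps)
  also have "W ^ q = W * W ^ (q - 1)" using q by (simp add: power_eq_if)
  finally show ?thesis using W by (simp add: W_def[symmetric])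
qed


text \<open>\<open>K\<close> depends on \<open>q\<close> only, so the estimate can be summed over
  windows. The segment on the line at distance 3/2 to the left of \<open>c\<close> stays within 8/5
  of \<open>c\<close>, and \<open>R > 17/10\<close> brings it into the disc of radius 19/20 after
  scaling. There the logarithm is bounded by a weighted sum of total weight L = ln (M / |F c|).
  Convexity moves the q-th power inside at the cost of L^(q - 1), and integrating the single
  logarithms gives the last factor L.\<close>

lemma local_ln_power_integral:
  assumes q: "even q" "q > 0"
  obtains K :: real where "K \<ge> 0"
    "\<And>F c M. F holomorphic_on UNIV \<Longrightarrow> (\<And>z. z \<in> cball c (7/4) \<Longrightarrow> norm (F z) \<le> M) \<Longrightarrow> F c \<noteq> 0 \<Longrightarrow>
       (\<integral>\<^sup>+y. ennreal (\<bar>ln (norm (F (c - 3/2 + \<i> * of_real y)) / M)\<bar> ^ q) * indicator {-1/2..1/2} y \<partial>lborel)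
         \<le> ennreal (K * ln (M / norm (F c)) ^ q)"
proof -
  have \<rho>: "(0::real) < 19/20" "(19/20::real) < 1" by simp_all
  obtain C where C: "C > 0" and C_bound:
    "\<forall>f S. open S \<longrightarrow> cball 0 1 \<subseteq> S \<longrightarrow> f holomorphic_on S \<longrightarrow> (\<forall>z. norm z = 1 \<longrightarrow> f z \<noteq> 0) \<longrightarrow>
       (\<forall>z. norm z \<le> 1 \<longrightarrow> norm (f z) \<le> 1) \<longrightarrow> f 0 \<noteq> 0 \<longrightarrow>
       (\<exists>Z V w. finite Z \<and> Z \<subseteq> ball 0 1 \<and> V \<ge> 0 \<and> (\<forall>a\<in>Z. w a \<ge> (0::real)) \<and> V + (\<Sum>a\<in>Z. w a) = - ln (norm (f 0)) \<and>
         (\<forall>z. norm z \<le> 19/20 \<longrightarrow> f z \<noteq> 0 \<longrightarrow> - ln (norm (f z)) \<le> C * (V + (\<Sum>a\<in>Z. w a * (1 + \<bar>ln (norm (z - a))\<bar>)))))"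
    using minus_ln_norm_le_weighted_sum[OF \<rho>] by (elim exE conjE) (rule that; assumption)
  define J where "J = enn2real (\<integral>\<^sup>+t. ennreal (\<bar>ln \<bar>t\<bar>\<bar> ^ q) * indicator {-3..3} t \<partial>lborel)"
  have J: "(\<integral>\<^sup>+t. ennreal (\<bar>ln \<bar>t\<bar>\<bar> ^ q) * indicator {-3..3} t \<partial>lborel) = ennreal J"
    unfolding J_def using nn_integral_ln_power_finite[of q 3] by (subst ennreal_enn2real) auto
  have J0: "J \<ge> 0" by (simp add: J_def)
  define K1 where "K1 = 6 ^ q + 2 ^ q * J"
  have K1: "K1 \<ge> 1" using J0 one_le_power[of "6::real" q] by (simp add: K1_def add_increasing2)
  have "(\<integral>\<^sup>+y. ennreal (\<bar>ln (norm (F (c - 3/2 + \<i> * of_real y)) / M)\<bar> ^ q) * indicator {-1/2..1/2} y \<partial>lborel)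
         \<le> ennreal (C ^ q * K1 * ln (M / norm (F c)) ^ q)"
    if F: "F holomorphic_on UNIV" and bd: "\<And>z. z \<in> cball c (7/4) \<Longrightarrow> norm (F z) \<le> M" and Fc: "F c \<noteq> 0" for F c M
  proof -
    have "norm (F c) \<le> M" by (rule bd) simp
    moreover have "norm (F c) > 0" using Fc by simp
    ultimately have M: "M > 0" by linarith
    have finZ0: "finite {a\<in>cball c 2. F a = 0}"
      using factor_zeros_compact_convex[OF compact_cball convex_cball subset_UNIV open_UNIV F, of c c 2] Fc by auto
    \<comment> \<open>Only finitely many radii meet a zero, so the interval contains the radius of a
      zero-free circle.\<close>
    obtain R where R: "17/10 < R" "R < 7/4" "R \<notin> dist c ` {a\<in>cball c 2. F a = 0}"
    proof -
      have "infinite ({17/10<..<7/4} - dist c ` {a\<in>cball c 2. F a = 0})"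
        using finZ0 by (intro Diff_infinite_finite) (auto simp: infinite_Ioo)
      then have "{17/10<..<7/4} - dist c ` {a\<in>cball c 2. F a = 0} \<noteq> {}" by (metis finite.emptyI)
      then obtain R where "R \<in> {17/10<..<7/4} - dist c ` {a\<in>cball c 2. F a = 0}" by blast
      then show thesis unfolding Diff_iff greaterThanLessThan_iff by (elim conjE) (rule that)
    qed
    define f where "f = (\<lambda>z. F (c + of_real R * z) / of_real M)"
    have f_hol: "f holomorphic_on UNIV"
    proof -
      have "F \<circ> (\<lambda>z. c + of_real R * z) holomorphic_on UNIV"
        by (rule holomorphic_on_compose_gen[OF _ F]) (auto intro!: holomorphic_intros)
      then show ?thesis unfolding f_def o_def using M by (auto intro!: holomorphic_intros)
    qed
    have f_sphere: "f z \<noteq> 0" if "norm z = 1" for z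
    proof
      assume "f z = 0"
      then have "F (c + of_real R * z) = 0" using M by (simp add: f_def)
      moreover have "dist c (c + of_real R * z) = R" using that R by (simp add: dist_norm norm_mult)
      ultimately show False using R by (auto simp: image_iff)
    qed
    have f_le: "norm (f z) \<le> 1" if "norm z \<le> 1" for z
    proof -
      have "R * norm z \<le> 7/4 * 1" using R that by (intro mult_mono) auto
      then have "norm (F (c + of_real R * z)) \<le> M" using R by (intro bd) (simp add: dist_norm norm_mult)
      then show ?thesis using M by (simp add: f_def norm_divide divide_le_eq)
    qed
    have f0: "f 0 \<noteq> 0" using Fc M by (simp add: f_def)
    define L where "L = - ln (norm (f 0))"
    have L_eq: "L = ln (M / norm (F c))" using M Fc by (simp add: L_def f_def norm_divide ln_div)
    obtain Z V w where Z: "finite Z" "Z \<subseteq> ball 0 1" and V: "V \<ge> 0" and w: "\<And>a. a \<in> Z \<Longrightarrow> w a \<ge> (0::real)"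
      and sum: "V + (\<Sum>a\<in>Z. w a) = L"
      and le: "\<And>z. norm z \<le> 19/20 \<Longrightarrow> f z \<noteq> 0 \<Longrightarrow> - ln (norm (f z)) \<le> C * (V + (\<Sum>a\<in>Z. w a * (1 + \<bar>ln (norm (z - a))\<bar>)))"
    proof -
      have "\<exists>Z V w. finite Z \<and> Z \<subseteq> ball 0 1 \<and> V \<ge> 0 \<and> (\<forall>a\<in>Z. w a \<ge> (0::real)) \<and> V + (\<Sum>a\<in>Z. w a) = - ln (norm (f 0)) \<and>
         (\<forall>z. norm z \<le> 19/20 \<longrightarrow> f z \<noteq> 0 \<longrightarrow> - ln (norm (f z)) \<le> C * (V + (\<Sum>a\<in>Z. w a * (1 + \<bar>ln (norm (z - a))\<bar>))))"
        using f_sphere f_le by (intro C_bound[rule_format, OF open_UNIV subset_UNIV f_hol _ _ f0]) auto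
      then show thesis unfolding L_def[symmetric] by (elim exE conjE) (rule that, auto)
    qed
    have L0: "L \<ge> 0" unfolding sum[symmetric] using V w by (intro add_nonneg_nonneg sum_nonneg) auto
    \<comment> \<open>The height of the zero in the coordinate \<open>y\<close>. Distances in the
      plane are bounded below by differences of heights; this leaves a logarithm of one real
      variable, the integral of whose power is at most \<open>J\<close> wherever the zero
      lies.\<close>
    define b where "b = (\<lambda>a. R * Im a)"
    define H where "H = (\<lambda>a y. 6 ^ q + 2 ^ q * \<bar>ln \<bar>y - b a\<bar>\<bar> ^ q)"
    have H0: "H a y \<ge> 0" for a y by (simp add: H_def)
    define c1 where "c1 = C ^ q * L ^ (q - 1)"
    have c1: "c1 \<ge> 0" using C L0 by (simp add: c1_def)
    have point: "\<bar>ln (norm (F (c - 3/2 + \<i> * of_real y)) / M)\<bar> ^ q \<le> c1 * (V + (\<Sum>a\<in>Z. w a * H a y))"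
      if y: "\<bar>y\<bar> \<le> 1/2" and nb: "\<And>a. a \<in> Z \<Longrightarrow> y \<noteq> b a" for y
    proof (cases "F (c - 3/2 + \<i> * of_real y) = 0")
      \<comment> \<open>Here \<open>ln 0 = 0\<close>, so the left-hand side is 0.\<close>
      case True
      have "0 \<le> c1 * (V + (\<Sum>a\<in>Z. w a * H a y))"
        using c1 V w H0 by (intro mult_nonneg_nonneg add_nonneg_nonneg sum_nonneg) auto
      then show ?thesis using True q by (simp add: power_0_left)
    next
      case False
      define z where "z = (- 3/2 + \<i> * of_real y) / of_real R"
      have Rz: "of_real R * z = - 3/2 + \<i> * of_real y" using R by (simp add: z_def)
      have fz: "f z = F (c - 3/2 + \<i> * of_real y) / of_real M"
      proof -
        have "c + (- 3/2 + \<i> * of_real y) = c - 3/2 + \<i> * of_real y" by simp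
        then show ?thesis unfolding f_def Rz by (simp only:)
      qed
      have nz: "norm z \<le> 19/20"
      proof -
        have "\<bar>y\<bar>\<^sup>2 \<le> (1/2)\<^sup>2" using y by (intro power_mono) auto
        then have "(norm (- 3/2 + \<i> * of_real y))\<^sup>2 \<le> (16/10)\<^sup>2"
          by (simp only: cmod_power2) (simp add: power2_eq_square)
        then have "norm (- 3/2 + \<i> * of_real y) \<le> 16/10" by (rule power2_le_imp_le) simp
        then show ?thesis using R by (simp add: z_def norm_divide divide_le_eq)
      qed
      have "f z \<noteq> 0" using False M by (simp add: fz)
      then have "norm (f z) > 0" by simp
      moreover have "norm (f z) \<le> 1" using nz by (intro f_le) auto
      ultimately have "\<bar>ln (norm (f z))\<bar> = - ln (norm (f z))" by simp
      also have "\<dots> \<le> C * (V + (\<Sum>a\<in>Z. w a * (1 + \<bar>ln (norm (z - a))\<bar>)))"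
        by (rule le[OF nz \<open>f z \<noteq> 0\<close>])
      also have "\<dots> \<le> C * (V + (\<Sum>a\<in>Z. w a * (3 + \<bar>ln \<bar>y - b a\<bar>\<bar>)))"
      proof (intro mult_left_mono add_left_mono sum_mono)
        fix a assume a: "a \<in> Z"
        define d where "d = norm (z - a)"
        define e where "e = \<bar>y - b a\<bar>"
        have e: "e > 0" using nb[OF a] by (simp add: e_def)
        have "Im z = y / R" by (simp add: z_def)
        then have "y - b a = R * Im (z - a)" using R by (simp add: b_def right_diff_distrib)
        then have "e = R * \<bar>Im (z - a)\<bar>" using R by (simp add: e_def abs_mult)
        moreover have "\<bar>Im (z - a)\<bar> \<le> d" unfolding d_def by (rule abs_Im_le_cmod)
        ultimately have "e \<le> R * d" using R by simp
        also have "\<dots> \<le> 2 * d" using R by (intro mult_right_mono) (auto simp: d_def)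
        finally have ed: "e \<le> 2 * d" .
        then have d: "d > 0" using e by linarith
        have "d \<le> norm z + norm a" unfolding d_def by (rule norm_triangle_ineq4)
        moreover have "norm a < 1" using a Z by auto
        ultimately have "d \<le> 2" using nz by linarith
        then have "ln d \<le> 1" using ln_le_minus_one[OF d] by linarith
        moreover have "ln e \<le> ln (2 * d)" using ed e by simp
        moreover have "ln (2 * d) = ln 2 + ln d" using d by (simp add: ln_mult)
        moreover have "ln 2 \<le> (1::real)" using ln_le_minus_one[of 2] by simp
        ultimately have "1 + \<bar>ln d\<bar> \<le> 3 + \<bar>ln e\<bar>" by linarith
        then show "1 + \<bar>ln (norm (z - a))\<bar> \<le> 3 + \<bar>ln \<bar>y - b a\<bar>\<bar>" by (simp add: d_def e_def)
      qed (use w C in auto)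
      finally have 1: "\<bar>ln (norm (f z))\<bar> \<le> C * (V + (\<Sum>a\<in>Z. w a * (3 + \<bar>ln \<bar>y - b a\<bar>\<bar>)))" .
      \<comment> \<open>\<open>None\<close> is the index of the constant term, with weight
        \<open>V\<close> and value 1. The total weight is then exactly \<open>L\<close>.\<close>
      define I where "I = insert None (Some ` Z)"
      define v where "v = (\<lambda>i. case i of None \<Rightarrow> V | Some a \<Rightarrow> w a)"
      define x where "x = (\<lambda>i. case i of None \<Rightarrow> 1 | Some a \<Rightarrow> 3 + \<bar>ln \<bar>y - b a\<bar>\<bar>)"
      have sumI: "(\<Sum>i\<in>I. h i) = h None + (\<Sum>a\<in>Z. h (Some a))" for h :: "complex option \<Rightarrow> real"
        unfolding I_def using Z(1) by (subst sum.insert) (auto simp: sum.reindex)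
      have "(\<Sum>i\<in>I. v i * x i) ^ q \<le> (\<Sum>i\<in>I. v i) ^ (q - 1) * (\<Sum>i\<in>I. v i * x i ^ q)"
        by (rule power_mean_weighted[OF _ _ q]) (use Z V w in \<open>auto simp: I_def v_def\<close>)
      then have 2: "(V + (\<Sum>a\<in>Z. w a * (3 + \<bar>ln \<bar>y - b a\<bar>\<bar>))) ^ q \<le>
          L ^ (q - 1) * (V + (\<Sum>a\<in>Z. w a * (3 + \<bar>ln \<bar>y - b a\<bar>\<bar>) ^ q))"
        by (simp add: sumI v_def x_def sum)
      have 3: "(3 + t) ^ q \<le> 6 ^ q + 2 ^ q * t ^ q" if "t \<ge> 0" for t :: real
      proof (cases "t \<le> 3")
        case True
        then have "(3 + t) ^ q \<le> 6 ^ q" using that by (intro power_mono) auto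
        then show ?thesis using that by (simp add: add_increasing2)
      next
        case False
        then have "(3 + t) ^ q \<le> (2 * t) ^ q" using that by (intro power_mono) auto
        then show ?thesis by (simp add: power_mult_distrib add_increasing)
      qed
      have "\<bar>ln (norm (f z))\<bar> ^ q \<le> (C * (V + (\<Sum>a\<in>Z. w a * (3 + \<bar>ln \<bar>y - b a\<bar>\<bar>)))) ^ q"
        by (intro power_mono 1) auto
      also have "\<dots> \<le> C ^ q * (L ^ (q - 1) * (V + (\<Sum>a\<in>Z. w a * (3 + \<bar>ln \<bar>y - b a\<bar>\<bar>) ^ q)))"
        unfolding power_mult_distrib using 2 C by (intro mult_left_mono) auto
      also have "\<dots> \<le> C ^ q * (L ^ (q - 1) * (V + (\<Sum>a\<in>Z. w a * H a y)))"
        unfolding H_def using C L0 w by (intro mult_left_mono add_left_mono sum_mono 3) auto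
      finally show ?thesis using M by (simp add: fz norm_divide c1_def mult.assoc)
    qed
    have intH: "(\<integral>\<^sup>+y. ennreal (H a y) * indicator {-1/2..1/2} y \<partial>lborel) \<le> ennreal K1" if a: "a \<in> Z" for a
    proof -
      have "norm a < 1" using a Z by auto
      then have "\<bar>Im a\<bar> < 1" using abs_Im_le_cmod[of a] by linarith
      then have "\<bar>b a\<bar> \<le> 7/4 * 1" unfolding b_def abs_mult using R by (intro mult_mono) auto
      then have sub: "y \<in> {-1/2..1/2} \<Longrightarrow> y - b a \<in> {-3..3}" for y by auto
      have "(\<integral>\<^sup>+y. ennreal (\<bar>ln \<bar>y - b a\<bar>\<bar> ^ q) * indicator {-1/2..1/2} y \<partial>lborel) \<le>
          (\<integral>\<^sup>+y. ennreal (\<bar>ln \<bar>y - b a\<bar>\<bar> ^ q) * indicator {-3..3} (y - b a) \<partial>lborel)"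
        using sub by (intro nn_integral_mono mult_left_mono) (auto simp: indicator_def)
      also have "\<dots> = ennreal J"
        unfolding J[symmetric] by (subst nn_integral_real_affine[where c = 1 and t = "b a"]) simp_all
      finally have 1: "(\<integral>\<^sup>+y. ennreal (\<bar>ln \<bar>y - b a\<bar>\<bar> ^ q) * indicator {-1/2..1/2} y \<partial>lborel) \<le> ennreal J" .
      have "(\<integral>\<^sup>+y. ennreal (H a y) * indicator {-1/2..1/2} y \<partial>lborel) =
          (\<integral>\<^sup>+y. ennreal (6 ^ q) * indicator {-1/2..1/2} y +
             ennreal (2 ^ q) * (ennreal (\<bar>ln \<bar>y - b a\<bar>\<bar> ^ q) * indicator {-1/2..1/2} y) \<partial>lborel)"
        by (intro nn_integral_cong) (simp add: H_def indicator_def ennreal_mult)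
      also have "\<dots> = ennreal (6 ^ q) * emeasure lborel {-1/2..1/2::real} +
          ennreal (2 ^ q) * (\<integral>\<^sup>+y. ennreal (\<bar>ln \<bar>y - b a\<bar>\<bar> ^ q) * indicator {-1/2..1/2} y \<partial>lborel)"
        by (subst nn_integral_add) (auto simp: nn_integral_cmult nn_integral_cmult_indicator)
      also have "\<dots> \<le> ennreal (6 ^ q) + ennreal (2 ^ q) * ennreal J"
        using 1 by (intro add_mono mult_left_mono) auto
      also have "\<dots> = ennreal K1" using J0 by (simp add: K1_def ennreal_mult)
      finally show ?thesis .
    qed
    have "(\<integral>\<^sup>+y. ennreal (\<bar>ln (norm (F (c - 3/2 + \<i> * of_real y)) / M)\<bar> ^ q) * indicator {-1/2..1/2} y \<partial>lborel) \<le>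
        (\<integral>\<^sup>+y. ennreal (c1 * V) * indicator {-1/2..1/2} y + (\<Sum>a\<in>Z. ennreal (c1 * w a) * (ennreal (H a y) * indicator {-1/2..1/2} y)) \<partial>lborel)"
    proof (intro nn_integral_mono_AE)
      have "AE y in lborel. y \<notin> b ` Z"
        by (intro AE_not_in finite_imp_null_set_lborel) (use Z in auto)
      then show "AE y in lborel. ennreal (\<bar>ln (norm (F (c - 3/2 + \<i> * of_real y)) / M)\<bar> ^ q) * indicator {-1/2..1/2} y \<le>
         ennreal (c1 * V) * indicator {-1/2..1/2} y + (\<Sum>a\<in>Z. ennreal (c1 * w a) * (ennreal (H a y) * indicator {-1/2..1/2} y))"
      proof eventually_elim
        case (elim y)
        show ?case
        proof (cases "\<bar>y\<bar> \<le> 1/2")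
          case True
          have "ennreal (\<bar>ln (norm (F (c - 3/2 + \<i> * of_real y)) / M)\<bar> ^ q) \<le> ennreal (c1 * (V + (\<Sum>a\<in>Z. w a * H a y)))"
            using elim by (intro ennreal_leI point True) auto
          also have "\<dots> = ennreal (c1 * V) + ennreal (\<Sum>a\<in>Z. c1 * w a * H a y)"
            using c1 V w H0 by (subst ennreal_plus[symmetric]) (auto simp: distrib_left sum_distrib_left mult.assoc intro!: sum_nonneg mult_nonneg_nonneg)
          also have "ennreal (\<Sum>a\<in>Z. c1 * w a * H a y) = (\<Sum>a\<in>Z. ennreal (c1 * w a) * ennreal (H a y))"
            using c1 w H0 by (subst sum_ennreal[symmetric]) (auto simp: ennreal_mult intro!: sum.cong mult_nonneg_nonneg)
          finally have *: "ennreal (\<bar>ln (norm (F (c - 3/2 + \<i> * of_real y)) / M)\<bar> ^ q) \<le>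
              ennreal (c1 * V) + (\<Sum>a\<in>Z. ennreal (c1 * w a) * ennreal (H a y))" .
          have ind: "indicator {-1/2..1/2} y = (1::ennreal)" using True by (auto simp: indicator_def)
          show ?thesis unfolding ind using * by simp
        next
          case False
          then have ind: "indicator {-1/2..1/2} y = (0::ennreal)" by (auto simp: indicator_def)
          show ?thesis unfolding ind by simp
        qed
      qed
    qed
    also have "\<dots> = ennreal (c1 * V) + (\<Sum>a\<in>Z. ennreal (c1 * w a) * (\<integral>\<^sup>+y. ennreal (H a y) * indicator {-1/2..1/2} y \<partial>lborel))"
    proof -
      have [measurable]: "H a \<in> borel_measurable borel" for a unfolding H_def by measurable
      show ?thesis
        by (subst nn_integral_add) (auto simp: nn_integral_sum nn_integral_cmult nn_integral_cmult_indicator)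
    qed
    also have "\<dots> \<le> ennreal (c1 * V) + (\<Sum>a\<in>Z. ennreal (c1 * w a) * ennreal K1)"
      using intH by (intro add_left_mono sum_mono mult_left_mono) auto
    also have "\<dots> = ennreal (c1 * V + (\<Sum>a\<in>Z. c1 * w a * K1))"
      using c1 V w K1 by (subst ennreal_plus) (auto simp: sum_ennreal[symmetric] ennreal_mult intro!: sum_nonneg mult_nonneg_nonneg sum.cong)
    also have "\<dots> \<le> ennreal (C ^ q * K1 * L ^ q)"
    proof (rule ennreal_leI)
      have "c1 * V + (\<Sum>a\<in>Z. c1 * w a * K1) \<le> c1 * V * K1 + (\<Sum>a\<in>Z. c1 * w a * K1)"
        using mult_left_mono[OF K1, of "c1 * V"] c1 V by simp
      also have "\<dots> = c1 * K1 * (V + (\<Sum>a\<in>Z. w a))" by (simp add: distrib_left sum_distrib_left mult_ac)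
      also have "\<dots> = C ^ q * K1 * (L ^ (q - 1) * L)" by (simp add: sum c1_def mult_ac)
      also have "L ^ (q - 1) * L = L ^ q" using q by (simp add: power_eq_if mult.commute)
      finally show "c1 * V + (\<Sum>a\<in>Z. c1 * w a * K1) \<le> C ^ q * K1 * L ^ q" .
    qed
    finally show ?thesis unfolding L_eq .
  qed
  then show thesis using C K1 by (intro that[of "C ^ q * K1"]) auto
qed

section \<open>Jensen's formula with a boundary singularity\<close>

lemma unit_measure_has_integral:
  fixes f :: "real \<Rightarrow> real"
  assumes cont: "continuous_on UNIV f" and I: "(f has_integral I) {0..1}"
  shows "integrable unit_measure f" "(\<integral>\<theta>. f \<theta> \<partial>unit_measure) = I"
proof -
  have [measurable]: "f \<in> borel_measurable borel" by (rule borel_measurable_continuous_onI[OF cont])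
  have si: "set_integrable lborel {0..1} f"
    by (rule borel_integrable_atLeastAtMost'[OF continuous_on_subset[OF cont subset_UNIV]])
  have eq: "(LINT x:{0..1}|lborel. f x) = I"
    using set_borel_integral_eq_integral(2)[OF si] integral_unique[OF I] by simp
  have "AE x in lborel. x \<noteq> (1::real)" by (rule AE_lborel_singleton)
  then have AE: "AE x in lborel. indicator {0..1} x *\<^sub>R f x = indicator {0..<1} x *\<^sub>R f x"
    by eventually_elim (auto simp: indicator_def)
  have "integrable lborel (\<lambda>x. indicator {0..<1} x *\<^sub>R f x)"
    using si unfolding set_integrable_def by (subst (asm) integrable_cong_AE[OF _ _ AE]) auto
  then show "integrable unit_measure f"
    unfolding unit_measure_def by (subst integrable_density) auto
  have "(\<integral>\<theta>. f \<theta> \<partial>unit_measure) = (\<integral>x. indicator {0..<1} x *\<^sub>R f x \<partial>lborel)"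
    unfolding unit_measure_def by (subst integral_density) auto
  also have "\<dots> = (LINT x:{0..1}|lborel. f x)"
    unfolding set_lebesgue_integral_def by (rule integral_cong_AE) (use AE in auto)
  finally show "(\<integral>\<theta>. f \<theta> \<partial>unit_measure) = I" using eq by simp
qed

text \<open>Apply the formula to z -> F (r z), holomorphic on the disc of radius 1 / r > 1; its
  zeros are those of \<open>F\<close> divided by \<open>r\<close>, with the same orders.\<close>

lemma poisson_jensen_scaled:
  assumes F: "F holomorphic_on ball 0 1" "F 0 \<noteq> 0" and r: "0 < r" "r < 1"
    and nz: "\<And>z. norm z = r \<Longrightarrow> F z \<noteq> 0" and w: "norm w < 1" "F (of_real r * w) \<noteq> 0"
  defines "Z \<equiv> {b. norm b < 1 \<and> F b = 0}"
  shows "finite {b\<in>Z. norm b < r}"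
    and "((\<lambda>\<theta>. poisson w \<theta> * ln (norm (F (of_real r * circ \<theta>)))) has_integral
           (ln (norm (F (of_real r * w))) - (\<Sum>b\<in>{b\<in>Z. norm b < r}. zorder F b * ln (norm (blaschke (b / of_real r) w))))) {0..1}"
proof -
  define f where "f = (\<lambda>z. F (of_real r * z))"
  define Z' where "Z' = {a. norm a < 1 \<and> f a = 0}"
  have sub: "cball (0::complex) 1 \<subseteq> ball 0 (1 / r)"
  proof
    fix x :: complex assume "x \<in> cball 0 1"
    moreover have "1 < 1 / r" using r by simp
    ultimately show "x \<in> ball 0 (1 / r)" unfolding mem_cball mem_ball by linarith
  qed
  have "F \<circ> (\<lambda>z. of_real r * z) holomorphic_on ball 0 (1 / r)"
    by (rule holomorphic_on_compose_gen[OF _ F(1)]) (use r in \<open>auto intro!: holomorphic_intros simp: norm_mult field_simps\<close>)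
  then have f: "f holomorphic_on ball 0 (1 / r)" by (simp add: f_def o_def)
  have fnz: "f z \<noteq> 0" if "norm z = 1" for z
    unfolding f_def by (rule nz) (use that r in \<open>simp add: norm_mult\<close>)
  have fw: "f w \<noteq> 0" using w(2) by (simp add: f_def)
  note pj = poisson_jensen[OF open_ball sub f fnz w(1) fw, folded Z'_def]
  have bij: "bij_betw (\<lambda>a. of_real r * a) Z' {b\<in>Z. norm b < r}"
  proof (rule bij_betw_byWitness[where f' = "\<lambda>b. b / of_real r"])
    show "(\<lambda>a. of_real r * a) ` Z' \<subseteq> {b \<in> Z. norm b < r}"
    proof
      fix b assume "b \<in> (\<lambda>a. of_real r * a) ` Z'"
      then obtain a where a: "a \<in> Z'" "b = of_real r * a" by auto
      then have "norm b < r * 1" using r by (auto simp: norm_mult Z'_def)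
      then show "b \<in> {b \<in> Z. norm b < r}" using a r by (auto simp: Z_def Z'_def f_def)
    qed
    show "(\<lambda>b. b / of_real r) ` {b \<in> Z. norm b < r} \<subseteq> Z'"
      using r by (auto simp: Z_def Z'_def f_def norm_divide)
  qed (use r in auto)
  show "finite {b\<in>Z. norm b < r}" using bij_betw_finite[OF bij] pj(1) by simp
  have zo: "zorder f a = zorder F (of_real r * a)" if "a \<in> Z'" for a
  proof -
    have ra: "of_real r * a \<in> ball 0 1"
      using bij_betwE[OF bij] that r by (auto simp: Z_def)
    have "F analytic_on {of_real r * a}" using F(1) ra open_ball analytic_at by blast
    then show ?thesis
      unfolding f_def using r by (intro zorder_scale analytic_on_imp_meromorphic_on) auto
  qed
  have "(\<Sum>b\<in>{b\<in>Z. norm b < r}. zorder F b * ln (norm (blaschke (b / of_real r) w))) =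
      (\<Sum>a\<in>Z'. zorder f a * ln (norm (blaschke a w)))"
    using r by (subst sum.reindex_bij_betw[OF bij, symmetric]) (simp add: zo)
  then show "((\<lambda>\<theta>. poisson w \<theta> * ln (norm (F (of_real r * circ \<theta>)))) has_integral
           (ln (norm (F (of_real r * w))) - (\<Sum>b\<in>{b\<in>Z. norm b < r}. zorder F b * ln (norm (blaschke (b / of_real r) w))))) {0..1}"
    using pj(3) by (simp add: f_def)
qed

lemma continuous_on_poisson:
  assumes "norm w < 1"
  shows "continuous_on A (poisson w)"
proof -
  have "circ \<theta> - w \<noteq> 0" for \<theta> using assms by auto
  then show ?thesis unfolding poisson_def[abs_def] by (intro continuous_intros) auto
qed

lemma norm_circ_minus_1: "(norm (circ \<theta> - 1))\<^sup>2 = 2 - 2 * Re (circ \<theta>)"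
proof -
  have "(cos (2 * pi * \<theta>))\<^sup>2 + (sin (2 * pi * \<theta>))\<^sup>2 = 1" by simp
  then show ?thesis by (simp only: cmod_power2) (simp add: circ_def power2_diff)
qed

lemma circ_inj: "circ s = circ t \<Longrightarrow> s \<in> {0..<1} \<Longrightarrow> t \<in> {0..<1} \<Longrightarrow> s = t"
proof -
  assume *: "circ s = circ t" "s \<in> {0..<1}" "t \<in> {0..<1}"
  have "cis (2 * pi * (s - t)) = circ s / circ t"
    by (simp add: circ_def cis_divide right_diff_distrib)
  also have "\<dots> = 1" using *(1) by simp
  finally have "cos (2 * pi * (s - t)) = 1" by (metis cis.sel(1) one_complex.sel(1))
  then obtain n :: int where "2 * pi * (s - t) = of_int n * 2 * pi"
    by (auto simp: cos_one_2pi_int)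
  then have "(2 * pi) * (s - t) = (2 * pi) * of_int n" by (simp only: mult_ac)
  then have n: "s - t = of_int n" by (simp only: mult_cancel_left) simp
  then have "real_of_int \<bar>n\<bar> < 1" using *(2,3) by auto
  then have "n = 0" by linarith
  then show ?thesis using n by simp
qed

text \<open>Pulling z back to r z moves it by 1 - r, and either alternative keeps \<open>a\<close>
  at least that far from r z. The retreat thus at most halves the distance to \<open>a\<close>,
  which costs only ln 2 in the logarithm.\<close>

lemma dist_circle_scaled_ge:
  fixes z a :: complex
  assumes z: "norm z = 1" and a: "norm a = 1 \<or> (1 + norm a) / 2 \<le> r" and r: "0 \<le> r" "r \<le> 1"
  shows "norm (z - a) \<le> 2 * norm (of_real r * z - a)"
proof -
  have "norm (z - a) \<le> norm (z - of_real r * z) + norm (of_real r * z - a)"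
    using norm_triangle_ineq[of "z - of_real r * z" "of_real r * z - a"] by simp
  also have "z - of_real r * z = of_real (1 - r) * z" by (simp add: algebra_simps)
  also have "norm (of_real (1 - r) * z) = 1 - r" using z r by (simp only: norm_mult norm_of_real) simp
  also have "1 - r \<le> norm (of_real r * z - a)"
    using a
  proof
    assume "norm a = 1"
    then show ?thesis using norm_triangle_ineq2[of a "of_real r * z"] z r by (simp add: norm_mult norm_minus_commute)
  next
    assume "(1 + norm a) / 2 \<le> r"
    then show ?thesis using norm_triangle_ineq2[of "of_real r * z" a] z r by (simp add: norm_mult field_simps)
  qed
  finally show ?thesis by simp
qed

text \<open>The condition \<open>radial\<close> excludes exp ((w + 1) / (w - 1)), which meets all
  the others: it has no zeros and modulus 1 on the circle, but modulus 1/e at 0, so Jensen's formula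
  fails for it. Along the radius it decays faster than any power of 1 - w.\<close>

locale boundary_singularity =
  fixes F :: "complex \<Rightarrow> complex" and S :: "complex set"
  assumes hol: "F holomorphic_on S" and open_S: "open S" and S_sub: "cball 0 1 - {1} \<subseteq> S"
    and bounded: "\<And>z. z \<in> cball 0 1 - {1} \<Longrightarrow> norm (F z) \<le> 1"
    and F0: "F 0 \<noteq> 0"
    and radial: "\<exists>c>0. \<exists>m. \<forall>\<^sub>F \<delta> in at_right 0. norm (F (of_real (1 - \<delta>))) \<ge> c * \<delta> ^ m"
    and boundary_integrable: "integrable unit_measure (\<lambda>\<theta>. ln (norm (F (circ \<theta>))))"
begin

definition zeros :: "complex set" where "zeros = {b. norm b < 1 \<and> F b = 0}"

definition weight :: "complex \<Rightarrow> real" where "weight b = zorder F b * (- ln (norm b))"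

definition u :: "complex \<Rightarrow> real" where "u z = - ln (norm (F z))"

lemma hol_ball: "F holomorphic_on ball 0 1"
  using hol by (rule holomorphic_on_subset) (use S_sub in auto)

lemma u_nonneg: "z \<in> cball 0 1 - {1} \<Longrightarrow> u z \<ge> 0"
  using bounded[of z] by (cases "F z = 0") (auto simp: u_def)

lemma zeros_norm: "b \<in> zeros \<Longrightarrow> 0 < norm b" "b \<in> zeros \<Longrightarrow> norm b < 1"
  using F0 by (auto simp: zeros_def)

lemma zorder_pos: "b \<in> zeros \<Longrightarrow> zorder F b > 0"
proof -
  assume b: "b \<in> zeros"
  then have b': "b \<in> ball 0 1" by (auto simp: zeros_def)
  have "eventually (\<lambda>w. F w \<noteq> 0 \<and> w \<in> ball 0 1) (at b)"
    by (rule non_zero_neighbour_alt[OF hol_ball open_ball connected_ball b', of 0]) (use F0 in auto)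
  then have "frequently (\<lambda>w. F w \<noteq> 0) (at b)" by (intro eventually_frequently) (auto elim: eventually_mono)
  then show ?thesis using zorder_pos_iff[OF hol_ball open_ball b'] b by (auto simp: zeros_def)
qed

lemma weight_nonneg: "b \<in> zeros \<Longrightarrow> weight b \<ge> 0"
  unfolding weight_def using zorder_pos[of b] zeros_norm[of b] by (intro mult_nonneg_nonneg) auto

text \<open>The radius is sought between 1 - 1/(n + 2) and 1 - 1/(n + 3). The closed disc of the
  larger radius contains finitely many zeros, even if the open unit disc contains infinitely
  many.\<close>

lemma radii_exist:
  "\<exists>r. \<forall>n. 1 - 1 / (real n + 2) < r n \<and> r n < 1 \<and> (\<forall>z. norm z = r n \<longrightarrow> F z \<noteq> 0)"
proof (rule choice, rule allI)
  fix n
  define a where "a = 1 - 1 / (real n + 2)"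
  define b where "b = 1 - 1 / (real n + 3)"
  have ab: "0 < a" "a < b" "b < 1" by (auto simp: a_def b_def field_simps)
  have fin: "finite {z\<in>cball 0 b. F z = 0}"
  proof -
    have sub: "cball 0 b \<subseteq> ball 0 1" using ab by auto
    show ?thesis
      using factor_zeros_compact_convex[OF compact_cball convex_cball sub open_ball hol_ball, of 0] F0 ab by auto
  qed
  then have "infinite ({a<..<b} - norm ` {z\<in>cball 0 b. F z = 0})"
    using ab by (intro Diff_infinite_finite) (auto simp: infinite_Ioo)
  then have "{a<..<b} - norm ` {z\<in>cball 0 b. F z = 0} \<noteq> {}" by (metis finite.emptyI)
  then obtain r where "r \<in> {a<..<b} - norm ` {z\<in>cball 0 b. F z = 0}" by blast
  then have r: "a < r" "r < b" "r \<notin> norm ` {z\<in>cball 0 b. F z = 0}"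
    unfolding Diff_iff greaterThanLessThan_iff by blast+
  have "F z \<noteq> 0" if "norm z = r" for z
  proof
    assume "F z = 0"
    then have "z \<in> {z\<in>cball 0 b. F z = 0}" using that r by auto
    then show False using r(3) that by blast
  qed
  then show "\<exists>r. 1 - 1 / (real n + 2) < r \<and> r < 1 \<and> (\<forall>z. norm z = r \<longrightarrow> F z \<noteq> 0)"
    using r ab unfolding a_def by (intro exI[of _ r]) auto
qed

definition radius :: "nat \<Rightarrow> real" where
  "radius = (SOME r. \<forall>n. 1 - 1 / (real n + 2) < r n \<and> r n < 1 \<and> (\<forall>z. norm z = r n \<longrightarrow> F z \<noteq> 0))"

lemma radius: "1 - 1 / (real n + 2) < radius n" "radius n < 1" "norm z = radius n \<Longrightarrow> F z \<noteq> 0"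
  using someI_ex[OF radii_exist] unfolding radius_def by blast+

lemma radius_pos: "radius n > 0"
proof -
  have "1 / (real n + 2) \<le> 1" by (simp add: field_simps)
  then show ?thesis using radius(1)[of n] by linarith
qed

lemma radius_tendsto: "radius \<longlonglongrightarrow> 1"
proof (rule tendsto_sandwich[OF _ _ _ tendsto_const])
  show "(\<lambda>n. 1 - 1 / (real n + 2)) \<longlonglongrightarrow> 1" by real_asymp
  show "\<forall>\<^sub>F n in sequentially. 1 - 1 / (real n + 2) \<le> radius n"
    using radius(1) by (intro always_eventually) (auto intro: less_imp_le)
  show "\<forall>\<^sub>F n in sequentially. radius n \<le> 1"
    using radius(2) by (intro always_eventually) (auto intro: less_imp_le)
qed

lemma radius_eventually_gt: "t < 1 \<Longrightarrow> \<forall>\<^sub>F n in sequentially. radius n > t"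
  using radius_tendsto by (rule order_tendstoD(1))

lemma circle_in: "of_real (radius n) * circ \<theta> \<in> cball 0 1 - {1}"
proof -
  have "norm (of_real (radius n) * circ \<theta>) = radius n" using radius_pos[of n] by (simp add: norm_mult)
  then show ?thesis using radius(2)[of n] by auto
qed

lemma continuous_u_circle: "continuous_on A (\<lambda>\<theta>. u (of_real (radius n) * circ \<theta>))"
proof -
  have nz: "F (of_real (radius n) * circ \<theta>) \<noteq> 0" for \<theta>
    by (rule radius(3)[of _ n]) (use radius_pos[of n] in \<open>simp add: norm_mult\<close>)
  have "continuous_on A (\<lambda>\<theta>. F (of_real (radius n) * circ \<theta>))"
    by (rule continuous_on_compose2[OF holomorphic_on_imp_continuous_on[OF hol]])
       (use circle_in S_sub in \<open>auto intro!: continuous_intros\<close>)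
  then show ?thesis unfolding u_def using nz by (intro continuous_intros) auto
qed

text \<open>Jensen's integrated counting function: the integral of nu(t) dt / t from 0 to
  \<open>radius n\<close>, where nu(t) is the number of zeros of modulus at most t with
  multiplicity.\<close>

definition counting :: "nat \<Rightarrow> real" where
  "counting n = (\<Sum>b\<in>{b\<in>zeros. norm b < radius n}. zorder F b * ln (radius n / norm b))"

lemma finite_zeros: "finite {b\<in>zeros. norm b < radius n}"
  unfolding zeros_def
  by (rule poisson_jensen_scaled(1)[OF hol_ball F0 radius_pos radius(2) radius(3), where w = 0]) (use F0 in auto)

lemma circle_mean:
  "integrable unit_measure (\<lambda>\<theta>. u (of_real (radius n) * circ \<theta>))"
  "(\<integral>\<theta>. u (of_real (radius n) * circ \<theta>) \<partial>unit_measure) = u 0 - counting n"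
proof -
  have 1: "((\<lambda>\<theta>. - (poisson 0 \<theta> * ln (norm (F (of_real (radius n) * circ \<theta>))))) has_integral
      - (ln (norm (F (of_real (radius n) * 0))) -
         (\<Sum>b\<in>{b\<in>zeros. norm b < radius n}. zorder F b * ln (norm (blaschke (b / of_real (radius n)) 0))))) {0..1}"
    unfolding zeros_def
    by (intro has_integral_neg poisson_jensen_scaled(2)[OF hol_ball F0 radius_pos radius(2) radius(3)]) (use F0 in auto)
  have 2: "(\<Sum>b\<in>{b\<in>zeros. norm b < radius n}. zorder F b * ln (norm (blaschke (b / of_real (radius n)) 0))) = - counting n"
    unfolding counting_def sum_negf[symmetric]
  proof (intro sum.cong refl)
    fix b assume "b \<in> {b\<in>zeros. norm b < radius n}"
    then have "norm b > 0" using zeros_norm by auto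
    then show "zorder F b * ln (norm (blaschke (b / of_real (radius n)) 0)) = - (zorder F b * ln (radius n / norm b))"
      using radius_pos[of n] by (simp add: blaschke_def norm_divide ln_div algebra_simps)
  qed
  have 3: "- (ln (norm (F (of_real (radius n) * 0))) - - counting n) = u 0 - counting n"
    by (simp add: u_def)
  have "((\<lambda>\<theta>. u (of_real (radius n) * circ \<theta>)) has_integral (u 0 - counting n)) {0..1}"
    using 1 unfolding 2 3 by (simp add: u_def)
  from unit_measure_has_integral[OF continuous_u_circle this]
  show "integrable unit_measure (\<lambda>\<theta>. u (of_real (radius n) * circ \<theta>))"
    "(\<integral>\<theta>. u (of_real (radius n) * circ \<theta>) \<partial>unit_measure) = u 0 - counting n" .
qed

lemma counting_le: "counting n \<le> u 0"
proof -
  have "0 \<le> (\<integral>\<theta>. u (of_real (radius n) * circ \<theta>) \<partial>unit_measure)"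
    using u_nonneg circle_in by (intro integral_nonneg_AE) auto
  then show ?thesis using circle_mean(2)[of n] by simp
qed

lemma counting_term_nonneg: "b \<in> zeros \<Longrightarrow> norm b < radius n \<Longrightarrow> zorder F b * ln (radius n / norm b) \<ge> 0"
  using zorder_pos[of b] zeros_norm[of b] by (intro mult_nonneg_nonneg) auto

text \<open>Each fixed zero eventually lies inside the circle and its term tends to its weight; the
  remaining terms of \<open>counting n\<close> are nonnegative.\<close>

lemma finite_partial_sum:
  assumes B: "finite B" "B \<subseteq> zeros" and t: "t < sum weight B"
  shows "\<forall>\<^sub>F n in sequentially. t < counting n"
proof -
  define s where "s = (\<lambda>n. \<Sum>b\<in>B. zorder F b * ln (radius n / norm b))"
  have "s \<longlonglongrightarrow> (\<Sum>b\<in>B. zorder F b * ln (1 / norm b))"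
    unfolding s_def using B zeros_norm(1) by (intro tendsto_intros radius_tendsto) auto
  also have "(\<Sum>b\<in>B. zorder F b * ln (1 / norm b)) = sum weight B"
    using B zeros_norm(1) by (intro sum.cong) (auto simp: weight_def ln_div)
  finally have 1: "\<forall>\<^sub>F n in sequentially. t < s n" using t by (rule order_tendstoD(1))
  have "\<forall>\<^sub>F n in sequentially. \<forall>b\<in>B. norm b < radius n"
    using B zeros_norm(2) by (intro eventually_ball_finite ballI radius_eventually_gt) auto
  with 1 show ?thesis
  proof eventually_elim
    case (elim n)
    have "s n \<le> counting n"
      unfolding s_def counting_def
      by (rule sum_mono2[OF finite_zeros]) (use B elim counting_term_nonneg in auto)
    then show ?case using elim by simp
  qed
qed

text \<open>The Blaschke condition. If a finite partial sum exceeded \<open>u 0\<close>, so would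
  \<open>counting n\<close> for large \<open>n\<close>, but Jensen's formula for the nonnegative
  \<open>u\<close> forbids this.\<close>

lemma weight_summable: "weight summable_on zeros"
proof (rule nonneg_bdd_above_summable_on[OF weight_nonneg])
  have "sum weight B \<le> u 0" if "finite B" "B \<subseteq> zeros" for B
  proof (rule ccontr)
    assume "\<not> sum weight B \<le> u 0"
    then have "\<forall>\<^sub>F n in sequentially. u 0 < counting n" by (intro finite_partial_sum[OF that]) simp
    then have "\<forall>\<^sub>F n::nat in sequentially. False" by eventually_elim (use counting_le not_less in blast)
    then show False by simp
  qed
  then show "bdd_above (sum weight ` {B. B \<subseteq> zeros \<and> finite B})" by (auto intro!: bdd_aboveI)
qed

text \<open>From below by finite partial sums; from above term by term, because
  \<open>ln (radius n)\<close> is not positive.\<close>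

lemma counting_tendsto: "counting \<longlonglongrightarrow> (\<Sum>\<^sub>\<infinity>b\<in>zeros. weight b)"
proof (rule order_tendstoI)
  fix t assume "t < (\<Sum>\<^sub>\<infinity>b\<in>zeros. weight b)"
  moreover have "(sum weight \<longlongrightarrow> (\<Sum>\<^sub>\<infinity>b\<in>zeros. weight b)) (finite_subsets_at_top zeros)"
    using weight_summable by (simp add: infsum_tendsto)
  ultimately have "\<forall>\<^sub>F B in finite_subsets_at_top zeros. t < sum weight B" by (metis order_tendstoD(1))
  then obtain B where "finite B" "B \<subseteq> zeros" "t < sum weight B"
    by (auto simp: eventually_finite_subsets_at_top)
  then show "\<forall>\<^sub>F n in sequentially. t < counting n" by (rule finite_partial_sum)
next
  fix t assume t: "(\<Sum>\<^sub>\<infinity>b\<in>zeros. weight b) < t"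
  have "counting n \<le> (\<Sum>\<^sub>\<infinity>b\<in>zeros. weight b)" for n
  proof -
    have "counting n \<le> sum weight {b\<in>zeros. norm b < radius n}"
      unfolding counting_def weight_def
    proof (rule sum_mono)
      fix b assume "b \<in> {b\<in>zeros. norm b < radius n}"
      then have b: "b \<in> zeros" "norm b > 0" using zeros_norm by auto
      have "ln (radius n) \<le> 0" using radius_pos[of n] radius(2)[of n] by simp
      then have "ln (radius n / norm b) \<le> - ln (norm b)"
        using radius_pos[of n] b by (simp add: ln_div)
      then show "zorder F b * ln (radius n / norm b) \<le> zorder F b * (- ln (norm b))"
        using zorder_pos[OF b(1)] by (intro mult_left_mono) auto
    qed
    also have "\<dots> \<le> (\<Sum>\<^sub>\<infinity>b\<in>zeros. weight b)"
      by (rule finite_sum_le_infsum[OF weight_summable finite_zeros]) (use weight_nonneg in auto)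
    finally show ?thesis .
  qed
  then show "\<forall>\<^sub>F n in sequentially. counting n < t"
    using t by (intro always_eventually allI) (auto intro: le_less_trans)
qed

text \<open>The angles whose point has distance at least \<eta> from 1, by
  \<open>norm_circ_minus_1\<close>. The real part is used because the corresponding part of the disc
  is then cut off by a straight line and is convex.\<close>

definition far :: "real \<Rightarrow> real set" where "far \<eta> = {\<theta>. Re (circ \<theta>) \<le> 1 - \<eta>\<^sup>2 / 2}"

lemma far_measurable [measurable]: "far \<eta> \<in> sets borel"
proof -
  have "closed (far \<eta>)" unfolding far_def by (intro closed_Collect_le continuous_intros)
  then show ?thesis by simp
qed

text \<open>
  Little mass near the singular point: evaluate the Poisson integral at the radial point at
  distance \<open>\<eta>\<close>, where the Poisson kernel is of order \<open>1 / \<eta>\<close> on the arc.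
\<close>

lemma near_mass:
  assumes \<eta>: "0 < \<eta>" "\<eta> \<le> 1/2" and F: "F (of_real (1 - \<eta>)) \<noteq> 0" and r: "radius n > 1 - \<eta> / 2"
  shows "(\<integral>\<theta>. indicator (- far \<eta>) \<theta> * u (of_real (radius n) * circ \<theta>) \<partial>unit_measure) \<le> 18 * \<eta> * u (of_real (1 - \<eta>))"
proof -
  \<comment> \<open>Chosen so that \<open>radius n * w = 1 - \<eta>\<close>: in the scaled disc it
    stands for the radial point.\<close>
  define w where "w = (1 - \<eta>) / radius n"
  have r1: "radius n < 1" "radius n > 1/2" "radius n > 0" using radius(2)[of n] r \<eta> by auto
  have w: "0 < w" "w < 1" using \<eta> r r1 by (auto simp: w_def field_simps)
  have rw: "radius n * w = 1 - \<eta>" using r1 by (simp add: w_def)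
  have rw': "of_real (radius n) * of_real w = (of_real (1 - \<eta>) :: complex)" by (simp only: of_real_mult[symmetric] rw)
  have nw: "norm (of_real w :: complex) < 1" using w by simp
  have w1: "1 - w \<ge> \<eta> / 2" "1 - w \<le> 2 * \<eta>"
  proof -
    have "1 - w = (radius n - (1 - \<eta>)) / radius n" using r1 by (simp add: w_def diff_divide_distrib)
    moreover have "(\<eta> / 2) / 1 \<le> (radius n - (1 - \<eta>)) / radius n" using r r1 \<eta> by (intro frac_le) auto
    moreover have "(radius n - (1 - \<eta>)) / radius n \<le> \<eta> / (1/2)" using r r1 \<eta> by (intro frac_le) auto
    ultimately show "1 - w \<ge> \<eta> / 2" "1 - w \<le> 2 * \<eta>" by auto
  qed
  define U where "U = (\<lambda>\<theta>. u (of_real (radius n) * circ \<theta>))"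
  have U0: "U \<theta> \<ge> 0" for \<theta> unfolding U_def using u_nonneg circle_in by blast
  have Ucont: "continuous_on UNIV U" unfolding U_def by (rule continuous_u_circle)
  have [measurable]: "U \<in> borel_measurable borel" by (rule borel_measurable_continuous_onI[OF Ucont])
  have Uint: "integrable unit_measure U" unfolding U_def by (rule circle_mean(1))
  define s where "s = (\<Sum>b\<in>{b\<in>zeros. norm b < radius n}. zorder F b * ln (norm (blaschke (b / of_real (radius n)) (of_real w))))"
  have s: "s \<le> 0"
    unfolding s_def
  proof (rule sum_nonpos)
    fix b assume b: "b \<in> {b\<in>zeros. norm b < radius n}"
    have "norm (blaschke (b / of_real (radius n)) (of_real w)) \<le> 1"
      by (rule norm_blaschke_le) (use b r1 w in \<open>auto simp: norm_divide\<close>)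
    then have "ln (norm (blaschke (b / of_real (radius n)) (of_real w))) \<le> 0"
      by (cases "norm (blaschke (b / of_real (radius n)) (of_real w)) = 0") auto
    then show "zorder F b * ln (norm (blaschke (b / of_real (radius n)) (of_real w))) \<le> 0"
      using zorder_pos[of b] b by (intro mult_nonneg_nonpos) auto
  qed
  have "((\<lambda>\<theta>. - (poisson (of_real w) \<theta> * ln (norm (F (of_real (radius n) * circ \<theta>))))) has_integral
      - (ln (norm (F (of_real (radius n) * of_real w))) - s)) {0..1}"
    unfolding s_def zeros_def
    by (intro has_integral_neg poisson_jensen_scaled(2)[OF hol_ball F0 r1(3) r1(1) radius(3)[of _ n] nw])
       (use F rw' in auto)
  then have "((\<lambda>\<theta>. poisson (of_real w) \<theta> * U \<theta>) has_integral (u (of_real (1 - \<eta>)) + s)) {0..1}"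
    unfolding rw' by (simp add: U_def u_def)
  note P = unit_measure_has_integral[OF _ this]
  have cont: "continuous_on UNIV (\<lambda>\<theta>. poisson (of_real w) \<theta> * U \<theta>)"
    by (intro continuous_intros continuous_on_poisson Ucont nw)
  \<comment> \<open>On the arc the distance to \<open>w\<close> is at most \<eta> + 2 \<eta>, and 1
    - w^2 >= \<eta> / 2. Dividing \<eta> / 2 by 9 \<eta>^2 gives the constant 18.\<close>
  have kernel: "1 / (18 * \<eta>) \<le> poisson (of_real w) \<theta>" if "\<theta> \<notin> far \<eta>" for \<theta>
  proof -
    have "(norm (circ \<theta> - 1))\<^sup>2 \<le> \<eta>\<^sup>2" using that by (simp add: norm_circ_minus_1 far_def)
    then have "norm (circ \<theta> - 1) \<le> \<eta>" by (rule power2_le_imp_le) (use \<eta> in simp)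
    moreover have "norm (circ \<theta> - of_real w) \<le> norm (circ \<theta> - 1) + norm (1 - of_real w :: complex)"
      using norm_triangle_ineq[of "circ \<theta> - 1" "1 - of_real w"] by simp
    moreover have "norm (1 - of_real w :: complex) = 1 - w"
      using w by (metis abs_of_pos diff_gt_0_iff_gt norm_of_real of_real_1 of_real_diff)
    ultimately have "norm (circ \<theta> - of_real w) \<le> 3 * \<eta>" using w1 by linarith
    then have d: "(norm (circ \<theta> - of_real w))\<^sup>2 \<le> (3 * \<eta>)\<^sup>2" by (intro power_mono) auto
    have "circ \<theta> \<noteq> of_real w" using nw by (metis norm_circ less_irrefl)
    then have pos: "(norm (circ \<theta> - of_real w))\<^sup>2 > 0" by simp
    have "w * w \<le> w * 1" using w by (intro mult_left_mono) auto
    then have n: "\<eta> / 2 \<le> 1 - w\<^sup>2" using w1 by (simp add: power2_eq_square)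
    have "1 / (18 * \<eta>) = (\<eta> / 2) / (3 * \<eta>)\<^sup>2" using \<eta> by (simp add: power2_eq_square)
    also have "\<dots> \<le> (1 - w\<^sup>2) / (norm (circ \<theta> - of_real w))\<^sup>2"
      by (rule frac_le) (use d pos n \<eta> w in auto)
    finally show ?thesis using w by (simp add: poisson_def)
  qed
  have "1 / (18 * \<eta>) * (\<integral>\<theta>. indicator (- far \<eta>) \<theta> * U \<theta> \<partial>unit_measure) =
      (\<integral>\<theta>. 1 / (18 * \<eta>) * (indicator (- far \<eta>) \<theta> * U \<theta>) \<partial>unit_measure)" by simp
  also have "\<dots> \<le> (\<integral>\<theta>. poisson (of_real w) \<theta> * U \<theta> \<partial>unit_measure)"
  proof (rule integral_mono)
    have "integrable unit_measure (\<lambda>\<theta>. indicator (- far \<eta>) \<theta> *\<^sub>R U \<theta>)"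
      by (rule integrable_mult_indicator[OF _ Uint]) auto
    then show "integrable unit_measure (\<lambda>\<theta>. 1 / (18 * \<eta>) * (indicator (- far \<eta>) \<theta> * U \<theta>))" by simp
    show "integrable unit_measure (\<lambda>\<theta>. poisson (of_real w) \<theta> * U \<theta>)" by (rule P(1)[OF cont])
    fix \<theta>
    show "1 / (18 * \<eta>) * (indicator (- far \<eta>) \<theta> * U \<theta>) \<le> poisson (of_real w) \<theta> * U \<theta>"
    proof (cases "\<theta> \<in> far \<eta>")
      case True
      then show ?thesis using U0 poisson_nonneg[of "of_real w" \<theta>] nw by simp
    next
      case False
      then show ?thesis using mult_right_mono[OF kernel[OF False] U0[of \<theta>]] by simp
    qed
  qed
  also have "\<dots> \<le> u (of_real (1 - \<eta>))" using P(2)[OF cont] s by simp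
  finally show ?thesis using \<eta> by (simp add: U_def field_simps)
qed

text \<open>Off the arc only finitely many zeros matter, and \<open>u\<close> is a bounded function
  plus multiples of -ln of the distances to them. By \<open>dist_circle_scaled_ge\<close> this
  yields u (r z) <= u (z) + D for r close to 1, so the boundary function, integrable by assumption,
  dominates.\<close>

lemma far_dominated:
  assumes \<eta>: "0 < \<eta>" "\<eta> \<le> 1"
  shows "(\<lambda>n. \<integral>\<theta>. indicator (far \<eta>) \<theta> * u (of_real (radius n) * circ \<theta>) \<partial>unit_measure) \<longlonglongrightarrow>
           (\<integral>\<theta>. indicator (far \<eta>) \<theta> * u (circ \<theta>) \<partial>unit_measure)"
proof -
  define K where "K = cball 0 1 \<inter> {z. Re z \<le> 1 - \<eta>\<^sup>2 / 2}"
  have \<eta>2: "0 < \<eta>\<^sup>2 / 2" "\<eta>\<^sup>2 / 2 \<le> 1" using \<eta> power_le_one[of \<eta> 2] by auto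
  have K: "compact K" "convex K"
    unfolding K_def by (auto intro!: compact_Int_closed convex_Int closed_halfspace_Re_le convex_halfspace_Re_le)
  have K1: "K \<subseteq> cball 0 1 - {1}" using \<eta>2 by (auto simp: K_def)
  have KS: "K \<subseteq> S" using K1 S_sub by blast
  have K0: "0 \<in> K" using \<eta>2 by (auto simp: K_def)
  obtain A h where A: "K \<subseteq> A" "A \<subseteq> S" and fin: "finite {a\<in>K. F a = 0}"
    and h: "h holomorphic_on A" "\<And>z. z \<in> A \<Longrightarrow> h z \<noteq> 0"
    and Fh: "\<And>z. z \<in> A \<Longrightarrow> F z = h z * (\<Prod>a\<in>{a\<in>K. F a = 0}. (z - a) ^ nat (zorder F a))"
    by (rule factor_zeros_compact_convex[OF K KS open_S hol K0 F0]) (rule that, assumption+)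
  define Z where "Z = {a\<in>K. F a = 0}"
  define m where "m = (\<lambda>a. real (nat (zorder F a)))"
  have far_K: "of_real r * circ \<theta> \<in> K" if "\<theta> \<in> far \<eta>" "0 \<le> r" "r \<le> 1" for r \<theta>
  proof -
    have "r * Re (circ \<theta>) \<le> 1 - \<eta>\<^sup>2 / 2"
    proof (cases "Re (circ \<theta>) \<ge> 0")
      case True
      then have "r * Re (circ \<theta>) \<le> 1 * Re (circ \<theta>)" using that by (intro mult_right_mono) auto
      then show ?thesis using that by (simp add: far_def)
    next
      case False
      then have "r * Re (circ \<theta>) \<le> 0" using that by (intro mult_nonneg_nonpos) auto
      then show ?thesis using \<eta>2 by linarith
    qed
    then show ?thesis using that by (simp add: K_def norm_mult)
  qed
  have u_eq: "u z = - ln (norm (h z)) - (\<Sum>a\<in>Z. m a * ln (norm (z - a)))" if "z \<in> K" "F z \<noteq> 0" for z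
  proof -
    have zA: "z \<in> A" using that A by auto
    have "z \<noteq> a" if "a \<in> Z" for a using that \<open>F z \<noteq> 0\<close> by (auto simp: Z_def)
    then have ne: "norm (z - a) > 0" if "a \<in> Z" for a using that by simp
    then have "(\<Prod>a\<in>Z. norm (z - a) ^ nat (zorder F a)) > 0" by (intro prod_pos) auto
    moreover have "ln (\<Prod>a\<in>Z. norm (z - a) ^ nat (zorder F a)) = (\<Sum>a\<in>Z. m a * ln (norm (z - a)))"
      using ne fin by (subst ln_prod) (auto simp: m_def ln_realpow Z_def[symmetric] intro!: sum.cong)
    ultimately show ?thesis
      using h(2)[OF zA] Fh[OF zA] by (simp add: u_def Z_def[symmetric] norm_mult prod_norm[symmetric] norm_power ln_mult)
  qed
  have hc: "continuous_on K (\<lambda>z. ln (norm (h z)))"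
    using holomorphic_on_imp_continuous_on[OF holomorphic_on_subset[OF h(1) A(1)]] h(2) A(1)
    by (intro continuous_intros) auto
  obtain B where B: "\<And>z. z \<in> K \<Longrightarrow> \<bar>ln (norm (h z))\<bar> \<le> B"
    using compact_imp_bounded[OF compact_continuous_image[OF hc K(1)]] by (auto simp: bounded_iff)
  define D where "D = 2 * B + (\<Sum>a\<in>Z. m a * ln 2)"
  \<comment> \<open>The circle must lie beyond the midpoint between each interior zero and the unit
    circle. This fails for finitely many \<open>n\<close> only, and \<open>g\<close> is set to 0 for
    these so that one bound serves all \<open>n\<close>.\<close>
  define good where "good = (\<lambda>n. \<forall>a\<in>Z. norm a = 1 \<or> (1 + norm a) / 2 \<le> radius n)"
  define g where "g = (\<lambda>n \<theta>. if good n then indicator (far \<eta>) \<theta> * u (of_real (radius n) * circ \<theta>) else 0)"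
  have B0: "B \<ge> 0" using B[OF K0] by linarith
  have m0: "m a \<ge> 0" for a by (simp add: m_def)
  have D0: "D \<ge> 0" unfolding D_def using B0 m0 by (intro add_nonneg_nonneg sum_nonneg mult_nonneg_nonneg) auto
  have AE_nz: "AE \<theta> in unit_measure. \<theta> \<in> far \<eta> \<longrightarrow> F (circ \<theta>) \<noteq> 0"
  proof -
    have inj: "inj_on circ ({\<theta>\<in>{0..<1} \<inter> far \<eta>. F (circ \<theta>) = 0})" using circ_inj by (auto intro!: inj_onI)
    have sub: "circ ` {\<theta>\<in>{0..<1} \<inter> far \<eta>. F (circ \<theta>) = 0} \<subseteq> Z"
      using far_K[of _ 1] by (auto simp: Z_def)
    have "finite {\<theta>\<in>{0..<1} \<inter> far \<eta>. F (circ \<theta>) = 0}"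
      using finite_imageD[OF finite_subset[OF sub fin[folded Z_def]] inj] .
    then have "AE \<theta> in lborel. \<theta> \<notin> {\<theta>\<in>{0..<1} \<inter> far \<eta>. F (circ \<theta>) = 0}"
      by (intro AE_not_in finite_imp_null_set_lborel)
    then show ?thesis unfolding AE_unit_measure by eventually_elim auto
  qed
  have ev: "\<forall>\<^sub>F n in sequentially. good n"
    unfolding good_def
  proof (rule eventually_ball_finite)
    show "\<forall>a\<in>Z. \<forall>\<^sub>F n in sequentially. norm a = 1 \<or> (1 + norm a) / 2 \<le> radius n"
    proof
      fix a assume a: "a \<in> Z"
      then have "norm a \<le> 1" by (auto simp: Z_def K_def)
      then consider "norm a = 1" | "norm a < 1" by linarith
      then show "\<forall>\<^sub>F n in sequentially. norm a = 1 \<or> (1 + norm a) / 2 \<le> radius n"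
      proof cases
        case 2
        then have "(1 + norm a) / 2 < 1" by simp
        from radius_eventually_gt[OF this] show ?thesis by eventually_elim auto
      qed auto
    qed
  qed (use fin in \<open>simp add: Z_def\<close>)
  have bound: "u (of_real (radius n) * circ \<theta>) \<le> u (circ \<theta>) + D"
    if \<theta>: "\<theta> \<in> far \<eta>" "F (circ \<theta>) \<noteq> 0" and n: "good n" for n \<theta>
  proof -
    define z where "z = circ \<theta>"
    define rz where "rz = of_real (radius n) * z"
    have r: "0 \<le> radius n" "radius n \<le> 1" using radius_pos[of n] radius(2)[of n] by auto
    have zK: "z \<in> K" "rz \<in> K" using far_K[OF \<theta>(1), of 1] far_K[OF \<theta>(1) r] by (auto simp: z_def rz_def)
    have Frz: "F rz \<noteq> 0" by (rule radius(3)[of _ n]) (use radius_pos[of n] in \<open>simp add: norm_mult rz_def z_def\<close>)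
    have "u rz = - ln (norm (h rz)) - (\<Sum>a\<in>Z. m a * ln (norm (rz - a)))" by (rule u_eq[OF zK(2) Frz])
    also have "\<dots> \<le> B - (\<Sum>a\<in>Z. m a * (ln (norm (z - a)) - ln 2))"
    proof (intro diff_mono sum_mono mult_left_mono m0)
      show "- ln (norm (h rz)) \<le> B" using B[OF zK(2)] by linarith
      fix a assume a: "a \<in> Z"
      have "norm (z - a) \<le> 2 * norm (rz - a)"
        unfolding rz_def by (rule dist_circle_scaled_ge) (use a n r in \<open>auto simp: good_def z_def\<close>)
      moreover have pos: "norm (z - a) > 0" "norm (rz - a) > 0"
        using a \<theta>(2) Frz by (auto simp: Z_def z_def)
      ultimately have "ln (norm (z - a)) \<le> ln (2 * norm (rz - a))" by simp
      also have "\<dots> = ln 2 + ln (norm (rz - a))" using pos by (simp add: ln_mult)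
      finally show "ln (norm (z - a)) - ln 2 \<le> ln (norm (rz - a))" by simp
    qed
    also have "\<dots> = B + (\<Sum>a\<in>Z. m a * ln 2) + (u z + ln (norm (h z)))"
      using u_eq[OF zK(1)] \<theta>(2) by (simp add: z_def right_diff_distrib sum_subtractf)
    also have "\<dots> \<le> u z + D" using B[OF zK(1)] by (simp add: D_def)
    finally show ?thesis by (simp add: z_def rz_def)
  qed
  have "(\<lambda>n. \<integral>\<theta>. g n \<theta> \<partial>unit_measure) \<longlonglongrightarrow> (\<integral>\<theta>. indicator (far \<eta>) \<theta> * u (circ \<theta>) \<partial>unit_measure)"
  proof (rule integral_dominated_convergence[of _ _ _ "\<lambda>\<theta>. \<bar>u (circ \<theta>)\<bar> + D"])
    have u_int: "integrable unit_measure (\<lambda>\<theta>. u (circ \<theta>))"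
      using boundary_integrable by (simp add: u_def)
    then have [measurable]: "(\<lambda>\<theta>. u (circ \<theta>)) \<in> borel_measurable unit_measure" by (rule borel_measurable_integrable)
    show "(\<lambda>\<theta>. indicator (far \<eta>) \<theta> * u (circ \<theta>)) \<in> borel_measurable unit_measure" by measurable
    show "integrable unit_measure (\<lambda>\<theta>. \<bar>u (circ \<theta>)\<bar> + D)" using u_int by simp
    fix n
    have [measurable]: "(\<lambda>\<theta>. u (of_real (radius n) * circ \<theta>)) \<in> borel_measurable borel"
      by (rule borel_measurable_continuous_onI[OF continuous_u_circle])
    show "g n \<in> borel_measurable unit_measure" unfolding g_def by measurable
    show "AE \<theta> in unit_measure. norm (g n \<theta>) \<le> \<bar>u (circ \<theta>)\<bar> + D"
      using AE_nz
    proof eventually_elim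
      case (elim \<theta>)
      show ?case
      proof (cases "good n \<and> \<theta> \<in> far \<eta>")
        case True
        then have "u (of_real (radius n) * circ \<theta>) \<le> u (circ \<theta>) + D" using elim by (intro bound) auto
        moreover have "u (of_real (radius n) * circ \<theta>) \<ge> 0" using u_nonneg circle_in by blast
        ultimately show ?thesis using True by (simp add: g_def)
      next
        case False
        then show ?thesis using D0 by (auto simp: g_def)
      qed
    qed
  next
    show "AE \<theta> in unit_measure. (\<lambda>n. g n \<theta>) \<longlonglongrightarrow> indicator (far \<eta>) \<theta> * u (circ \<theta>)"
      using AE_nz
    proof eventually_elim
      case (elim \<theta>)
      have "(\<lambda>n. indicator (far \<eta>) \<theta> * u (of_real (radius n) * circ \<theta>)) \<longlonglongrightarrow> indicator (far \<eta>) \<theta> * u (circ \<theta>)"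
      proof (cases "\<theta> \<in> far \<eta>")
        case True
        have "circ \<theta> \<in> S" using far_K[OF True, of 1] KS by auto
        then have "isCont F (circ \<theta>)"
          using holomorphic_on_imp_continuous_on[OF hol] open_S by (simp add: continuous_on_eq_continuous_at)
        moreover have "(\<lambda>n. of_real (radius n) * circ \<theta>) \<longlonglongrightarrow> of_real 1 * circ \<theta>"
          by (intro tendsto_intros radius_tendsto)
        ultimately have "(\<lambda>n. F (of_real (radius n) * circ \<theta>)) \<longlonglongrightarrow> F (circ \<theta>)"
          by (intro isCont_tendsto_compose[of _ F]) simp_all
        then show ?thesis unfolding u_def using True elim by (intro tendsto_intros) auto
      qed simp
      then show ?case
        by (rule Lim_transform_eventually) (use ev in \<open>eventually_elim, simp add: g_def\<close>)
    qed
  qed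
  then show ?thesis
    by (rule Lim_transform_eventually) (use ev in \<open>eventually_elim, simp add: g_def\<close>)
qed

text \<open>Jensen's formula on the circle of radius \<open>radius n\<close>, split at the arc. The
  far part and the counting function converge, hence so does the near part, and the bound of
  \<open>near_mass\<close> survives in the limit.\<close>

lemma far_error:
  assumes \<eta>: "0 < \<eta>" "\<eta> \<le> 1/2" and F: "F (of_real (1 - \<eta>)) \<noteq> 0"
  shows "\<bar>u 0 - (\<Sum>\<^sub>\<infinity>b\<in>zeros. weight b) - (\<integral>\<theta>. indicator (far \<eta>) \<theta> * u (circ \<theta>) \<partial>unit_measure)\<bar>
           \<le> 18 * \<eta> * u (of_real (1 - \<eta>))"
proof -
  define N where "N = (\<lambda>n. \<integral>\<theta>. indicator (- far \<eta>) \<theta> * u (of_real (radius n) * circ \<theta>) \<partial>unit_measure)"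
  define I where "I = (\<lambda>n. \<integral>\<theta>. indicator (far \<eta>) \<theta> * u (of_real (radius n) * circ \<theta>) \<partial>unit_measure)"
  have int: "integrable unit_measure (\<lambda>\<theta>. indicator X \<theta> * u (of_real (radius n) * circ \<theta>))"
    if "X \<in> sets borel" for X n
    using integrable_mult_indicator[OF _ circle_mean(1), of X n] that by simp
  have split: "N n = u 0 - counting n - I n" for n
  proof -
    have "u 0 - counting n = (\<integral>\<theta>. indicator (- far \<eta>) \<theta> * u (of_real (radius n) * circ \<theta>) +
        indicator (far \<eta>) \<theta> * u (of_real (radius n) * circ \<theta>) \<partial>unit_measure)"
      unfolding circle_mean(2)[symmetric] by (intro Bochner_Integration.integral_cong) (auto simp: indicator_def)
    also have "\<dots> = N n + I n"
      unfolding N_def I_def by (intro Bochner_Integration.integral_add int) auto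
    finally show ?thesis by simp
  qed
  have "I \<longlonglongrightarrow> (\<integral>\<theta>. indicator (far \<eta>) \<theta> * u (circ \<theta>) \<partial>unit_measure)"
    unfolding I_def by (rule far_dominated) (use \<eta> in auto)
  then have "N \<longlonglongrightarrow> u 0 - (\<Sum>\<^sub>\<infinity>b\<in>zeros. weight b) - (\<integral>\<theta>. indicator (far \<eta>) \<theta> * u (circ \<theta>) \<partial>unit_measure)"
    unfolding split by (intro tendsto_intros counting_tendsto)
  then have "(\<lambda>n. \<bar>N n\<bar>) \<longlonglongrightarrow> \<bar>u 0 - (\<Sum>\<^sub>\<infinity>b\<in>zeros. weight b) - (\<integral>\<theta>. indicator (far \<eta>) \<theta> * u (circ \<theta>) \<partial>unit_measure)\<bar>"
    by (rule tendsto_rabs)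
  moreover have "\<forall>\<^sub>F n in sequentially. \<bar>N n\<bar> \<le> 18 * \<eta> * u (of_real (1 - \<eta>))"
  proof -
    have "\<forall>\<^sub>F n in sequentially. radius n > 1 - \<eta> / 2" using \<eta> by (intro radius_eventually_gt) auto
    then show ?thesis
    proof eventually_elim
      case (elim n)
      have "N n \<ge> 0" unfolding N_def using u_nonneg circle_in by (intro integral_nonneg_AE) auto
      then show ?case using near_mass[OF \<eta> F elim] by (simp add: N_def)
    qed
  qed
  ultimately show ?thesis by (intro tendsto_upperbound[OF _ _ sequentially_bot])
qed

text \<open>Let the arc shrink. Since \<open>radial\<close> bounds u (1 - \<eta>) by a constant plus
  a multiple of ln (1 / \<eta>), the error 18 \<eta> u (1 - \<eta>) tends to 0, while the far
  integrals exhaust the circle by dominated convergence.\<close>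

theorem jensen:
  "(\<integral>\<theta>. ln (norm (F (circ \<theta>))) \<partial>unit_measure) = ln (norm (F 0)) + (\<Sum>\<^sub>\<infinity>b\<in>zeros. weight b)"
proof -
  define V where "V = u 0 - (\<Sum>\<^sub>\<infinity>b\<in>zeros. weight b)"
  define \<eta> where "\<eta> = (\<lambda>j::nat. 1 / (real j + 2))"
  have \<eta>: "0 < \<eta> j" "\<eta> j \<le> 1/2" for j by (auto simp: \<eta>_def field_simps)
  have \<eta>_lim: "filterlim \<eta> (at_right 0) sequentially" unfolding \<eta>_def by real_asymp
  then have \<eta>0: "\<eta> \<longlonglongrightarrow> 0" by (simp add: filterlim_at)
  obtain c m where c: "c > 0" and rad: "\<forall>\<^sub>F \<delta> in at_right 0. norm (F (of_real (1 - \<delta>))) \<ge> c * \<delta> ^ m"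
    using radial by auto
  define J where "J = (\<lambda>j. \<integral>\<theta>. indicator (far (\<eta> j)) \<theta> * u (circ \<theta>) \<partial>unit_measure)"
  have u_int: "integrable unit_measure (\<lambda>\<theta>. u (circ \<theta>))"
    using boundary_integrable by (simp add: u_def)
  have [measurable]: "(\<lambda>\<theta>. u (circ \<theta>)) \<in> borel_measurable unit_measure" using u_int by (rule borel_measurable_integrable)
  have "J \<longlonglongrightarrow> (\<integral>\<theta>. u (circ \<theta>) \<partial>unit_measure)"
    unfolding J_def
  proof (rule integral_dominated_convergence[of _ _ _ "\<lambda>\<theta>. \<bar>u (circ \<theta>)\<bar>"])
    have "AE \<theta> in lborel. \<theta> \<noteq> (0::real)" by (rule AE_lborel_singleton)
    then have "AE \<theta> in unit_measure. \<theta> \<in> {0<..<1}" unfolding AE_unit_measure by eventually_elim auto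
    then show "AE \<theta> in unit_measure. (\<lambda>j. indicator (far (\<eta> j)) \<theta> * u (circ \<theta>)) \<longlonglongrightarrow> u (circ \<theta>)"
    proof eventually_elim
      case (elim \<theta>)
      have "Re (circ \<theta>) < 1"
      proof (rule ccontr)
        assume "\<not> Re (circ \<theta>) < 1"
        then have "(norm (circ \<theta> - 1))\<^sup>2 \<le> 0" unfolding norm_circ_minus_1 by simp
        then have "circ \<theta> = circ 0" by (simp add: circ_def)
        then have "\<theta> = 0" using elim by (intro circ_inj) auto
        then show False using elim by simp
      qed
      moreover have "(\<lambda>j. 1 - (\<eta> j)\<^sup>2 / 2) \<longlonglongrightarrow> 1 - 0\<^sup>2 / 2" by (intro tendsto_intros \<eta>0) simp
      ultimately have "\<forall>\<^sub>F j in sequentially. Re (circ \<theta>) < 1 - (\<eta> j)\<^sup>2 / 2" by (intro order_tendstoD(1)) auto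
      then have "\<forall>\<^sub>F j in sequentially. indicator (far (\<eta> j)) \<theta> * u (circ \<theta>) = u (circ \<theta>)"
        by eventually_elim (simp add: far_def)
      then show ?case by (rule tendsto_eventually)
    qed
    show "AE \<theta> in unit_measure. norm (indicator (far (\<eta> j)) \<theta> * u (circ \<theta>)) \<le> \<bar>u (circ \<theta>)\<bar>" for j
      by (auto simp: indicator_def)
  qed (use u_int in auto)
  moreover have "J \<longlonglongrightarrow> V"
  proof -
    have "(\<lambda>j. V - J j) \<longlonglongrightarrow> 0"
    proof (rule Lim_null_comparison)
      show "\<forall>\<^sub>F j in sequentially. norm (V - J j) \<le> 18 * \<eta> j * (- ln c - real m * ln (\<eta> j))"
        using eventually_compose_filterlim[OF rad \<eta>_lim]
      proof eventually_elim
        case (elim j)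
        have pos: "c * \<eta> j ^ m > 0" using c \<eta> by simp
        then have nz: "F (of_real (1 - \<eta> j)) \<noteq> 0" using elim by auto
        have "ln (c * \<eta> j ^ m) \<le> ln (norm (F (of_real (1 - \<eta> j))))" using elim pos by (subst ln_le_cancel_iff) auto
        moreover have "ln (c * \<eta> j ^ m) = ln c + real m * ln (\<eta> j)"
          using c \<eta>(1)[of j] by (simp add: ln_mult ln_realpow)
        ultimately have "u (of_real (1 - \<eta> j)) \<le> - ln c - real m * ln (\<eta> j)" by (simp add: u_def)
        then have "18 * \<eta> j * u (of_real (1 - \<eta> j)) \<le> 18 * \<eta> j * (- ln c - real m * ln (\<eta> j))"
          using \<eta>(1)[of j] by (intro mult_left_mono) auto
        then show ?case using far_error[OF \<eta> nz] by (simp add: V_def J_def)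
      qed
      have "((\<lambda>x::real. 18 * x * (- ln c - real m * ln x)) \<longlongrightarrow> 0) (at_right 0)" by real_asymp
      from filterlim_compose[OF this \<eta>_lim]
      show "(\<lambda>j. 18 * \<eta> j * (- ln c - real m * ln (\<eta> j))) \<longlonglongrightarrow> 0" .
    qed
    from tendsto_diff[OF tendsto_const[of V] this] show ?thesis by simp
  qed
  ultimately have "(\<integral>\<theta>. u (circ \<theta>) \<partial>unit_measure) = V" by (rule LIMSEQ_unique)
  then show ?thesis by (simp add: V_def u_def)
qed

end

section \<open>Powers of the logarithm of zeta on the critical line\<close>

text \<open>The distribution function of X / 2 for a standard Cauchy variable X. It inverts the
  substitution cot (pi t) / 2 up to sign, since cot (pi / 2 + a) = -tan a.\<close>

definition cauchy_quantile :: "real \<Rightarrow> real" where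
  "cauchy_quantile y = 1 / 2 + arctan (2 * y) / pi"

lemma cauchy_quantile_mono: "y \<le> z \<Longrightarrow> cauchy_quantile y \<le> cauchy_quantile z"
  by (simp add: cauchy_quantile_def divide_right_mono arctan_le_iff)

lemma cot_cauchy_quantile: "cot (pi * cauchy_quantile y) / 2 = - y"
proof -
  have "pi * cauchy_quantile y = pi / 2 + arctan (2 * y)"
    by (simp add: cauchy_quantile_def field_simps)
  then have "cot (pi * cauchy_quantile y) = - tan (arctan (2 * y))"
    by (simp only: cot_def tan_def sin_add cos_add) simp
  then show ?thesis by (simp add: tan_arctan)
qed

lemma cauchy_quantile_cover:
  assumes "0 < \<theta>" "\<theta> < 1"
  obtains k :: int where "\<theta> \<in> {cauchy_quantile (of_int k - 1/2)..cauchy_quantile (of_int k + 1/2)}"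
proof -
  define y where "y = tan (pi * (\<theta> - 1/2)) / 2"
  have "arctan (tan (pi * (\<theta> - 1/2))) = pi * (\<theta> - 1/2)"
  proof (rule arctan_tan)
    have "pi * (- 1/2) < pi * (\<theta> - 1/2)" "pi * (\<theta> - 1/2) < pi * (1/2)"
      using assms pi_gt_zero by (intro mult_strict_left_mono; simp)+
    then show "- (pi / 2) < pi * (\<theta> - 1/2)" "pi * (\<theta> - 1/2) < pi / 2" by auto
  qed
  then have \<theta>: "\<theta> = cauchy_quantile y" by (simp add: cauchy_quantile_def y_def)
  have "of_int (round y) - 1/2 \<le> y" "y \<le> of_int (round y) + 1/2"
    using of_int_round_abs_le[of y] by linarith+
  then show ?thesis using that[of "round y"] unfolding \<theta> by (auto intro: cauchy_quantile_mono)
qed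

lemma cot_measurable [measurable]: "(\<lambda>x::real. cot (pi * x)) \<in> borel_measurable borel"
proof -
  have "(\<lambda>x::real. sin (pi * x)) \<in> borel_measurable borel" "(\<lambda>x::real. cos (pi * x)) \<in> borel_measurable borel"
    by (intro borel_measurable_continuous_onI continuous_intros)+
  then show ?thesis unfolding cot_def by measurable
qed

text \<open>The density of X / 2 is 2 / (pi (1 + 4 y^2)). On the window around \<open>k\<close> one
  has k^2 <= (|y| + 1/2)^2 <= 2 y^2 + 1/2, and pi > 3 then bounds the density by 1 / (1 + k^2). The
  sign of the substitution moves the window to \<open>- k\<close>.\<close>

lemma nn_integral_cot_window:
  assumes \<Phi> [measurable]: "\<Phi> \<in> borel_measurable borel" and nonneg: "\<And>y. 0 \<le> (\<Phi> y :: real)"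
  shows "(\<integral>\<^sup>+\<theta>. ennreal (\<Phi> (cot (pi * \<theta>) / 2)) *
            indicator {cauchy_quantile (of_int k - 1/2)..cauchy_quantile (of_int k + 1/2)} \<theta> \<partial>lborel) \<le>
         ennreal (1 / (1 + (of_int k)\<^sup>2)) * (\<integral>\<^sup>+t. ennreal (\<Phi> (of_int (- k) + t)) * indicator {-1/2..1/2} t \<partial>lborel)"
proof -
  define a b :: real where "a = of_int k - 1/2" and "b = of_int k + 1/2"
  define g' where "g' = (\<lambda>y::real. (2 / (1 + (2 * y)\<^sup>2)) / pi)"
  define f where "f = (\<lambda>\<theta>. \<Phi> (cot (pi * \<theta>) / 2))"
  have [measurable]: "f \<in> borel_measurable borel" unfolding f_def by measurable
  have "(\<integral>\<^sup>+\<theta>. ennreal (f \<theta>) * indicator {cauchy_quantile a..cauchy_quantile b} \<theta> \<partial>lborel) =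
      (\<integral>\<^sup>+\<theta>. f \<theta> * indicator {cauchy_quantile a..cauchy_quantile b} \<theta> \<partial>lborel)"
    by (intro nn_integral_cong) (auto simp: indicator_def)
  also have "\<dots> = (\<integral>\<^sup>+y. f (cauchy_quantile y) * g' y * indicator {a..b} y \<partial>lborel)"
  proof (rule nn_integral_substitution)
    show "set_borel_measurable borel {cauchy_quantile a..cauchy_quantile b} f"
      unfolding set_borel_measurable_def by measurable
    show "(cauchy_quantile has_real_derivative g' x) (at x)" for x
      unfolding cauchy_quantile_def[abs_def] g'_def
      by (rule DERIV_cong[OF DERIV_add[OF DERIV_const DERIV_cdivide[OF DERIV_chain2[OF DERIV_arctan DERIV_cmult_Id]]]])
         (simp add: divide_inverse)
    have "1 + (2 * y)\<^sup>2 \<noteq> 0" for y :: real by (smt (verit) zero_le_power2)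
    then show "continuous_on {a..b} g'" unfolding g'_def by (intro continuous_intros) auto
    show "0 \<le> g' x" for x by (simp add: g'_def)
    show "a \<le> b" by (simp add: a_def b_def)
  qed
  also have "\<dots> \<le> (\<integral>\<^sup>+y. ennreal (1 / (1 + (of_int k)\<^sup>2)) * (ennreal (\<Phi> (- y)) * indicator {a..b} y) \<partial>lborel)"
  proof (rule nn_integral_mono)
    fix y :: real
    show "ennreal (f (cauchy_quantile y) * g' y * indicator {a..b} y) \<le>
        ennreal (1 / (1 + (of_int k)\<^sup>2)) * (ennreal (\<Phi> (- y)) * indicator {a..b} y)"
    proof (cases "y \<in> {a..b}")
      case True
      have "g' y \<le> 1 / (1 + (of_int k)\<^sup>2)"
      proof -
        have "\<bar>of_int k\<bar> \<le> \<bar>y\<bar> + 1/2" using True by (auto simp: a_def b_def abs_if)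
        then have "\<bar>of_int k\<bar>\<^sup>2 \<le> (\<bar>y\<bar> + 1/2)\<^sup>2" by (intro power_mono) auto
        moreover have "0 \<le> (\<bar>y\<bar> - 1/2)\<^sup>2" by simp
        ultimately have "(of_int k)\<^sup>2 \<le> 2 * y\<^sup>2 + 1/2"
          by (simp add: power2_sum power2_diff power2_eq_square[of "1/2"] field_simps)
        then have "2 * (1 + (of_int k)\<^sup>2) \<le> 3 * (1 + (2 * y)\<^sup>2)"
        proof -
          have lin: "X \<le> 2 * Y + 1/2 \<Longrightarrow> 0 \<le> Y \<Longrightarrow> 2 * (1 + X) \<le> 3 * (1 + 4 * Y)" for X Y :: real
            by (rule order.trans[of _ "3 + 4 * Y"]) simp_all
          show "(of_int k)\<^sup>2 \<le> 2 * y\<^sup>2 + 1/2 \<Longrightarrow> 2 * (1 + (of_int k)\<^sup>2) \<le> 3 * (1 + (2 * y)\<^sup>2)"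
            using lin[of "(of_int k)\<^sup>2" "y\<^sup>2"] by (simp add: power_mult_distrib)
        qed
        also have "\<dots> \<le> pi * (1 + (2 * y)\<^sup>2)" using pi_gt3 by (intro mult_right_mono) auto
        finally show ?thesis
          unfolding g'_def by (simp add: field_simps add_pos_nonneg)
      qed
      then have "\<Phi> (- y) * g' y \<le> 1 / (1 + (of_int k)\<^sup>2) * \<Phi> (- y)"
        using nonneg[of "- y"] by (subst mult.commute) (intro mult_right_mono)
      then have "ennreal (\<Phi> (- y) * g' y) \<le> ennreal (1 / (1 + (of_int k)\<^sup>2) * \<Phi> (- y))" by (rule ennreal_leI)
      also have "\<dots> = ennreal (1 / (1 + (of_int k)\<^sup>2)) * ennreal (\<Phi> (- y))" by (rule ennreal_mult) (use nonneg in auto)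
      finally show ?thesis using True by (simp add: f_def cot_cauchy_quantile)
    qed simp
  qed
  also have "\<dots> = ennreal (1 / (1 + (of_int k)\<^sup>2)) * (\<integral>\<^sup>+y. ennreal (\<Phi> (- y)) * indicator {a..b} y \<partial>lborel)"
    by (rule nn_integral_cmult) measurable
  also have "(\<integral>\<^sup>+y. ennreal (\<Phi> (- y)) * indicator {a..b} y \<partial>lborel) =
      (\<integral>\<^sup>+t. ennreal (\<Phi> (of_int (- k) + t)) * indicator {-1/2..1/2} t \<partial>lborel)"
    by (subst nn_integral_real_affine[where c = "-1" and t = "of_int k"])
       (auto intro!: nn_integral_cong simp: a_def b_def indicator_def)
  finally show ?thesis by (simp add: f_def a_def b_def)
qed

text \<open>The windows cover (0, 1). Pairing \<open>k\<close> with \<open>- k\<close> turns the sum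
  over the integers into a series; shared end points and the window 0, listed twice, do no harm to
  an upper bound.\<close>

lemma nn_integral_cot_finite:
  assumes \<Phi> [measurable]: "\<Phi> \<in> borel_measurable borel" and nonneg: "\<And>y. 0 \<le> (\<Phi> y :: real)"
    and b: "\<And>k::int. (\<integral>\<^sup>+t. ennreal (\<Phi> (of_int k + t)) * indicator {-1/2..1/2} t \<partial>lborel) \<le> ennreal (b (nat \<bar>k\<bar>))"
    and b0: "\<And>n. b n \<ge> 0" and sm: "summable (\<lambda>n. b n / (1 + (real n)\<^sup>2))"
  shows "(\<integral>\<^sup>+\<theta>. ennreal (\<Phi> (cot (pi * \<theta>) / 2)) \<partial>unit_measure) < \<infinity>"
proof -
  define I where "I = (\<lambda>k::int. {cauchy_quantile (of_int k - 1/2)..cauchy_quantile (of_int k + 1/2)})"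
  define h where "h = (\<lambda>\<theta>. ennreal (\<Phi> (cot (pi * \<theta>) / 2)))"
  have [measurable]: "h \<in> borel_measurable borel" unfolding h_def by measurable
  have [measurable]: "I k \<in> sets borel" for k by (simp add: I_def)
  have win: "(\<integral>\<^sup>+\<theta>. h \<theta> * indicator (I k) \<theta> \<partial>lborel) \<le> ennreal (b (nat \<bar>k\<bar>) / (1 + (real (nat \<bar>k\<bar>))\<^sup>2))" for k
  proof -
    have "(\<integral>\<^sup>+\<theta>. h \<theta> * indicator (I k) \<theta> \<partial>lborel) \<le> ennreal (1 / (1 + (of_int k)\<^sup>2)) * ennreal (b (nat \<bar>- k\<bar>))"
      unfolding h_def I_def by (rule order.trans[OF nn_integral_cot_window[OF \<Phi> nonneg]]) (intro mult_left_mono b, simp)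
    also have "\<dots> = ennreal (1 / (1 + (of_int k)\<^sup>2) * b (nat \<bar>- k\<bar>))" by (rule ennreal_mult[symmetric]) (use b0 in auto)
    finally show ?thesis by simp
  qed
  have "(\<integral>\<^sup>+\<theta>. h \<theta> \<partial>unit_measure) = (\<integral>\<^sup>+\<theta>. h \<theta> * indicator {0..<1} \<theta> \<partial>lborel)"
    by (rule nn_integral_unit_measure) measurable
  also have "\<dots> \<le> (\<integral>\<^sup>+\<theta>. (\<Sum>n. h \<theta> * indicator (I (int n)) \<theta> + h \<theta> * indicator (I (- int n)) \<theta>) \<partial>lborel)"
  proof (rule nn_integral_mono_AE)
    have "AE \<theta> in lborel. \<theta> \<noteq> (0::real)" by (rule AE_lborel_singleton)
    then show "AE \<theta> in lborel. h \<theta> * indicator {0..<1} \<theta> \<le>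
        (\<Sum>n. h \<theta> * indicator (I (int n)) \<theta> + h \<theta> * indicator (I (- int n)) \<theta>)"
    proof eventually_elim
      case (elim \<theta>)
      show ?case
      proof (cases "\<theta> \<in> {0..<1}")
        case True
        then obtain k where k: "\<theta> \<in> I k"
          using cauchy_quantile_cover[of \<theta>] elim unfolding I_def by auto
        define n where "n = nat \<bar>k\<bar>"
        have "k = int n \<or> k = - int n" by (auto simp: n_def)
        then have "h \<theta> \<le> h \<theta> * indicator (I (int n)) \<theta> + h \<theta> * indicator (I (- int n)) \<theta>"
          using k by auto
        also have "\<dots> = (\<Sum>i\<in>{n}. h \<theta> * indicator (I (int i)) \<theta> + h \<theta> * indicator (I (- int i)) \<theta>)" by simp
        also have "\<dots> \<le> (\<Sum>n. h \<theta> * indicator (I (int n)) \<theta> + h \<theta> * indicator (I (- int n)) \<theta>)"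
          by (rule sum_le_suminf) auto
        finally show ?thesis using True by simp
      qed simp
    qed
  qed
  also have "\<dots> = (\<Sum>n. \<integral>\<^sup>+\<theta>. h \<theta> * indicator (I (int n)) \<theta> + h \<theta> * indicator (I (- int n)) \<theta> \<partial>lborel)"
    by (rule nn_integral_suminf) measurable
  also have "\<dots> = (\<Sum>n. (\<integral>\<^sup>+\<theta>. h \<theta> * indicator (I (int n)) \<theta> \<partial>lborel) + (\<integral>\<^sup>+\<theta>. h \<theta> * indicator (I (- int n)) \<theta> \<partial>lborel))"
    by (subst nn_integral_add) measurable
  also have "\<dots> \<le> (\<Sum>n. ennreal (2 * (b n / (1 + (real n)\<^sup>2))))"
  proof (rule suminf_le)
    fix n
    have "(\<integral>\<^sup>+\<theta>. h \<theta> * indicator (I (int n)) \<theta> \<partial>lborel) + (\<integral>\<^sup>+\<theta>. h \<theta> * indicator (I (- int n)) \<theta> \<partial>lborel) \<le>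
        ennreal (b n / (1 + (real n)\<^sup>2)) + ennreal (b n / (1 + (real n)\<^sup>2))"
      using win[of "int n"] win[of "- int n"] by (intro add_mono) auto
    also have "\<dots> = ennreal (2 * (b n / (1 + (real n)\<^sup>2)))"
      using b0[of n] by (subst ennreal_plus[symmetric]) auto
    finally show "(\<integral>\<^sup>+\<theta>. h \<theta> * indicator (I (int n)) \<theta> \<partial>lborel) + (\<integral>\<^sup>+\<theta>. h \<theta> * indicator (I (- int n)) \<theta> \<partial>lborel) \<le>
        ennreal (2 * (b n / (1 + (real n)\<^sup>2)))" .
  qed auto
  also have "\<dots> = ennreal (\<Sum>n. 2 * (b n / (1 + (real n)\<^sup>2)))"
    using b0 by (intro suminf_ennreal2 summable_mult sm) auto
  also have "\<dots> < \<infinity>" by simp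
  finally show ?thesis unfolding h_def .
qed

lemma summable_ln_power_over_square:
  assumes A: "A \<ge> (1::real)"
  shows "summable (\<lambda>n. ln (A * (real n + 5)\<^sup>2) ^ q / (1 + (real n)\<^sup>2))"
proof (rule summable_comparison_test_bigo)
  show "summable (\<lambda>n. norm (1 / real n powr (3/2)))"
    by (simp add: powr_minus_divide[symmetric] summable_real_powr_iff)
  have "(\<lambda>n. ln (A * (real n + 5)\<^sup>2) powr real q / (1 + (real n)\<^sup>2)) \<in> O(\<lambda>n. 1 / real n powr (3/2))"
    using A by real_asymp
  moreover have "ln (A * (real n + 5)\<^sup>2) powr real q = ln (A * (real n + 5)\<^sup>2) ^ q" for n
  proof -
    have "1 * 1 < A * (real n + 5)\<^sup>2"
      using A by (intro mult_le_less_imp_less) (auto intro: one_less_power)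
    then show ?thesis by (intro powr_realpow) simp
  qed
  ultimately show "(\<lambda>n. ln (A * (real n + 5)\<^sup>2) ^ q / (1 + (real n)\<^sup>2)) \<in> O(\<lambda>n. 1 / real n powr (3/2))"
    by simp
qed

section \<open>Logarithmic moments of zeta and of s - 1 on the critical line\<close>

definition zeta_line :: "real \<Rightarrow> complex" where
  "zeta_line y = 1 / 2 + \<i> * of_real y"

lemma zeta_line_ne_1: "zeta_line y \<noteq> 1"
  by (simp add: zeta_line_def complex_eq_iff)

lemma zeta_line_measurable:
  "(\<lambda>y. ln (norm (zeta (zeta_line y)))) \<in> borel_measurable borel"
  "(\<lambda>y. ln (norm (zeta_line y - 1))) \<in> borel_measurable borel"
proof -
  have line: "continuous_on UNIV zeta_line" unfolding zeta_line_def[abs_def] by (intro continuous_intros)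
  have "continuous_on UNIV (\<lambda>y. zeta_reg (zeta_line y) / (zeta_line y - 1))"
    using zeta_line_ne_1
    by (intro continuous_on_divide continuous_on_diff continuous_on_const line
        continuous_on_compose2[OF holomorphic_on_imp_continuous_on[OF holomorphic_zeta_reg[of UNIV]] line]) auto
  moreover have "(\<lambda>y. zeta_reg (zeta_line y) / (zeta_line y - 1)) = (\<lambda>y. zeta (zeta_line y))"
    using zeta_line_ne_1 by (simp add: zeta_eq)
  ultimately have "continuous_on UNIV (\<lambda>y. zeta (zeta_line y))" by (simp only:)
  then have "continuous_on UNIV (\<lambda>y. norm (zeta (zeta_line y)))" by (rule continuous_on_norm)
  from borel_measurable_continuous_onI[OF this]
  show "(\<lambda>y. ln (norm (zeta (zeta_line y)))) \<in> borel_measurable borel" by measurable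
  have "continuous_on UNIV (\<lambda>y. norm (zeta_line y - 1))"
    unfolding zeta_line_def by (intro continuous_intros)
  from borel_measurable_continuous_onI[OF this]
  show "(\<lambda>y. ln (norm (zeta_line y - 1))) \<in> borel_measurable borel" by measurable
qed

lemma abs_ln_norm_line_minus_1_le:
  assumes A: "A \<ge> 2" and t: "\<bar>t\<bar> \<le> 1/2"
  shows "\<bar>ln (norm (zeta_line (of_int k + t) - 1))\<bar> \<le> ln (A * (real (nat \<bar>k\<bar>) + 5)\<^sup>2)"
proof -
  define n where "n = real (nat \<bar>k\<bar>)"
  define d where "d = norm (zeta_line (of_int k + t) - 1)"
  define y where "y = of_int k + t"
  have n: "n = \<bar>of_int k\<bar>" "n \<ge> 0" by (auto simp: n_def)
  have eq: "zeta_line y - 1 = Complex (-1/2) y" by (simp add: zeta_line_def complex_eq_iff)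
  have "1/2 \<le> d" using abs_Re_le_cmod[of "zeta_line y - 1"] by (simp add: d_def y_def[symmetric] eq)
  have "\<bar>y\<bar> \<le> n + 1/2" using t n abs_triangle_ineq[of "of_int k" t] by (simp add: y_def)
  then have "d \<le> n + 1"
    using cmod_le[of "zeta_line y - 1"] by (simp add: d_def y_def[symmetric] eq)
  have A': "2 \<le> A * (n + 5)\<^sup>2" "n + 1 \<le> A * (n + 5)\<^sup>2"
  proof -
    have "1 * (n + 5) \<le> (n + 5) * (n + 5)" using n by (intro mult_right_mono) auto
    then have "n + 5 \<le> (n + 5)\<^sup>2" by (simp add: power2_eq_square)
    moreover have "1 * (n + 5)\<^sup>2 \<le> A * (n + 5)\<^sup>2" using A by (intro mult_right_mono) auto
    ultimately show "2 \<le> A * (n + 5)\<^sup>2" "n + 1 \<le> A * (n + 5)\<^sup>2" using n(2) by linarith+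
  qed
  have "ln d \<le> ln (A * (n + 5)\<^sup>2)" using \<open>1/2 \<le> d\<close> \<open>d \<le> n + 1\<close> A' by (subst ln_le_cancel_iff) auto
  moreover have "ln (1/2) \<le> ln d" using \<open>1/2 \<le> d\<close> by (subst ln_le_cancel_iff) auto
  moreover have "ln (1/2) = - ln (2::real)" by (simp add: ln_div)
  moreover have "ln 2 \<le> ln (A * (n + 5)\<^sup>2)" using A' by (subst ln_le_cancel_iff) auto
  ultimately show ?thesis unfolding d_def[symmetric] n_def[symmetric] by linarith
qed

lemma ln_line_minus_1_finite:
  "(\<integral>\<^sup>+\<theta>. ennreal (\<bar>ln (norm (zeta_line (cot (pi * \<theta>) / 2) - 1))\<bar> ^ q) \<partial>unit_measure) < \<infinity>"
proof (rule nn_integral_cot_finite)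
  note [measurable] = zeta_line_measurable
  show "(\<lambda>y. \<bar>ln (norm (zeta_line y - 1))\<bar> ^ q) \<in> borel_measurable borel" by measurable
  show "summable (\<lambda>n. ln (2 * (real n + 5)\<^sup>2) ^ q / (1 + (real n)\<^sup>2))"
    by (rule summable_ln_power_over_square) simp
  show "0 \<le> ln (2 * (real n + 5)\<^sup>2) ^ q" for n
  proof -
    have "1 * 1 \<le> 2 * (real n + 5)\<^sup>2" by (intro mult_mono one_le_power) auto
    then show ?thesis by simp
  qed
  show "(\<integral>\<^sup>+t. ennreal (\<bar>ln (norm (zeta_line (of_int k + t) - 1))\<bar> ^ q) * indicator {-1/2..1/2} t \<partial>lborel)
      \<le> ennreal (ln (2 * (real (nat \<bar>k\<bar>) + 5)\<^sup>2) ^ q)" for k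
  proof -
    have "(\<integral>\<^sup>+t. ennreal (\<bar>ln (norm (zeta_line (of_int k + t) - 1))\<bar> ^ q) * indicator {-1/2..1/2} t \<partial>lborel)
      \<le> (\<integral>\<^sup>+t. ennreal (ln (2 * (real (nat \<bar>k\<bar>) + 5)\<^sup>2) ^ q) * indicator {-1/2..1/2::real} t \<partial>lborel)"
    proof (rule nn_integral_mono)
      fix t :: real
      show "ennreal (\<bar>ln (norm (zeta_line (of_int k + t) - 1))\<bar> ^ q) * indicator {-1/2..1/2} t \<le>
          ennreal (ln (2 * (real (nat \<bar>k\<bar>) + 5)\<^sup>2) ^ q) * indicator {-1/2..1/2} t"
      proof (cases "t \<in> {-1/2..1/2}")
        case True
        then have "\<bar>t\<bar> \<le> 1/2" by auto
        then have "\<bar>ln (norm (zeta_line (of_int k + t) - 1))\<bar> ^ q \<le> ln (2 * (real (nat \<bar>k\<bar>) + 5)\<^sup>2) ^ q"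
          by (intro power_mono abs_ln_norm_line_minus_1_le) auto
        then show ?thesis by (intro mult_right_mono ennreal_leI) auto
      next
        case False
        then have ind: "indicator {-1/2..1/2} t = (0::ennreal)" by (rule indicator_simps(2))
        show ?thesis unfolding ind by simp
      qed
    qed
    also have "\<dots> = ennreal (ln (2 * (real (nat \<bar>k\<bar>) + 5)\<^sup>2) ^ q)"
      by (subst nn_integral_cmult_indicator) auto
    finally show ?thesis .
  qed
qed simp

text \<open>The local estimate is applied to \<open>zeta_reg\<close> with centre 2 + ik: the segment
  then lies on the critical line and the disc of radius 7/4 in Re s >= 1/4. There
  \<open>zeta_reg\<close> grows at most quadratically, and at the centre its modulus is at least
  1/4, so the weight is logarithmic in |k|; its q-th power is summable against 1 / (1 + k^2). The
  divisor s - 1 costs another logarithm.\<close>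

lemma ln_zeta_finite:
  assumes q: "even q" "q > 0"
  shows "(\<integral>\<^sup>+\<theta>. ennreal (\<bar>ln (norm (zeta (zeta_line (cot (pi * \<theta>) / 2))))\<bar> ^ q) \<partial>unit_measure) < \<infinity>"
proof -
  obtain C where C: "C > 0" and C_bound: "\<And>s. Re s \<ge> 1/4 \<Longrightarrow> norm (zeta_reg s - 1) \<le> C * norm s * norm (s - 1)"
    by (rule zeta_reg_bound) (rule that; assumption)
  obtain K :: real where K: "K \<ge> 0" and K_bound:
    "\<And>F c M. F holomorphic_on UNIV \<Longrightarrow> (\<And>z. z \<in> cball c (7/4) \<Longrightarrow> norm (F z) \<le> M) \<Longrightarrow> F c \<noteq> 0 \<Longrightarrow>
       (\<integral>\<^sup>+y. ennreal (\<bar>ln (norm (F (c - 3/2 + \<i> * of_real y)) / M)\<bar> ^ q) * indicator {-1/2..1/2} y \<partial>lborel)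
         \<le> ennreal (K * ln (M / norm (F c)) ^ q)"
    by (rule local_ln_power_integral[OF q]) (rule that, assumption, blast)
  \<comment> \<open>The 4 is the reciprocal of the lower bound 1/4 at the centre: \<open>M\<close>
    divided by 1/4 is A (n + 5)^2.\<close>
  define A where "A = 4 * (1 + C)"
  define Ln where "Ln = (\<lambda>n::nat. ln (A * (real n + 5)\<^sup>2))"
  define B where "B = 2 ^ q * K + 4 ^ q"
  have A: "A \<ge> 2" using C by (simp add: A_def)
  have big: "1 \<le> (1 + C) * (real n + 5)\<^sup>2" for n
  proof -
    have "1 * 1 \<le> (1 + C) * (real n + 5)\<^sup>2" using C by (intro mult_mono one_le_power) auto
    then show ?thesis by simp
  qed
  have Ln0: "Ln n \<ge> 0" for n
  proof -
    have "1 * 1 \<le> A * (real n + 5)\<^sup>2" using A by (intro mult_mono one_le_power) auto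
    then show ?thesis by (simp add: Ln_def)
  qed
  have B0: "B \<ge> 0" using K by (simp add: B_def)
  have window: "(\<integral>\<^sup>+t. ennreal (\<bar>ln (norm (zeta (zeta_line (of_int k + t))))\<bar> ^ q) * indicator {-1/2..1/2} t \<partial>lborel)
      \<le> ennreal (B * Ln (nat \<bar>k\<bar>) ^ q)" for k
  proof -
    define n where "n = nat \<bar>k\<bar>"
    define M where "M = (1 + C) * (real n + 5)\<^sup>2"
    define c where "c = Complex 2 (of_int k)"
    have M1: "M \<ge> 1" using big[of n] by (simp add: M_def)
    have kn: "\<bar>of_int k\<bar> = real n" by (simp add: n_def)
    have M_bound: "norm (zeta_reg z) \<le> M" if "z \<in> cball c (7/4)" for z
    proof -
      have d: "norm (z - c) \<le> 7/4" using that by (simp add: dist_norm norm_minus_commute)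
      have "\<bar>Re (z - c)\<bar> \<le> 7/4" using abs_Re_le_cmod[of "z - c"] d by linarith
      moreover have "Re (z - c) = Re z - 2" by (simp add: c_def)
      ultimately have Re: "Re z \<ge> 1/4" by linarith
      have "norm c \<le> 2 + real n" using cmod_le[of c] kn by (simp add: c_def)
      moreover have "norm z \<le> norm c + norm (z - c)" using norm_triangle_ineq[of c "z - c"] by simp
      ultimately have z: "norm z \<le> real n + 4" using d by linarith
      then have z1: "norm (z - 1) \<le> real n + 5" using norm_triangle_ineq4[of z 1] by simp
      have "norm (zeta_reg z) \<le> 1 + norm (zeta_reg z - 1)" using norm_triangle_ineq[of 1 "zeta_reg z - 1"] by simp
      also have "norm (zeta_reg z - 1) \<le> C * norm z * norm (z - 1)" by (rule C_bound[OF Re])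
      also have "\<dots> \<le> C * (real n + 5) * (real n + 5)" using z z1 C by (intro mult_mono) auto
      also have "1 \<le> (real n + 5)\<^sup>2" by (intro one_le_power) simp
      finally show ?thesis by (simp add: M_def power2_eq_square algebra_simps)
    qed
    have c_ge: "norm (zeta_reg c) \<ge> 1/4"
    proof -
      have "zeta_reg c = (c - 1) * zeta_series c" by (rule zeta_reg_eq_series) (simp add: c_def)
      moreover have "1 \<le> norm (c - 1)" using abs_Re_le_cmod[of "c - 1"] by (simp add: c_def)
      moreover have "1/4 \<le> norm (zeta_series c)" by (rule norm_zeta_series_ge) (simp add: c_def)
      ultimately have "1 * (1/4) \<le> norm (zeta_reg c)" unfolding \<open>zeta_reg c = _\<close> norm_mult by (intro mult_mono) auto
      then show ?thesis by simp
    qed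
    then have c_nz: "zeta_reg c \<noteq> 0" by auto
    have c_le: "norm (zeta_reg c) \<le> M" by (rule M_bound) simp
    have cpos: "norm (zeta_reg c) > 0" using c_nz by simp
    have L: "0 \<le> ln (M / norm (zeta_reg c))" "ln (M / norm (zeta_reg c)) \<le> Ln n"
    proof -
      show "0 \<le> ln (M / norm (zeta_reg c))" using c_le cpos by simp
      have "M / norm (zeta_reg c) \<le> M / (1/4)" using c_ge M1 by (intro divide_left_mono) auto
      also have "\<dots> = A * (real n + 5)\<^sup>2" by (simp add: M_def A_def)
      finally show "ln (M / norm (zeta_reg c)) \<le> Ln n"
        unfolding Ln_def using M1 cpos by (subst ln_le_cancel_iff) (auto intro: less_le_trans[of 0 "M / norm (zeta_reg c)"])
    qed
    have lnM: "0 \<le> ln M" "ln M \<le> Ln n"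
    proof -
      show "0 \<le> ln M" using M1 by simp
      have "A * (real n + 5)\<^sup>2 = 4 * M" by (simp add: A_def M_def)
      then show "ln M \<le> Ln n" using M1 unfolding Ln_def by (subst ln_le_cancel_iff) auto
    qed
    define X where "X = (\<lambda>t. \<bar>ln (norm (zeta_reg (c - 3/2 + \<i> * of_real t)) / M)\<bar>)"
    have X_cont: "continuous_on UNIV (\<lambda>t. norm (zeta_reg (c - 3/2 + \<i> * of_real t)))"
      by (intro continuous_intros continuous_on_compose2[OF holomorphic_on_imp_continuous_on[OF holomorphic_zeta_reg[of UNIV]]]) auto
    from borel_measurable_continuous_onI[OF this]
    have [measurable]: "X \<in> borel_measurable borel" unfolding X_def by measurable
    have line: "c - 3/2 + \<i> * of_real t = zeta_line (of_int k + t)" for t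
      by (simp add: c_def zeta_line_def complex_eq_iff)
    have point: "\<bar>ln (norm (zeta (zeta_line (of_int k + t))))\<bar> ^ q \<le> 2 ^ q * X t ^ q + 4 ^ q * Ln n ^ q"
      if t: "\<bar>t\<bar> \<le> 1/2" for t
    proof -
      define s where "s = zeta_line (of_int k + t)"
      have s1: "s \<noteq> 1" unfolding s_def by (rule zeta_line_ne_1)
      have X0: "X t \<ge> 0" by (simp add: X_def)
      have "\<bar>ln (norm (zeta s))\<bar> \<le> X t + 2 * Ln n"
      proof (cases "zeta_reg s = 0")
        case True
        then show ?thesis using s1 X0 Ln0[of n] by (simp add: zeta_eq)
      next
        case False
        have "ln (norm (zeta s)) = ln (norm (zeta_reg s)) - ln (norm (s - 1))"
          using False s1 by (simp add: zeta_eq norm_divide ln_div)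
        moreover have "ln (norm (zeta_reg s) / M) = ln (norm (zeta_reg s)) - ln M"
          using False M1 by (simp add: ln_div)
        moreover have "X t = \<bar>ln (norm (zeta_reg s) / M)\<bar>" by (simp add: X_def line s_def)
        moreover have "\<bar>ln (norm (s - 1))\<bar> \<le> Ln n"
          unfolding s_def Ln_def n_def by (rule abs_ln_norm_line_minus_1_le[OF A t])
        ultimately show ?thesis using lnM by linarith
      qed
      then have "\<bar>ln (norm (zeta s))\<bar> ^ q \<le> (X t + 2 * Ln n) ^ q" by (intro power_mono) auto
      also have "\<dots> \<le> 2 ^ q * X t ^ q + 4 ^ q * Ln n ^ q"
      proof (cases "X t \<le> 2 * Ln n")
        case True
        then have "(X t + 2 * Ln n) ^ q \<le> (4 * Ln n) ^ q" using X0 Ln0[of n] by (intro power_mono) auto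
        then show ?thesis using X0 by (simp add: power_mult_distrib add_increasing)
      next
        case False
        then have "(X t + 2 * Ln n) ^ q \<le> (2 * X t) ^ q" using X0 Ln0[of n] by (intro power_mono) auto
        then show ?thesis using Ln0[of n] by (simp add: power_mult_distrib add_increasing2)
      qed
      finally show ?thesis by (simp add: s_def)
    qed
    have "(\<integral>\<^sup>+t. ennreal (\<bar>ln (norm (zeta (zeta_line (of_int k + t))))\<bar> ^ q) * indicator {-1/2..1/2} t \<partial>lborel) \<le>
        (\<integral>\<^sup>+t. ennreal (2 ^ q) * (ennreal (X t ^ q) * indicator {-1/2..1/2} t) +
               ennreal (4 ^ q * Ln n ^ q) * indicator {-1/2..1/2} t \<partial>lborel)"
    proof (rule nn_integral_mono)
      fix t :: real
      show "ennreal (\<bar>ln (norm (zeta (zeta_line (of_int k + t))))\<bar> ^ q) * indicator {-1/2..1/2} t \<le>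
          ennreal (2 ^ q) * (ennreal (X t ^ q) * indicator {-1/2..1/2} t) + ennreal (4 ^ q * Ln n ^ q) * indicator {-1/2..1/2} t"
      proof (cases "t \<in> {-1/2..1/2}")
        case True
        then have t: "\<bar>t\<bar> \<le> 1/2" by auto
        have ind: "indicator {-1/2..1/2} t = (1::ennreal)" using True by (rule indicator_simps(1))
        have "ennreal (\<bar>ln (norm (zeta (zeta_line (of_int k + t))))\<bar> ^ q) \<le> ennreal (2 ^ q * X t ^ q + 4 ^ q * Ln n ^ q)"
          by (intro ennreal_leI point t)
        also have "\<dots> = ennreal (2 ^ q) * ennreal (X t ^ q) + ennreal (4 ^ q * Ln n ^ q)"
          using Ln0[of n] by (subst ennreal_plus) (auto simp: X_def ennreal_mult)
        finally show ?thesis unfolding ind by simp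
      next
        case False
        then have ind: "indicator {-1/2..1/2} t = (0::ennreal)" by (rule indicator_simps(2))
        show ?thesis unfolding ind by simp
      qed
    qed
    also have "\<dots> = ennreal (2 ^ q) * (\<integral>\<^sup>+t. ennreal (X t ^ q) * indicator {-1/2..1/2} t \<partial>lborel) + ennreal (4 ^ q * Ln n ^ q)"
      by (subst nn_integral_add) (auto simp: nn_integral_cmult nn_integral_cmult_indicator)
    also have "\<dots> \<le> ennreal (2 ^ q) * ennreal (K * Ln n ^ q) + ennreal (4 ^ q * Ln n ^ q)"
    proof (intro add_right_mono mult_left_mono)
      have "(\<integral>\<^sup>+t. ennreal (X t ^ q) * indicator {-1/2..1/2} t \<partial>lborel) \<le> ennreal (K * ln (M / norm (zeta_reg c)) ^ q)"
        unfolding X_def by (rule K_bound[OF holomorphic_zeta_reg M_bound c_nz])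
      also have "\<dots> \<le> ennreal (K * Ln n ^ q)"
        using L K by (intro ennreal_leI mult_left_mono power_mono) auto
      finally show "(\<integral>\<^sup>+t. ennreal (X t ^ q) * indicator {-1/2..1/2} t \<partial>lborel) \<le> ennreal (K * Ln n ^ q)" .
    qed simp
    also have "\<dots> = ennreal (B * Ln n ^ q)"
      using K Ln0[of n] by (subst ennreal_mult[symmetric], simp, simp, subst ennreal_plus[symmetric]) (auto simp: B_def algebra_simps)
    finally show ?thesis by (simp add: n_def)
  qed
  show ?thesis
  proof (rule nn_integral_cot_finite[OF _ _ window])
    note [measurable] = zeta_line_measurable
    show "(\<lambda>y. \<bar>ln (norm (zeta (zeta_line y)))\<bar> ^ q) \<in> borel_measurable borel" by measurable
    show "0 \<le> B * Ln n ^ q" for n using B0 Ln0 by simp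
    have "summable (\<lambda>n. Ln n ^ q / (1 + (real n)\<^sup>2))"
      unfolding Ln_def by (rule summable_ln_power_over_square) (use A in simp)
    from summable_mult[OF this, of B] show "summable (\<lambda>n. B * Ln n ^ q / (1 + (real n)\<^sup>2))" by simp
  qed simp
qed

section \<open>The mean of the logarithm of zeta on the critical line\<close>

text \<open>The Moebius map w -> 1 / (1 - w) takes the circle to the critical line, because 1 - exp
  (2it) = 2 sin t (sin t - i cos t), here with t = pi \<theta>.\<close>

lemma one_minus_circ:
  assumes "0 < \<theta>" "\<theta> < 1"
  shows "circ \<theta> \<noteq> 1" "1 / (1 - circ \<theta>) = zeta_line (cot (pi * \<theta>) / 2)"
proof -
  define s where "s = sin (pi * \<theta>)"
  define c where "c = cos (pi * \<theta>)"
  have s: "s > 0" unfolding s_def using assms by (intro sin_gt_zero) auto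
  have sc: "s * s + c * c = 1" by (simp add: s_def c_def power2_eq_square[symmetric])
  have "circ \<theta> = Complex (1 - 2 * s\<^sup>2) (2 * s * c)"
    unfolding circ_def s_def c_def using cos_double_sin[of "pi * \<theta>"] sin_double[of "pi * \<theta>"]
    by (simp add: complex_eq_iff mult_ac)
  then have circ: "1 - circ \<theta> = Complex (2 * s * s) (- 2 * s * c)"
    by (simp add: complex_eq_iff power2_eq_square)
  then show "circ \<theta> \<noteq> 1" using s by (auto simp: complex_eq_iff)
  then have nz: "1 - circ \<theta> \<noteq> 0" by simp
  have "zeta_line (cot (pi * \<theta>) / 2) * (1 - circ \<theta>) = 1"
  proof -
    have "zeta_line (cot (pi * \<theta>) / 2) = Complex (1/2) (c / s / 2)"
      by (simp add: zeta_line_def cot_def complex_eq_iff s_def c_def)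
    then show ?thesis unfolding circ using s sc by (simp add: complex_eq_iff field_simps)
  qed
  then show "1 / (1 - circ \<theta>) = zeta_line (cot (pi * \<theta>) / 2)"
    using nz by (simp add: field_simps)
qed

lemma norm_one_minus_circ:
  assumes "0 < \<theta>" "\<theta> < 1"
  shows "norm (1 - circ \<theta>) = 1 / norm (zeta_line (cot (pi * \<theta>) / 2) - 1)"
proof -
  have nz: "1 - circ \<theta> \<noteq> 0" using one_minus_circ(1)[OF assms] by simp
  have "zeta_line (cot (pi * \<theta>) / 2) - 1 = circ \<theta> / (1 - circ \<theta>)"
    unfolding one_minus_circ(2)[OF assms, symmetric] using nz by (simp add: field_simps)
  then show ?thesis by (simp add: norm_divide)
qed

lemma AE_unit_measure_pos: "AE \<theta> in unit_measure. 0 < \<theta> \<and> \<theta> < 1"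
proof -
  have "AE \<theta> in lborel. \<theta> \<noteq> (0::real)" by (rule AE_lborel_singleton)
  then show ?thesis unfolding AE_unit_measure by eventually_elim auto
qed

lemma integrable_of_square:
  assumes [measurable]: "f \<in> borel_measurable borel"
    and fin: "(\<integral>\<^sup>+\<theta>. ennreal (\<bar>f \<theta>\<bar> ^ 2) \<partial>unit_measure) < \<infinity>"
  shows "integrable unit_measure (f :: real \<Rightarrow> real)"
proof (rule Bochner_Integration.integrable_bound[of _ "\<lambda>\<theta>. 1 + \<bar>f \<theta>\<bar> ^ 2"])
  have "integrable unit_measure (\<lambda>\<theta>. \<bar>f \<theta>\<bar> ^ 2)"
    using fin by (intro integrableI_nonneg) auto
  then show "integrable unit_measure (\<lambda>\<theta>. 1 + \<bar>f \<theta>\<bar> ^ 2)" by simp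
  have "\<bar>x\<bar> \<le> 1 + \<bar>x\<bar> ^ 2" for x :: real
  proof (cases "\<bar>x\<bar> \<le> 1")
    case False
    then have "1 * \<bar>x\<bar> \<le> \<bar>x\<bar> * \<bar>x\<bar>" by (intro mult_right_mono) auto
    then show ?thesis by (simp add: power2_eq_square)
  qed (simp add: add_increasing2)
  then show "AE \<theta> in unit_measure. norm (f \<theta>) \<le> norm (1 + \<bar>f \<theta>\<bar> ^ 2)" by (intro AE_I2) simp
qed simp

definition ln_zeta_angle :: "real \<Rightarrow> real" where
  "ln_zeta_angle \<theta> = ln (norm (zeta (zeta_line (cot (pi * \<theta>) / 2))))"

lemma ln_zeta_angle_measurable [measurable]: "ln_zeta_angle \<in> borel_measurable borel"
  unfolding ln_zeta_angle_def[abs_def] by (rule measurable_compose[OF _ zeta_line_measurable(1)]) measurable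

lemma ln_zeta_angle_integrable: "integrable unit_measure ln_zeta_angle"
  using ln_zeta_finite[of 2] by (intro integrable_of_square) (simp_all add: ln_zeta_angle_def)

lemma circ_measurable [measurable]: "circ \<in> borel_measurable borel"
  by (rule borel_measurable_continuous_onI) (intro continuous_intros)

lemma ln_one_minus_circ_integrable: "integrable unit_measure (\<lambda>\<theta>. ln (norm (1 - circ \<theta>)))"
proof -
  note [measurable] = zeta_line_measurable
  have m [measurable]: "(\<lambda>\<theta>. ln (norm (zeta_line (cot (pi * \<theta>) / 2) - 1))) \<in> borel_measurable borel"
    by (rule measurable_compose[OF _ zeta_line_measurable(2)]) measurable
  have "integrable unit_measure (\<lambda>\<theta>. - ln (norm (zeta_line (cot (pi * \<theta>) / 2) - 1)))"
    by (intro integrable_minus integrable_of_square m ln_line_minus_1_finite)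
  moreover have "AE \<theta> in unit_measure. - ln (norm (zeta_line (cot (pi * \<theta>) / 2) - 1)) = ln (norm (1 - circ \<theta>))"
    using AE_unit_measure_pos
  proof eventually_elim
    case (elim \<theta>)
    then show ?case using zeta_line_ne_1 by (simp add: norm_one_minus_circ ln_div)
  qed
  ultimately show ?thesis
    by (subst (asm) integrable_cong_AE) auto
qed

lemma Re_inverse_one_minus_ge:
  assumes "norm w \<le> 1" "w \<noteq> 1"
  shows "Re (1 / (1 - w)) \<ge> 1/2"
proof -
  have pos: "(norm (1 - w))\<^sup>2 > 0" using assms by simp
  have "(norm w)\<^sup>2 \<le> 1" using assms by (simp add: power_le_one)
  then have "(norm (1 - w))\<^sup>2 \<le> 2 * Re (1 - w)"
    unfolding cmod_power2 by (simp add: power2_eq_square algebra_simps)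
  then have "1/2 \<le> Re (1 - w) / (norm (1 - w))\<^sup>2" using pos by (simp add: field_simps)
  also have "\<dots> = Re (1 / (1 - w))" by (simp add: Re_divide cmod_power2)
  finally show ?thesis .
qed

text \<open>The classical integral of ln |1 - exp (it)|, obtained as another instance of
  \<open>jensen\<close>: the function (1 - w) / 2 is bounded by 1, has no zero in the open disc and
  vanishes only linearly at 1.\<close>

lemma mean_ln_one_minus_circ: "(\<integral>\<theta>. ln (norm (1 - circ \<theta>)) \<partial>unit_measure) = 0"
proof -
  define F where "F = (\<lambda>w::complex. (1 - w) / 2)"
  have split: "AE \<theta> in unit_measure. ln (norm (F (circ \<theta>))) = ln (norm (1 - circ \<theta>)) - ln 2"
    using AE_unit_measure_pos
  proof eventually_elim
    case (elim \<theta>)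
    then show ?case using one_minus_circ(1)[of \<theta>] by (simp add: F_def norm_divide ln_div)
  qed
  have [measurable]: "(\<lambda>\<theta>. ln (norm (F (circ \<theta>)))) \<in> borel_measurable borel" unfolding F_def by measurable
  interpret boundary_singularity F UNIV
  proof
    show "F holomorphic_on UNIV" unfolding F_def by (intro holomorphic_intros) auto
    show "norm (F z) \<le> 1" if "z \<in> cball 0 1 - {1}" for z
      using norm_triangle_ineq4[of 1 z] that by (simp add: F_def norm_divide)
    have "\<forall>\<^sub>F \<delta> in at_right 0. (1/2) * \<delta> ^ 1 \<le> norm (F (of_real (1 - \<delta>)))"
      using eventually_at_right_less[of 0] by eventually_elim (simp add: F_def norm_divide)
    then show "\<exists>c>0. \<exists>m. \<forall>\<^sub>F \<delta> in at_right 0. c * \<delta> ^ m \<le> norm (F (of_real (1 - \<delta>)))"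
      by (intro exI[of _ "1/2"] conjI exI[of _ 1]) auto
    show "integrable unit_measure (\<lambda>\<theta>. ln (norm (F (circ \<theta>))))"
      using ln_one_minus_circ_integrable by (subst integrable_cong_AE[OF _ _ split]) auto
  qed (auto simp: F_def)
  have "zeros = {}" unfolding zeros_def by (auto simp: F_def)
  then have "(\<integral>\<theta>. ln (norm (F (circ \<theta>))) \<partial>unit_measure) = ln (norm (F 0))" using jensen by simp
  moreover have "(\<integral>\<theta>. ln (norm (F (circ \<theta>))) \<partial>unit_measure) = (\<integral>\<theta>. ln (norm (1 - circ \<theta>)) \<partial>unit_measure) - ln 2"
    using ln_one_minus_circ_integrable by (subst integral_cong_AE[OF _ _ split]) auto
  moreover have "ln (norm (F 0)) = - ln 2" by (simp add: F_def ln_div norm_divide)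
  ultimately show ?thesis by simp
qed


section \<open>Zeros in the half plane and in the disc\<close>

lemma right_zeta_zeros_iff: "\<rho> \<in> right_zeta_zeros \<longleftrightarrow> zeta_reg \<rho> = 0 \<and> Re \<rho> > 1 / 2"
proof
  assume "\<rho> \<in> right_zeta_zeros"
  then have "\<rho> \<noteq> 1" "zeta \<rho> = 0" "Re \<rho> > 1/2"
    by (auto simp: right_zeta_zeros_def nontrivial_zeta_zeros_def)
  then show "zeta_reg \<rho> = 0 \<and> Re \<rho> > 1 / 2" by (auto simp: zeta_eq)
next
  assume *: "zeta_reg \<rho> = 0 \<and> Re \<rho> > 1 / 2"
  then have "\<rho> \<noteq> 1" by auto
  moreover have "\<rho> \<noteq> - 2 * of_nat n" for n using * by auto
  ultimately show "\<rho> \<in> right_zeta_zeros"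
    using * by (auto simp: right_zeta_zeros_def nontrivial_zeta_zeros_def zeta_eq)
qed

lemma zeta_reg_eventually_nonzero: "eventually (\<lambda>s. zeta_reg s \<noteq> 0) (at z)"
proof -
  have "eventually (\<lambda>s. zeta_reg s \<noteq> 0 \<and> s \<in> UNIV) (at z)"
    by (rule non_zero_neighbour_alt[OF holomorphic_zeta_reg open_UNIV connected_UNIV UNIV_I, of 1]) auto
  then show ?thesis by simp
qed

lemma zeta_reg_analytic: "zeta_reg analytic_on A"
  using holomorphic_zeta_reg[of UNIV] analytic_on_open[OF open_UNIV] analytic_on_subset by blast

lemma zorder_zeta:
  assumes "s \<noteq> 1"
  shows "zorder zeta s = zorder zeta_reg s"
proof -
  have "zorder zeta s = zorder (\<lambda>z. zeta_reg z * (1 / (z - 1))) s"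
  proof (rule zorder_cong[OF _ refl])
    show "\<forall>\<^sub>F z in at s. zeta z = zeta_reg z * (1 / (z - 1))"
      using eventually_neq_at_within[of 1 s UNIV] by eventually_elim (simp add: zeta_eq)
  qed
  also have "\<dots> = zorder zeta_reg s + zorder (\<lambda>z. 1 / (z - 1)) s"
  proof (rule zorder_times_analytic[OF zeta_reg_analytic])
    show "(\<lambda>z. 1 / (z - 1)) analytic_on {s}" using assms by (auto intro!: analytic_intros)
    show "\<forall>\<^sub>F z in at s. zeta_reg z * (1 / (z - 1)) \<noteq> 0"
      using zeta_reg_eventually_nonzero[of s] eventually_neq_at_within[of 1 s UNIV] by eventually_elim simp
  qed
  also have "zorder (\<lambda>z. 1 / (z - 1)) s = 0"
    by (rule zorder_eq_0I) (use assms in \<open>auto intro!: analytic_intros\<close>)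
  finally show ?thesis by simp
qed

text \<open>The Moebius map has a simple zero of its increment at \<open>b\<close>, and the
  prefactor does not vanish there, so the order is carried over unchanged.\<close>

lemma zorder_zeta_reg_half_plane_to_disc:
  assumes b: "b \<noteq> 1" and M: "M \<noteq> (0::complex)"
  shows "zorder (\<lambda>w. (1 - w)\<^sup>2 / M * zeta_reg (1 / (1 - w))) b = zorder zeta_reg (1 / (1 - b))"
proof -
  define m where "m = (\<lambda>w::complex. 1 / (1 - w))"
  have m_ana: "m analytic_on {b}" unfolding m_def using b by (auto intro!: analytic_intros)
  have m_inj: "\<forall>\<^sub>F w in at b. m w \<noteq> m b"
    using eventually_neq_at_within[of b b UNIV] eventually_neq_at_within[of 1 b UNIV]
    by eventually_elim (use b in \<open>auto simp: m_def\<close>)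
  have "(m \<longlongrightarrow> m b) (at b)" using analytic_at_imp_isCont[OF m_ana] by (simp add: isCont_def)
  then have "filterlim m (at (m b)) (at b)" using m_inj by (rule filterlim_atI)
  then have nz: "\<forall>\<^sub>F w in at b. zeta_reg (m w) \<noteq> 0"
    by (rule eventually_compose_filterlim[OF zeta_reg_eventually_nonzero])
  have "zorder (\<lambda>x. m x - m b) b = 1"
  proof (rule zorder_eqI[of "- {1}" _ "\<lambda>x. 1 / ((1 - x) * (1 - b))"])
    fix w :: complex assume "w \<in> - {1}"
    then show "m w - m b = 1 / ((1 - w) * (1 - b)) * (w - b) powi 1"
      using b by (simp add: m_def field_simps)
  qed (use b in \<open>auto intro!: holomorphic_intros\<close>)
  then have comp: "zorder (zeta_reg \<circ> m) b = zorder zeta_reg (m b)"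
    using zorder_compose'[OF isolated_singularity_at_analytic[OF zeta_reg_analytic]
        not_essential_analytic[OF zeta_reg_analytic] m_ana zeta_reg_eventually_nonzero m_inj] by simp
  have "zorder (\<lambda>w. (1 - w)\<^sup>2 / M * (zeta_reg \<circ> m) w) b = zorder (\<lambda>w. (1 - w)\<^sup>2 / M) b + zorder (zeta_reg \<circ> m) b"
  proof (rule zorder_times_analytic)
    show "(\<lambda>w. (1 - w)\<^sup>2 / M) analytic_on {b}" using M by (auto intro!: analytic_intros)
    show "(zeta_reg \<circ> m) analytic_on {b}" by (rule analytic_on_compose[OF m_ana zeta_reg_analytic])
    show "\<forall>\<^sub>F w in at b. (1 - w)\<^sup>2 / M * (zeta_reg \<circ> m) w \<noteq> 0"
      using nz eventually_neq_at_within[of 1 b UNIV] by eventually_elim (use M in auto)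
  qed
  also have "zorder (\<lambda>w. (1 - w)\<^sup>2 / M) b = 0"
    by (rule zorder_eq_0I) (use b M in \<open>auto intro!: analytic_intros\<close>)
  finally show ?thesis using comp by (simp add: m_def o_def)
qed

text \<open>On Re s >= 1/2 also |s| >= 1/2, so that |s|^2 absorbs the constant and linear terms of
  \<open>zeta_reg_bound\<close>.\<close>

lemma zeta_reg_quadratic_bound:
  obtains M :: real where "M > 0" "\<And>s. Re s \<ge> 1/2 \<Longrightarrow> norm (zeta_reg s) \<le> M * (norm s)\<^sup>2"
proof -
  obtain C where C: "C > 0" and C_bound: "\<And>s. Re s \<ge> 1/4 \<Longrightarrow> norm (zeta_reg s - 1) \<le> C * norm s * norm (s - 1)"
    by (rule zeta_reg_bound) (rule that; assumption)
  have "norm (zeta_reg s) \<le> (4 + 3 * C) * (norm s)\<^sup>2" if s: "Re s \<ge> 1/2" for s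
  proof -
    have ns: "norm s \<ge> 1/2" using complex_Re_le_cmod[of s] s by linarith
    then have "(1/2)\<^sup>2 \<le> (norm s)\<^sup>2" by (intro power_mono) auto
    then have 1: "1 \<le> 4 * (norm s)\<^sup>2" by (simp add: power2_eq_square)
    have 3: "norm (s - 1) \<le> 3 * norm s"
    proof -
      have "norm (s - 1) \<le> norm s + 1" using norm_triangle_ineq4[of s 1] by simp
      moreover have "1 \<le> 2 * norm s" using ns by simp
      ultimately show ?thesis by simp
    qed
    have "norm (zeta_reg s) \<le> 1 + norm (zeta_reg s - 1)" using norm_triangle_ineq[of 1 "zeta_reg s - 1"] by simp
    also have "norm (zeta_reg s - 1) \<le> C * norm s * norm (s - 1)" by (rule C_bound) (use s in simp)
    also have "\<dots> \<le> C * norm s * (3 * norm s)" using 3 C by (intro mult_left_mono) auto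
    also have "1 \<le> 4 * (norm s)\<^sup>2" by (rule 1)
    finally show ?thesis by (simp add: power2_eq_square algebra_simps)
  qed
  then show thesis using C by (intro that[of "4 + 3 * C"]) auto
qed

text \<open>On the circle |s - 1| = 1 / |1 - w|, so the factor s - 1 cancels one of the two factors
  1 - w, and the other has logarithmic mean 0. The point w = 0 corresponds to s = 1, where
  \<open>zeta_reg\<close> is 1; hence -ln M occurs both in the mean and in the value at 0 and drops
  out. A zero \<rho> corresponds to w = 1 - 1/\<rho>, for which -ln |w| = ln |\<rho> / (1 -
  \<rho>)|.\<close>

theorem mean_ln_zeta:
  "zeta_zero_term summable_on right_zeta_zeros"
  "(\<integral>\<theta>. ln_zeta_angle \<theta> \<partial>unit_measure) = (\<Sum>\<^sub>\<infinity>\<rho>\<in>right_zeta_zeros. zeta_zero_term \<rho>)"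
proof -
  obtain M :: real where M: "M > 0" and M_bound: "\<And>s. Re s \<ge> 1/2 \<Longrightarrow> norm (zeta_reg s) \<le> M * (norm s)\<^sup>2"
    by (rule zeta_reg_quadratic_bound) (rule that; assumption)
  define F where "F = (\<lambda>w. (1 - w)\<^sup>2 / of_real M * zeta_reg (1 / (1 - w)))"
  have F_hol: "F holomorphic_on - {1}"
  proof -
    have "zeta_reg \<circ> (\<lambda>w. 1 / (1 - w)) holomorphic_on - {1}"
      by (rule holomorphic_on_compose_gen[OF _ holomorphic_zeta_reg[of UNIV]]) (auto intro!: holomorphic_intros)
    then show ?thesis using M unfolding F_def o_def by (intro holomorphic_intros) auto
  qed
  have F_zero_iff: "F w = 0 \<longleftrightarrow> zeta_reg (1 / (1 - w)) = 0" if "w \<noteq> 1" for w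
    using that M by (simp add: F_def)
  have AE_eq: "AE \<theta> in unit_measure. ln (norm (F (circ \<theta>))) = ln_zeta_angle \<theta> + ln (norm (1 - circ \<theta>)) - ln M"
  proof -
    \<comment> \<open>Zeros on the circle might accumulate at 1; countability is enough for a null
      set of angles.\<close>
    have "countable {z \<in> - {1}. F z = 0}"
    proof (cases "F constant_on - {1}")
      case True
      moreover have "F 0 \<noteq> 0" using M by (simp add: F_def)
      ultimately have "{z \<in> - {1}. F z = 0} = {}" unfolding constant_on_def by force
      then show ?thesis by (simp only: countable_empty)
    next
      case False
      have "connected (- {1 :: complex})"
        using connected_open_delete[OF open_UNIV connected_UNIV, of "1::complex"] by (simp add: Compl_eq_Diff_UNIV)
      moreover have "fsigma (- {1 :: complex})"
      proof -
        have "open (- {1 :: complex})" by (simp add: open_Compl)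
        then obtain C where "\<forall>n::nat. compact (C n)" "\<Union> (range C) = - {1 :: complex}"
          by (metis open_Union_compact_subsets)
        then show ?thesis by (metis compact_imp_closed fsigma.intros)
      qed
      ultimately show ?thesis
        by (intro holomorphic_countable_zeros[OF F_hol _ _ _ False]) (auto simp: open_Compl)
    qed
    then have "countable (circ ` {\<theta>\<in>{0<..<1}. F (circ \<theta>) = 0})"
      by (rule countable_subset[rotated]) (use one_minus_circ(1) in auto)
    then have "countable {\<theta>\<in>{0<..<1}. F (circ \<theta>) = 0}"
      by (rule countable_image_inj_on) (auto intro!: inj_onI circ_inj)
    then have "AE \<theta> in lborel. \<theta> \<notin> {\<theta>\<in>{0<..<1}. F (circ \<theta>) = 0}"
      by (intro AE_not_in countable_imp_null_set_lborel)
    then have "AE \<theta> in unit_measure. \<theta> \<notin> {\<theta>\<in>{0<..<1}. F (circ \<theta>) = 0}"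
      unfolding AE_unit_measure by eventually_elim auto
    with AE_unit_measure_pos show ?thesis
    proof eventually_elim
      case (elim \<theta>)
      define s where "s = zeta_line (cot (pi * \<theta>) / 2)"
      have \<theta>: "0 < \<theta>" "\<theta> < 1" using elim by auto
      note oc = one_minus_circ[OF \<theta>] norm_one_minus_circ[OF \<theta>]
      have s1: "s \<noteq> 1" unfolding s_def by (rule zeta_line_ne_1)
      have nz: "zeta_reg s \<noteq> 0" using elim oc F_zero_iff[of "circ \<theta>"] by (auto simp: s_def)
      have d: "norm (1 - circ \<theta>) > 0" using oc(1) by simp
      have "norm (F (circ \<theta>)) = (norm (1 - circ \<theta>))\<^sup>2 / M * norm (zeta_reg s)"
        using M by (simp add: F_def oc(2) s_def norm_mult norm_divide norm_power)
      then have "ln (norm (F (circ \<theta>))) = 2 * ln (norm (1 - circ \<theta>)) - ln M + ln (norm (zeta_reg s))"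
        using d nz M by (simp add: ln_mult ln_div ln_realpow)
      moreover have "ln (norm (1 - circ \<theta>)) = - ln (norm (s - 1))"
        using s1 by (simp add: oc(3) s_def[symmetric] ln_div)
      moreover have "ln_zeta_angle \<theta> = ln (norm (zeta_reg s)) - ln (norm (s - 1))"
        using s1 nz by (simp add: ln_zeta_angle_def s_def[symmetric] zeta_eq norm_divide ln_div)
      ultimately show ?case by simp
    qed
  qed
  have int_rhs: "integrable unit_measure (\<lambda>\<theta>. ln_zeta_angle \<theta> + ln (norm (1 - circ \<theta>)) - ln M)"
    using ln_zeta_angle_integrable ln_one_minus_circ_integrable by simp
  have [measurable]: "zeta_reg \<in> borel_measurable borel"
    by (intro borel_measurable_continuous_onI holomorphic_on_imp_continuous_on holomorphic_zeta_reg)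
  have F_meas: "(\<lambda>\<theta>. ln (norm (F (circ \<theta>)))) \<in> borel_measurable unit_measure"
    unfolding F_def by measurable
  interpret boundary_singularity F "- {1}"
  proof
    show "norm (F z) \<le> 1" if "z \<in> cball 0 1 - {1}" for z
    proof -
      have z: "norm z \<le> 1" "z \<noteq> 1" using that by auto
      have d: "norm (1 - z) > 0" using z by simp
      have "norm (zeta_reg (1 / (1 - z))) \<le> M * (norm (1 / (1 - z)))\<^sup>2"
        by (rule M_bound[OF Re_inverse_one_minus_ge[OF z]])
      then have "(norm (1 - z))\<^sup>2 / M * norm (zeta_reg (1 / (1 - z))) \<le> (norm (1 - z))\<^sup>2 / M * (M * (norm (1 / (1 - z)))\<^sup>2)"
        using M by (intro mult_left_mono) auto
      also have "\<dots> = 1" using M d by (simp add: norm_divide power_divide)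
      finally show ?thesis using M by (simp add: F_def norm_mult norm_divide norm_power)
    qed
    \<comment> \<open>Radially s = 1 / \<delta> is real and tends to infinity. For s >= 2 one has
      |zeta_reg s| >= (s - 1) / 4 >= s / 8, and multiplication by \<delta>^2 / M leaves \<delta> /
      (8 M).\<close>
    have "\<forall>\<^sub>F \<delta> in at_right 0. 1 / (8 * M) * \<delta> ^ 1 \<le> norm (F (of_real (1 - \<delta>)))"
    proof -
      have "\<forall>\<^sub>F \<delta> in at_right (0::real). \<delta> \<in> {0<..<1/2}" by (rule eventually_at_right_real) simp
      then show ?thesis
      proof eventually_elim
        case (elim \<delta>)
        define x where "x = 1 / \<delta>"
        have x: "x \<ge> 2" using elim by (simp add: x_def field_simps)
        have "zeta_reg (of_real x) = (of_real x - 1) * zeta_series (of_real x)"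
          by (rule zeta_reg_eq_series) (use x in simp)
        moreover have "norm (zeta_series (of_real x)) \<ge> 1/4" by (rule norm_zeta_series_ge) (use x in simp)
        moreover have "norm (of_real x - 1 :: complex) = x - 1"
          using x by (metis abs_of_nonneg diff_ge_0_iff_ge norm_of_real of_real_1 of_real_diff order.trans one_le_numeral)
        ultimately have "(x - 1) * (1/4) \<le> norm (zeta_reg (of_real x))"
          using x by (simp only: norm_mult) (intro mult_left_mono, auto)
        moreover have "x / 8 \<le> (x - 1) * (1/4)" using x by (simp add: field_simps)
        ultimately have "x / 8 \<le> norm (zeta_reg (of_real x))" by (rule order.trans[rotated])
        then have "\<delta>\<^sup>2 / M * (x / 8) \<le> \<delta>\<^sup>2 / M * norm (zeta_reg (of_real x))"
          using M by (intro mult_left_mono) auto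
        moreover have "\<delta>\<^sup>2 / M * (x / 8) = 1 / (8 * M) * \<delta> ^ 1"
          using elim by (simp add: x_def power2_eq_square)
        moreover have "norm (F (of_real (1 - \<delta>))) = \<delta>\<^sup>2 / M * norm (zeta_reg (of_real x))"
          using M elim by (simp add: F_def x_def norm_mult norm_divide norm_power)
        ultimately show ?case by simp
      qed
    qed
    then show "\<exists>c>0. \<exists>m. \<forall>\<^sub>F \<delta> in at_right 0. c * \<delta> ^ m \<le> norm (F (of_real (1 - \<delta>)))"
      using M by (intro exI[of _ "1 / (8 * M)"] conjI exI[of _ 1]) auto
    show "integrable unit_measure (\<lambda>\<theta>. ln (norm (F (circ \<theta>))))"
      using int_rhs by (subst integrable_cong_AE[OF F_meas _ AE_eq]) auto
    show "F 0 \<noteq> 0" using M by (simp add: F_def)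
  qed (use F_hol in auto)
  define \<phi> where "\<phi> = (\<lambda>\<rho>::complex. 1 - 1 / \<rho>)"
  have bij: "bij_betw \<phi> right_zeta_zeros zeros"
  proof (rule bij_betw_byWitness[where f' = "\<lambda>w. 1 / (1 - w)"])
    have ne0: "\<rho> \<noteq> 0" if "\<rho> \<in> right_zeta_zeros" for \<rho> using that by (auto simp: right_zeta_zeros_iff)
    show "\<forall>\<rho>\<in>right_zeta_zeros. 1 / (1 - \<phi> \<rho>) = \<rho>" using ne0 by (simp add: \<phi>_def)
    show "\<forall>w\<in>zeros. \<phi> (1 / (1 - w)) = w" by (auto simp: \<phi>_def)
    show "\<phi> ` right_zeta_zeros \<subseteq> zeros"
    proof
      fix w assume "w \<in> \<phi> ` right_zeta_zeros"
      then obtain \<rho> where \<rho>: "\<rho> \<in> right_zeta_zeros" "w = \<phi> \<rho>" by auto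
      have r: "\<rho> \<noteq> 0" "Re \<rho> > 1/2" "zeta_reg \<rho> = 0" using \<rho>(1) ne0 by (auto simp: right_zeta_zeros_iff)
      have w: "1 / (1 - w) = \<rho>" "w \<noteq> 1" using r(1) by (auto simp: \<rho>(2) \<phi>_def)
      have "(norm (\<rho> - 1))\<^sup>2 < (norm \<rho>)\<^sup>2"
        using r(2) unfolding cmod_power2 by (simp add: power2_eq_square algebra_simps)
      then have "norm (\<rho> - 1) < norm \<rho>" by (rule power2_less_imp_less) simp
      moreover have "w = (\<rho> - 1) / \<rho>" using r(1) by (simp add: \<rho>(2) \<phi>_def diff_divide_distrib)
      ultimately have "norm w < 1" using r(1) by (simp add: norm_divide)
      then show "w \<in> zeros" unfolding zeros_def using F_zero_iff[OF w(2)] w(1) r(3) by simp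
    qed
    show "(\<lambda>w. 1 / (1 - w)) ` zeros \<subseteq> right_zeta_zeros"
    proof
      fix \<rho> assume "\<rho> \<in> (\<lambda>w. 1 / (1 - w)) ` zeros"
      then obtain w where w: "norm w < 1" "F w = 0" "\<rho> = 1 / (1 - w)" unfolding zeros_def by auto
      have w1: "w \<noteq> 1" using w(1) by auto
      have pos: "(norm (1 - w))\<^sup>2 > 0" using w1 by simp
      have "(norm w)\<^sup>2 < 1" using w(1) by (simp add: abs_square_less_1)
      then have "(norm (1 - w))\<^sup>2 < 2 * Re (1 - w)"
        unfolding cmod_power2 by (simp add: power2_eq_square algebra_simps)
      then have "1/2 < Re (1 - w) / (norm (1 - w))\<^sup>2" using pos by (simp add: field_simps)
      also have "\<dots> = Re \<rho>" by (simp add: w(3) Re_divide cmod_power2)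
      finally show "\<rho> \<in> right_zeta_zeros"
        using F_zero_iff[OF w1] w by (simp add: right_zeta_zeros_iff)
    qed
  qed
  have weight_eq: "weight (\<phi> \<rho>) = zeta_zero_term \<rho>" if "\<rho> \<in> right_zeta_zeros" for \<rho>
  proof -
    have r: "\<rho> \<noteq> 0" "zeta_reg \<rho> = 0" using that by (auto simp: right_zeta_zeros_iff)
    then have r1: "\<rho> \<noteq> 1" by auto
    have b: "\<phi> \<rho> \<noteq> 1" "1 / (1 - \<phi> \<rho>) = \<rho>" using r by (auto simp: \<phi>_def)
    have "zorder F (\<phi> \<rho>) = zorder zeta_reg (1 / (1 - \<phi> \<rho>))"
      unfolding F_def by (rule zorder_zeta_reg_half_plane_to_disc[OF b(1)]) (use M in simp)
    then have "zorder F (\<phi> \<rho>) = zorder zeta \<rho>" using zorder_zeta[OF r1] b by simp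
    moreover have "\<phi> \<rho> = (\<rho> - 1) / \<rho>" using r(1) by (simp add: \<phi>_def diff_divide_distrib)
    then have "- ln (norm (\<phi> \<rho>)) = ln (norm (\<rho> / (1 - \<rho>)))"
      using r r1 by (simp add: norm_divide ln_div norm_minus_commute)
    ultimately show ?thesis by (simp add: weight_def zeta_zero_term_def)
  qed
  have "weight \<circ> \<phi> summable_on right_zeta_zeros"
    using summable_on_reindex_bij_betw[OF bij, of weight] weight_summable by (simp add: o_def)
  then show "zeta_zero_term summable_on right_zeta_zeros"
    by (rule summable_on_cong[THEN iffD1, rotated]) (simp add: weight_eq)
  have "(\<Sum>\<^sub>\<infinity>\<rho>\<in>right_zeta_zeros. zeta_zero_term \<rho>) = (\<Sum>\<^sub>\<infinity>\<rho>\<in>right_zeta_zeros. weight (\<phi> \<rho>))"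
    by (rule infsum_cong) (simp add: weight_eq)
  also have "\<dots> = (\<Sum>\<^sub>\<infinity>b\<in>zeros. weight b)" by (rule infsum_reindex_bij_betw[OF bij])
  also have "\<dots> = (\<integral>\<theta>. ln (norm (F (circ \<theta>))) \<partial>unit_measure) - ln (norm (F 0))" using jensen by simp
  also have "ln (norm (F 0)) = - ln M" using M by (simp add: F_def norm_divide ln_div)
  also have "(\<integral>\<theta>. ln (norm (F (circ \<theta>))) \<partial>unit_measure) =
      (\<integral>\<theta>. ln_zeta_angle \<theta> + ln (norm (1 - circ \<theta>)) - ln M \<partial>unit_measure)"
    by (rule integral_cong_AE[OF F_meas _ AE_eq]) (use int_rhs in auto)
  also have "\<dots> = (\<integral>\<theta>. ln_zeta_angle \<theta> \<partial>unit_measure) - ln M"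
    using ln_zeta_angle_integrable ln_one_minus_circ_integrable by (simp add: mean_ln_one_minus_circ)
  finally show "(\<integral>\<theta>. ln_zeta_angle \<theta> \<partial>unit_measure) = (\<Sum>\<^sub>\<infinity>\<rho>\<in>right_zeta_zeros. zeta_zero_term \<rho>)"
    by simp
qed

section \<open>The cotangent as a semiconjugacy, and the return to the real line\<close>

lemma cot_double: "cot (2 * x) = boole_map (cot x)" for x :: real
proof (cases "sin x = 0 \<or> cos x = 0")
  \<comment> \<open>Here cot x = 0, as a true value or as a quotient by 0, and cot (2 x) is a
    quotient by 0 as well; this agrees with \<open>boole_map 0 = 0\<close>.\<close>
  case True
  then show ?thesis by (auto simp: cot_def sin_double boole_map_def)
next
  case False
  have "cot (2 * x) = ((cos x)\<^sup>2 - (sin x)\<^sup>2) / (2 * sin x * cos x)"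
    by (simp only: cot_def sin_double cos_double)
  also have "\<dots> = (cot x - 1 / cot x) / 2"
    using False unfolding cot_def by (simp add: power2_eq_square field_simps)
  finally show ?thesis using False by (simp add: boole_map_def cot_def)
qed

lemma cot_doubling: "cot (pi * doubling \<theta>) = boole_map (cot (pi * \<theta>))"
proof -
  define m where "m = \<lfloor>2 * \<theta>\<rfloor>"
  have "pi * doubling \<theta> = 2 * (pi * \<theta>) - of_int m * pi"
    by (simp add: doubling_def frac_def m_def algebra_simps)
  moreover have "sin (of_int m * pi) = 0" by (simp add: sin_zero_iff_int2)
  moreover from this have "cos (of_int m * pi) \<noteq> 0" using sin_zero_abs_cos_one[of "of_int m * pi"] by auto
  ultimately have "cot (pi * doubling \<theta>) = cot (2 * (pi * \<theta>))"
    by (simp only: cot_def sin_diff cos_diff) simp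
  then show ?thesis by (simp add: cot_double)
qed

text \<open>Valid for every angle, with no exceptional orbits, because division by 0 matches the
  value of \<open>boole_map\<close> at 0.\<close>

lemma cot_doubling_funpow: "cot (pi * (doubling ^^ n) \<theta>) = (boole_map ^^ n) (cot (pi * \<theta>))"
  by (induction n) (simp_all add: cot_doubling)

text \<open>The exceptional angles are only known to lie in a null set \<open>N\<close>. The
  cotangent is differentiable on (0, 1), hence maps the part of \<open>N\<close> there to a
  negligible set; as it is onto the real line, this image contains all exceptional
  \<open>x\<close>.\<close>

lemma AE_lebesgue_of_AE_cot:
  assumes "AE \<theta> in unit_measure. P (cot (pi * \<theta>))"
  shows "AE x in lebesgue. P x"
proof -
  obtain N where N: "N \<in> null_sets lborel" "{\<theta>. \<not> (\<theta> \<in> {0..<1} \<longrightarrow> P (cot (pi * \<theta>)))} \<subseteq> N"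
    using assms[unfolded AE_unit_measure] unfolding eventually_ae_filter by auto
  define g :: "real \<Rightarrow> real" where "g = (\<lambda>\<theta>. cot (pi * \<theta>))"
  have "N \<in> null_sets lebesgue" using N(1) by (simp add: null_sets_completionI)
  then have "negligible (N \<inter> {0<..<1})" by (metis negligible_iff_null_sets negligible_Int)
  moreover have "g differentiable_on (N \<inter> {0<..<1})"
  proof -
    have "g differentiable at \<theta>" if "0 < \<theta>" "\<theta> < 1" for \<theta>
    proof -
      have "sin (pi * \<theta>) > 0" using that by (intro sin_gt_zero) auto
      then have "(g has_real_derivative - inverse ((sin (pi * \<theta>))\<^sup>2) * pi) (at \<theta>)"
        unfolding g_def by (intro DERIV_chain2[OF DERIV_cot DERIV_cmult_Id]) auto
      then show ?thesis unfolding real_differentiable_def by (rule exI)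
    qed
    then show ?thesis by (auto simp: differentiable_on_def intro: differentiable_at_withinI)
  qed
  ultimately have "negligible (g ` (N \<inter> {0<..<1}))"
    by (intro negligible_differentiable_image_negligible) auto
  then have null: "g ` (N \<inter> {0<..<1}) \<in> null_sets lebesgue" by (simp add: negligible_iff_null_sets)
  have "{x. \<not> P x} \<subseteq> g ` (N \<inter> {0<..<1})"
  proof
    fix x assume x: "x \<in> {x. \<not> P x}"
    \<comment> \<open>The argument \<open>- x / 2\<close> undoes both the factor 1/2 and the sign in
      \<open>cot_cauchy_quantile\<close>.\<close>
    define \<theta> where "\<theta> = cauchy_quantile (- x / 2)"
    have gx: "g \<theta> = x" using cot_cauchy_quantile[of "- x / 2"] by (simp add: g_def \<theta>_def)
    have "- (1/2) < arctan (2 * (- x / 2)) / pi" "arctan (2 * (- x / 2)) / pi < 1/2"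
      using arctan_lbound[of "2 * (- x / 2)"] arctan_ubound[of "2 * (- x / 2)"]
      by (simp_all add: field_simps)
    then have "0 < \<theta>" "\<theta> < 1" unfolding \<theta>_def cauchy_quantile_def by linarith+
    moreover have "\<theta> \<in> N" using N(2) calculation gx x by (auto simp: g_def)
    ultimately show "x \<in> g ` (N \<inter> {0<..<1})" using gx by (intro image_eqI[of _ _ \<theta>]) auto
  qed
  then show ?thesis by (intro AE_I'[OF null]) auto
qed

theorem theorem2p4:
  fixes k :: "nat \<Rightarrow> nat" and p :: real
  assumes "p > 1"
    and "hartman_uniformly_distributed k"
    and "Lp_good_universal p k"
  shows "zeta_zero_term summable_on right_zeta_zeros \<and>
    (AE x in lebesgue.
      (\<lambda>N. (\<Sum>n=1..N.
              ln (norm (zeta (1 / 2 + 1 / 2 * \<i> * of_real ((boole_map ^^ k n) x))))) / real N)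
        \<longlonglongrightarrow> (\<Sum>\<^sub>\<infinity>\<rho>\<in>right_zeta_zeros. zeta_zero_term \<rho>))"
proof
  show "zeta_zero_term summable_on right_zeta_zeros" by (rule mean_ln_zeta(1))
  \<comment> \<open>An even integer that is at least \<open>p\<close>: evenness serves the convexity
    argument in the local estimate, and t^p <= 1 + t^q for t >= 0 passes from \<open>q\<close> to
    \<open>p\<close>.\<close>
  define q where "q = 2 * nat \<lceil>p\<rceil>"
  have q: "even q" "q > 0" "p \<le> real q"
  proof -
    have "p \<le> real (nat \<lceil>p\<rceil>)" by (rule real_nat_ceiling_ge)
    moreover have "real (nat \<lceil>p\<rceil>) \<le> real q" by (simp add: q_def)
    ultimately show "p \<le> real q" by linarith
    then show "q > 0" using assms(1) by (cases q) auto
  qed (simp add: q_def)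
  have "integrable unit_measure (\<lambda>\<theta>. \<bar>ln_zeta_angle \<theta>\<bar> powr p)"
  proof (rule Bochner_Integration.integrable_bound[of _ "\<lambda>\<theta>. 1 + \<bar>ln_zeta_angle \<theta>\<bar> ^ q"])
    have "integrable unit_measure (\<lambda>\<theta>. \<bar>ln_zeta_angle \<theta>\<bar> ^ q)"
      using ln_zeta_finite[OF q(1,2), folded ln_zeta_angle_def] by (intro integrableI_nonneg) auto
    then show "integrable unit_measure (\<lambda>\<theta>. 1 + \<bar>ln_zeta_angle \<theta>\<bar> ^ q)" by simp
    have "t powr p \<le> 1 + t ^ q" if "t \<ge> 0" for t :: real
    proof (cases "t \<le> 1")
      case True
      then have "t powr p \<le> 1" using that assms(1) by (simp add: powr_le1)
      then show ?thesis using that by (simp add: add_increasing2)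
    next
      case False
      then have "t powr p \<le> t powr real q" using q by (intro powr_mono) auto
      then show ?thesis using False by (simp add: powr_realpow)
    qed
    then show "AE \<theta> in unit_measure. norm (\<bar>ln_zeta_angle \<theta>\<bar> powr p) \<le> norm (1 + \<bar>ln_zeta_angle \<theta>\<bar> ^ q)"
      by (intro AE_I2) (simp add: abs_of_nonneg add_nonneg_nonneg)
  qed measurable
  from doubling_good_universal_limit[OF assms ln_zeta_angle_measurable this]
  have "AE \<theta> in unit_measure. (\<lambda>N. (\<Sum>n=1..N. ln_zeta_angle ((doubling ^^ k n) \<theta>)) / real N)
      \<longlonglongrightarrow> (\<Sum>\<^sub>\<infinity>\<rho>\<in>right_zeta_zeros. zeta_zero_term \<rho>)"
    by (simp only: mean_ln_zeta(2))
  moreover have "ln_zeta_angle ((doubling ^^ n) \<theta>) =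
      ln (norm (zeta (1 / 2 + 1 / 2 * \<i> * of_real ((boole_map ^^ n) (cot (pi * \<theta>))))))" for n \<theta>
    by (simp add: ln_zeta_angle_def zeta_line_def cot_doubling_funpow)
  ultimately show "AE x in lebesgue.
      (\<lambda>N. (\<Sum>n=1..N.
              ln (norm (zeta (1 / 2 + 1 / 2 * \<i> * of_real ((boole_map ^^ k n) x))))) / real N)
        \<longlonglongrightarrow> (\<Sum>\<^sub>\<infinity>\<rho>\<in>right_zeta_zeros. zeta_zero_term \<rho>)"
    by (intro AE_lebesgue_of_AE_cot) (simp only:)
qed

end
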